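(* Let $(\Gamma,c)$ be a real Fuchsian group with $X_\Gamma$ compact. Then the graph $\Xi_\Gamma$ (viewed as a topological space, an edge with no vertices being a circle) is homeomorphic to $X_\Gamma(\mathbf{R})$, via a homeomorphism that is the identity on the vertex set and maps the interior of the edge corresponding to an admissible $\gamma$ homeomorphically onto the interior of $\pi(C_\gamma)$.
   Context: $\mathfrak{h}$ is the upper half-plane. A complex conjugation is an anti-holomorphic involution $c$ of $\mathfrak{h}$; for $\gamma\in\mathrm{PSL}_2(\mathbf{R})$, $\gamma^c$ denotes the element acting as $c\gamma c$. A real Fuchsian group is a pair $(\Gamma,c)$ with $\Gamma\subseteq\mathrm{PSL}_2(\mathbf{R})$ discrete, $c$ a complex conjugation and $\Gamma^c=\Gamma$. Let $\mathfrak{h}^*$ be $\mathfrak{h}$ with the cusps of $\Gamma$ adjoined, $X_\Gamma=\mathfrak{h}^*/\Gamma$, $\pi:\mathfrak{h}^*\to X_\Gamma$ the quotient map; $c$ descends to an involution of $X_\Gamma$ whose fixed locus is $X_\Gamma(\mathbf{R})$. An element $\gamma\in\Gamma$ is admissible if $\gamma^c=\gamma^{-1}$; $\gamma,\gamma'$ are twisted conjugate if $\gamma=\delta^c\gamma'\delta^{-1}$ for some $\delta\in\Gamma$; $C_\gamma=\{z\in\mathfrak{h}^*:\gamma z=cz\}$. A special point is a point of $X_\Gamma(\mathbf{R})$ that is a cusp or an elliptic point of even order (image of a point of $\mathfrak{h}$ whose stabilizer in $\Gamma$ has even order). The graph $\Xi_\Gamma$ has vertex set the set of special points and edge set the set of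 twisted conjugacy classes of admissible elements. A special point $z$ lies on the edge of $\gamma$ if $z\in\pi(C_\gamma)$; that edge is a loop at $z$ iff $\pi(C_\gamma)$ contains an open neighbourhood of $z$ in $X_\Gamma(\mathbf{R})$; an edge containing no special points is a circle. (Each edge contains either no special point, or is a loop at one special point, or joins two distinct special points.) *)

theory Defs
  imports "HOL-Analysis.Analysis"
begin

datatype hpt = Pt complex | Inf

type_synonym mat2 = "real \<times> real \<times> real \<times> real"  \<comment> \<open>(a,b,c,d) = [[a,b],[c,d]]\<close>

definition mdet :: "mat2 \<Rightarrow> real" where
  "mdet M = (case M of (a,b,c,d) \<Rightarrow> a*d - b*c)"

definition SL2 :: "mat2 set" where
  "SL2 = {M. mdet M = 1}"

definition mob :: "mat2 \<Rightarrow> hpt \<Rightarrow> hpt" where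
  "mob M w = (case M of (a,b,c,d) \<Rightarrow>
     (case w of
        Pt z \<Rightarrow> (if of_real c * z + of_real d = 0 then Inf
                  else Pt ((of_real a * z + of_real b) / (of_real c * z + of_real d)))
      | Inf \<Rightarrow> (if c = 0 then Inf else Pt (of_real (a / c)))))"

definition conjh :: "hpt \<Rightarrow> hpt" where
  "conjh w = (case w of Pt z \<Rightarrow> Pt (cnj z) | Inf \<Rightarrow> Inf)"

definition antimob :: "mat2 \<Rightarrow> hpt \<Rightarrow> hpt" where
  "antimob M = mob M \<circ> conjh"

text \<open>PSL_2(R), identified with its (faithful) action on the Riemann sphere.\<close>
definition PSL2 :: "(hpt \<Rightarrow> hpt) set" where
  "PSL2 = mob ` SL2"

definition uhp :: "hpt set" where
  "uhp = {Pt z | z. Im z > 0}"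

definition bdry :: "hpt set" where
  "bdry = insert Inf {Pt (of_real x) | x. True}"

definition parabolic :: "(hpt \<Rightarrow> hpt) \<Rightarrow> bool" where
  "parabolic g \<longleftrightarrow> g \<noteq> id \<and>
     (\<exists>a b c d. (a,b,c,d) \<in> SL2 \<and> g = mob (a,b,c,d) \<and> \<bar>a + d\<bar> = 2)"

text \<open>Discreteness of a subset of PSL_2(R) (quotient topology of SL_2(R) \<subseteq> R^4):
  every element is isolated.\<close>
definition discrete_psl :: "(hpt \<Rightarrow> hpt) set \<Rightarrow> bool" where
  "discrete_psl G \<longleftrightarrow> (\<forall>M\<in>SL2. mob M \<in> G \<longrightarrow>
      (\<exists>\<epsilon>>0. \<forall>N\<in>SL2. mob N \<in> G \<and> dist N M < \<epsilon> \<longrightarrow> mob N = mob M))"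

definition fuchsian :: "(hpt \<Rightarrow> hpt) set \<Rightarrow> bool" where
  "fuchsian G \<longleftrightarrow> G \<subseteq> PSL2 \<and> id \<in> G \<and> (\<forall>g\<in>G. \<forall>h\<in>G. g \<circ> h \<in> G)
      \<and> (\<forall>g\<in>G. inv g \<in> G) \<and> discrete_psl G"

text \<open>A complex conjugation: an anti-holomorphic involution of h. Every anti-holomorphic
  automorphism of h is z \<mapsto> (a conj z + b)/(c conj z + d) with ad - bc = -1; we record it
  together with its extension to the boundary.\<close>
definition cplx_conjugation :: "(hpt \<Rightarrow> hpt) \<Rightarrow> bool" where
  "cplx_conjugation c \<longleftrightarrow> (\<exists>M. mdet M = -1 \<and> c = antimob M) \<and> c \<circ> c = id"

definition twist :: "(hpt \<Rightarrow> hpt) \<Rightarrow> (hpt \<Rightarrow> hpt) \<Rightarrow> (hpt \<Rightarrow> hpt)" where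
  "twist c g = c \<circ> g \<circ> c"

definition real_fuchsian :: "(hpt \<Rightarrow> hpt) set \<Rightarrow> (hpt \<Rightarrow> hpt) \<Rightarrow> bool" where
  "real_fuchsian G c \<longleftrightarrow> fuchsian G \<and> cplx_conjugation c \<and> twist c ` G = G"

definition cusps :: "(hpt \<Rightarrow> hpt) set \<Rightarrow> hpt set" where
  "cusps G = {s \<in> bdry. \<exists>g\<in>G. parabolic g \<and> g s = s}"

definition hstar :: "(hpt \<Rightarrow> hpt) set \<Rightarrow> hpt set" where
  "hstar G = uhp \<union> cusps G"

definition horoball :: "hpt \<Rightarrow> real \<Rightarrow> hpt set" where
  "horoball s r = (case s of
      Inf \<Rightarrow> {Pt z | z. Im z > r}
    | Pt x \<Rightarrow> {Pt z | z. cmod (z - (x + \<i> * of_real r)) < r})"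

definition hstar_open :: "(hpt \<Rightarrow> hpt) set \<Rightarrow> hpt set \<Rightarrow> bool" where
  "hstar_open G U \<longleftrightarrow> U \<subseteq> hstar G \<and> open {z. Pt z \<in> U \<and> Im z > 0}
      \<and> (\<forall>s\<in>U \<inter> cusps G. \<exists>r>0. horoball s r \<subseteq> U)"

definition hstar_top :: "(hpt \<Rightarrow> hpt) set \<Rightarrow> hpt topology" where
  "hstar_top G = topology (hstar_open G)"

definition quot_top :: "'a topology \<Rightarrow> ('a \<Rightarrow> 'b) \<Rightarrow> 'b topology" where
  "quot_top T f = topology (\<lambda>U. U \<subseteq> f ` topspace T \<and> openin T {x \<in> topspace T. f x \<in> U})"

definition orbit :: "(hpt \<Rightarrow> hpt) set \<Rightarrow> hpt \<Rightarrow> hpt set" where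
  "orbit G z = (\<lambda>g. g z) ` G"

definition X_top :: "(hpt \<Rightarrow> hpt) set \<Rightarrow> hpt set topology" where
  "X_top G = quot_top (hstar_top G) (orbit G)"

text \<open>The descended involution sends the orbit Q to c ` Q; X_Gamma(R) is its fixed locus.\<close>
definition XR :: "(hpt \<Rightarrow> hpt) set \<Rightarrow> (hpt \<Rightarrow> hpt) \<Rightarrow> hpt set set" where
  "XR G c = {Q \<in> topspace (X_top G). c ` Q = Q}"

definition XR_top :: "(hpt \<Rightarrow> hpt) set \<Rightarrow> (hpt \<Rightarrow> hpt) \<Rightarrow> hpt set topology" where
  "XR_top G c = subtopology (X_top G) (XR G c)"

definition stab :: "(hpt \<Rightarrow> hpt) set \<Rightarrow> hpt \<Rightarrow> (hpt \<Rightarrow> hpt) set" where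
  "stab G z = {g \<in> G. g z = z}"

definition special_pts :: "(hpt \<Rightarrow> hpt) set \<Rightarrow> (hpt \<Rightarrow> hpt) \<Rightarrow> hpt set set" where
  "special_pts G c = {Q \<in> XR G c.
      (\<exists>s\<in>cusps G. Q = orbit G s) \<or>
      (\<exists>z\<in>uhp. Q = orbit G z \<and> finite (stab G z) \<and> even (card (stab G z)))}"

definition admissible :: "(hpt \<Rightarrow> hpt) set \<Rightarrow> (hpt \<Rightarrow> hpt) \<Rightarrow> (hpt \<Rightarrow> hpt) set" where
  "admissible G c = {g \<in> G. twist c g = inv g}"

definition twisted_conj :: "(hpt \<Rightarrow> hpt) set \<Rightarrow> (hpt \<Rightarrow> hpt) \<Rightarrow> (hpt \<Rightarrow> hpt) \<Rightarrow> (hpt \<Rightarrow> hpt) \<Rightarrow> bool" where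
  "twisted_conj G c g g' \<longleftrightarrow> (\<exists>d\<in>G. g = twist c d \<circ> g' \<circ> inv d)"

definition tw_class :: "(hpt \<Rightarrow> hpt) set \<Rightarrow> (hpt \<Rightarrow> hpt) \<Rightarrow> (hpt \<Rightarrow> hpt) \<Rightarrow> (hpt \<Rightarrow> hpt) set" where
  "tw_class G c g = {g' \<in> admissible G c. twisted_conj G c g g'}"

definition edges :: "(hpt \<Rightarrow> hpt) set \<Rightarrow> (hpt \<Rightarrow> hpt) \<Rightarrow> (hpt \<Rightarrow> hpt) set set" where
  "edges G c = tw_class G c ` admissible G c"

definition Cset :: "(hpt \<Rightarrow> hpt) set \<Rightarrow> (hpt \<Rightarrow> hpt) \<Rightarrow> (hpt \<Rightarrow> hpt) \<Rightarrow> hpt set" where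
  "Cset G c g = {z \<in> hstar G. g z = c z}"

definition Cimg :: "(hpt \<Rightarrow> hpt) set \<Rightarrow> (hpt \<Rightarrow> hpt) \<Rightarrow> (hpt \<Rightarrow> hpt) \<Rightarrow> hpt set set" where
  "Cimg G c g = orbit G ` Cset G c g"

definition edge_ends :: "(hpt \<Rightarrow> hpt) set \<Rightarrow> (hpt \<Rightarrow> hpt) \<Rightarrow> (hpt \<Rightarrow> hpt) set \<Rightarrow> hpt set set" where
  "edge_ends G c e = {v \<in> special_pts G c. \<exists>g\<in>e. v \<in> Cimg G c g}"

text \<open>Vertex set V, edge set E, and for each edge the set of its endpoints (0, 1 or 2 of them).
  Each edge is a copy of [0,1]; its ends are glued to its endpoint vertices (both ends to the
  same vertex for a loop), or glued to each other (a circle) if it has no endpoints.\<close>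
datatype ('v, 'e) gpt = GV 'v | GE 'e real

definition end0 :: "('e \<Rightarrow> 'v set) \<Rightarrow> 'e \<Rightarrow> 'v" where
  "end0 ends e = (SOME v. v \<in> ends e)"

definition end1 :: "('e \<Rightarrow> 'v set) \<Rightarrow> 'e \<Rightarrow> 'v" where
  "end1 ends e = (if \<exists>w\<in>ends e. w \<noteq> end0 ends e
                  then (SOME w. w \<in> ends e \<and> w \<noteq> end0 ends e) else end0 ends e)"

definition pre_open :: "'v set \<Rightarrow> 'e set \<Rightarrow> ('v + 'e \<times> real) set \<Rightarrow> bool" where
  "pre_open V E U \<longleftrightarrow> U \<subseteq> Inl ` V \<union> Inr ` (E \<times> {0..1})
      \<and> (\<forall>e\<in>E. openin (top_of_set {0..1}) {t. Inr (e, t) \<in> U})"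

definition pre_top :: "'v set \<Rightarrow> 'e set \<Rightarrow> ('v + 'e \<times> real) topology" where
  "pre_top V E = topology (pre_open V E)"

definition glue :: "('e \<Rightarrow> 'v set) \<Rightarrow> ('v + 'e \<times> real) \<Rightarrow> ('v, 'e) gpt" where
  "glue ends p = (case p of
      Inl v \<Rightarrow> GV v
    | Inr (e, t) \<Rightarrow>
        (if t = 0 then (if ends e = {} then GE e 0 else GV (end0 ends e))
         else if t = 1 then (if ends e = {} then GE e 0 else GV (end1 ends e))
         else GE e t))"

definition graph_top :: "'v set \<Rightarrow> 'e set \<Rightarrow> ('e \<Rightarrow> 'v set) \<Rightarrow> ('v, 'e) gpt topology" where
  "graph_top V E ends = quot_top (pre_top V E) (glue ends)"

definition edge_interior :: "'v set \<Rightarrow> 'e set \<Rightarrow> ('e \<Rightarrow> 'v set) \<Rightarrow> 'e \<Rightarrow> ('v, 'e) gpt set" where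
  "edge_interior V E ends e = {p \<in> topspace (graph_top V E ends). \<exists>t. p = GE e t}"

lemma istopology_quot: "istopology (\<lambda>U. U \<subseteq> f ` topspace T \<and> openin T {x \<in> topspace T. f x \<in> U})"
  unfolding istopology_def
proof (rule conjI; intro allI impI)
  fix S S' assume a: "S \<subseteq> f ` topspace T \<and> openin T {x \<in> topspace T. f x \<in> S}"
    "S' \<subseteq> f ` topspace T \<and> openin T {x \<in> topspace T. f x \<in> S'}"
  have "{x \<in> topspace T. f x \<in> S \<inter> S'} = {x \<in> topspace T. f x \<in> S} \<inter> {x \<in> topspace T. f x \<in> S'}"
    by auto
  then show "S \<inter> S' \<subseteq> f ` topspace T \<and> openin T {x \<in> topspace T. f x \<in> S \<inter> S'}"
    using a by auto
next
  fix K assume a: "\<forall>S\<in>K. S \<subseteq> f ` topspace T \<and> openin T {x \<in> topspace T. f x \<in> S}"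
  have "{x \<in> topspace T. f x \<in> \<Union>K} = \<Union>((\<lambda>S. {x \<in> topspace T. f x \<in> S}) ` K)"
    by auto
  moreover have "openin T (\<Union>((\<lambda>S. {x \<in> topspace T. f x \<in> S}) ` K))"
    using a by (intro openin_Union) auto
  ultimately show "\<Union>K \<subseteq> f ` topspace T \<and> openin T {x \<in> topspace T. f x \<in> \<Union>K}"
    using a by auto
qed

lemma istopology_pre: "istopology (pre_open V E)"
  unfolding istopology_def
proof (rule conjI; intro allI impI)
  fix S S' assume a: "pre_open V E S" "pre_open V E S'"
  have "{t. Inr (e, t) \<in> S \<inter> S'} = {t. Inr (e, t) \<in> S} \<inter> {t. Inr (e, t) \<in> S'}" for e
    by auto
  then show "pre_open V E (S \<inter> S')"
    using a unfolding pre_open_def by auto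
next
  fix K assume a: "\<forall>S\<in>K. pre_open V E S"
  have "{t. Inr (e, t) \<in> \<Union>K} = \<Union>((\<lambda>S. {t. Inr (e, t) \<in> S}) ` K)" for e
    by auto
  moreover have "openin (top_of_set {0..1}) (\<Union>((\<lambda>S. {t. Inr (e, t) \<in> S}) ` K))" if "e \<in> E" for e
    using a that unfolding pre_open_def by (intro openin_Union) auto
  ultimately show "pre_open V E (\<Union>K)"
    using a unfolding pre_open_def by auto
qed

end

theory Submission
  imports Defs
begin

text \<open>
  For admissible \<open>g\<close> the map \<open>c \<circ> g\<close> is a reflection in a geodesic, and every point of the real locus coming
  from the half-plane lies on the image of such a geodesic. Two of these geodesics through a common point
  are conjugate by an element of odd order fixing that point, unless the point is fixed by a half-turn in
  \<open>G\<close>; hence away from the special points the images of geodesics are disjoint for different twisted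
  conjugacy classes. The stabiliser of a geodesic acts on it as a discrete group of isometries of a line, which
  may be trivial, generated by a half-turn, cyclic, or infinite dihedral. Compactness of the quotient forces every end of
  a geodesic without translations to be a cusp, so the image is an arc between special points or a circle.
  Near a cusp, Shimizu's lemma shows that only vertical geodesics occur, finitely many up to translation; together with local
  finiteness in the half-plane this identifies the topology of the real locus with the one coming from
  the edges.
\<close>

section \<open>Moebius transformations of the sphere\<close>

text \<open>All computations use explicit matrices. Each reflection \<open>c \<circ> g\<close> is
  moved by some \<open>B\<close> in \<open>SL2\<close> to the reflection in the imaginary axis, and
  the group is seen through the same \<open>B\<close>; an element preserving the axis then has a
  diagonal or antidiagonal matrix, and a cusp is put at infinity. The homeomorphism is not drawn
  from a compact-to-Hausdorff argument. A set is open in the graph iff its preimage in every edge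
  interval is open, and the crux is to prove the same description for the real locus. The obstacle
  sits at the cusps: a neighbourhood contains a whole horoball, possibly met by infinitely many
  geodesics, and openness along each of them separately gives no common height. The parabolic
  translation leaves finitely many of them to consider, hence a uniform height. The path of an edge
  runs through a fundamental interval of its geodesic, and its topology is controlled by a
  continuous fold of the geodesic onto that interval; such a fold is missing exactly for circles,
  which need a periodic argument.\<close>

definition mmul :: "mat2 \<Rightarrow> mat2 \<Rightarrow> mat2" where
  "mmul M N = (case M of (a,b,c,d) \<Rightarrow> case N of (a',b',c',d') \<Rightarrow>
     (a*a'+b*c', a*b'+b*d', c*a'+d*c', c*b'+d*d'))"

definition madj :: "mat2 \<Rightarrow> mat2" where
  "madj M = (case M of (a,b,c,d) \<Rightarrow> (d,-b,-c,a))"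

text \<open>The action inside the complex numbers, where continuity and imaginary parts are
  available; \<open>mob_uhp\<close> identifies it with \<open>mob\<close> on the half-plane.\<close>

definition mobz :: "mat2 \<Rightarrow> complex \<Rightarrow> complex" where
  "mobz M z = (case M of (a,b,c,d) \<Rightarrow> (of_real a * z + of_real b) / (of_real c * z + of_real d))"

lemma mmul_simp [simp]: "mmul (a,b,c,d) (a',b',c',d') = (a*a'+b*c', a*b'+b*d', c*a'+d*c', c*b'+d*d')"
  by (simp add: mmul_def)

lemma madj_simp [simp]: "madj (a,b,c,d) = (d,-b,-c,a)"
  by (simp add: madj_def)

lemma mdet_simp [simp]: "mdet (a,b,c,d) = a*d - b*c"
  by (simp add: mdet_def)

lemma SL2_iff [simp]: "(a,b,c,d) \<in> SL2 \<longleftrightarrow> a*d - b*c = 1"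
  by (simp add: SL2_def)

lemma mdet_mmul: "mdet (mmul M N) = mdet M * mdet N"
  by (cases M; cases N) (simp add: algebra_simps)

lemma mdet_madj: "mdet (madj M) = mdet M"
  by (cases M) (simp add: algebra_simps)

lemma SL2_mmul: "M \<in> SL2 \<Longrightarrow> N \<in> SL2 \<Longrightarrow> mmul M N \<in> SL2"
  by (simp add: SL2_def mdet_mmul)

lemma SL2_madj: "M \<in> SL2 \<Longrightarrow> madj M \<in> SL2"
  by (simp add: SL2_def mdet_madj)

lemma SL2_det: "M \<in> SL2 \<Longrightarrow> mdet M \<noteq> 0"
  by (simp add: SL2_def)

lemma mmul_assoc: "mmul (mmul L M) N = mmul L (mmul M N)"
  by (cases L; cases M; cases N) (simp add: algebra_simps)

lemma mmul_madj: "M \<in> SL2 \<Longrightarrow> mmul M (madj M) = (1,0,0,1)" "M \<in> SL2 \<Longrightarrow> mmul (madj M) M = (1,0,0,1)"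
  by (cases M; simp add: algebra_simps)+

lemma mmul_one [simp]: "mmul M (1,0,0,1) = M" "mmul (1,0,0,1) M = M"
  by (cases M; simp)+

lemma mob_Pt: "mob (a,b,c,d) (Pt z) = (if of_real c * z + of_real d = 0 then Inf
                  else Pt ((of_real a * z + of_real b) / (of_real c * z + of_real d)))"
  by (simp add: mob_def)

lemma mob_Inf: "mob (a,b,c,d) Inf = (if c = 0 then Inf else Pt (of_real (a / c)))"
  by (simp add: mob_def)

lemma mob_one: "mob (1,0,0,1) = id"
  by (rule ext, case_tac x) (auto simp: mob_Pt mob_Inf)

text \<open>Nonzero determinant instead of \<open>SL2\<close>, because matrices of complex
  conjugations have determinant -1 and must multiply by the same rule.\<close>

lemma mob_mmul:
  assumes "mdet M \<noteq> 0" "mdet N \<noteq> 0"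
  shows "mob (mmul M N) = mob M \<circ> mob N"
proof (rule ext)
  fix w
  obtain a b c d where M: "M = (a,b,c,d)" by (cases M) auto
  obtain a' b' c' d' where N: "N = (a',b',c',d')" by (cases N) auto
  have dM: "a*d - b*c \<noteq> 0" and dN: "a'*d' - b'*c' \<noteq> 0" using assms M N by auto
  show "mob (mmul M N) w = (mob M \<circ> mob N) w"
  proof (cases w)
    case Inf
    have "c * a' \<noteq> 0" if "c' = 0" "c \<noteq> 0" using that dN by auto
    moreover have "(c*a'+d*c' = 0) = (c * (a'/c') + d = 0)" if "c' \<noteq> 0"
      using that by (simp add: field_simps)
    moreover have "(a*a'+b*c')/(c*a'+d*c') = (a * (a'/c') + b)/(c * (a'/c')+d)" if "c' \<noteq> 0"
    proof -
      have "a * (a'/c') + b = (a*a'+b*c')/c'" "c * (a'/c')+d = (c*a'+d*c')/c'"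
        using that by (simp_all add: field_simps)
      then show ?thesis using that by simp
    qed
    moreover have "complex_of_real c * complex_of_real (a'/c') + complex_of_real d = complex_of_real (c * (a'/c') + d)"
       "complex_of_real a * complex_of_real (a'/c') + complex_of_real b = complex_of_real (a * (a'/c') + b)"
      by simp_all
    ultimately show ?thesis
      using dN by (auto simp: M N Inf mob_Pt mob_Inf simp flip: of_real_divide of_real_mult of_real_add)
  next
    case (Pt z)
    let ?n = "of_real a' * z + of_real b'" let ?e = "of_real c' * z + of_real d'"
    have e1: "of_real (c*a'+d*c') * z + of_real (c*b'+d*d') = of_real c * ?n + of_real d * ?e"
      "of_real (a*a'+b*c') * z + of_real (a*b'+b*d') = of_real a * ?n + of_real b * ?e"
      by (simp_all add: algebra_simps)
    have nz: "?n \<noteq> 0" if "?e = 0"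
    proof
      assume "?n = 0"
      have "of_real (a'*d' - b'*c') = of_real a' * ?e - of_real c' * ?n"
        by (simp add: algebra_simps)
      then have "complex_of_real (a'*d' - b'*c') = 0" using that \<open>?n=0\<close> by simp
      then show False using dN by (simp only: of_real_eq_0_iff)
    qed
    show ?thesis
    proof (cases "?e = 0")
      case True
      have L: "mob (mmul M N) w = (if of_real c * ?n = 0 then Inf else Pt (of_real a * ?n / (of_real c * ?n)))"
        unfolding M N mmul_simp Pt mob_Pt e1 True by simp
      have "mob N w = Inf" unfolding N Pt mob_Pt True by simp
      then show ?thesis using nz[OF True] L by (simp add: M mob_Inf)
    next
      case False
      have L: "mob (mmul M N) w = (if of_real c * ?n + of_real d * ?e = 0 then Inf else
          Pt ((of_real a * ?n + of_real b * ?e) / (of_real c * ?n + of_real d * ?e)))"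
        unfolding M N mmul_simp Pt mob_Pt e1 by simp
      have R: "mob N w = Pt (?n / ?e)" unfolding N Pt mob_Pt using False by simp
      have frac: "p * (n/e) + q = (p*n+q*e)/e" if "e \<noteq> 0" for p q n e :: complex
        using that by (simp add: field_simps)
      have d: "of_real c * (?n/?e) + of_real d = (of_real c * ?n + of_real d * ?e)/?e"
        "of_real a * (?n/?e) + of_real b = (of_real a * ?n + of_real b * ?e)/?e"
        using frac[OF False] by simp_all
      have "mob M (Pt (?n / ?e)) = (if of_real c * ?n + of_real d * ?e = 0 then Inf else
          Pt ((of_real a * ?n + of_real b * ?e) / (of_real c * ?n + of_real d * ?e)))"
        unfolding M mob_Pt d using False by simp
      then show ?thesis unfolding L o_apply R by simp
    qed
  qed
qed

lemma conjh_simps [simp]: "conjh (Pt z) = Pt (cnj z)" "conjh Inf = Inf"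
  by (simp_all add: conjh_def)

lemma conjh_conjh: "conjh \<circ> conjh = id"
  by (rule ext, case_tac x) auto

lemma conjh_mob: "conjh \<circ> mob M = mob M \<circ> conjh"
proof (rule ext)
  fix w
  obtain a b c d where M: "M = (a,b,c,d)" by (cases M) auto
  have "of_real c * cnj z + of_real d = cnj (of_real c * z + of_real d)" for z by simp
  then have "(of_real c * cnj z + of_real d = 0) = (of_real c * z + of_real d = 0)" for z
    by (metis complex_cnj_zero_iff)
  then show "(conjh \<circ> mob M) w = (mob M \<circ> conjh) w"
    by (cases w) (auto simp: M mob_Pt mob_Inf)
qed

text \<open>Real entries let conjugation pass through the matrix action, so anti-holomorphic maps
  multiply like their matrices.\<close>

lemma antimob_mob:
  assumes "mdet M \<noteq> 0" "mdet N \<noteq> 0"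
  shows "antimob M \<circ> mob N = antimob (mmul M N)" "mob M \<circ> antimob N = antimob (mmul M N)"
    "antimob M \<circ> antimob N = mob (mmul M N)"
proof -
  show 1: "antimob M \<circ> mob N = antimob (mmul M N)"
    by (simp add: antimob_def mob_mmul assms o_assoc [symmetric] conjh_mob)
  show "mob M \<circ> antimob N = antimob (mmul M N)"
    by (simp add: antimob_def mob_mmul assms o_assoc)
  have "antimob M \<circ> antimob N = antimob (mmul M N) \<circ> conjh"
    using 1 by (simp add: antimob_def[of N] o_assoc)
  then show "antimob M \<circ> antimob N = mob (mmul M N)"
    by (simp add: antimob_def o_assoc [symmetric] conjh_conjh)
qed

text \<open>The values at infinity, 0 and 1 already force a scalar matrix.\<close>

lemma mob_eq_id:
  assumes "mob (a,b,c,d) = id" shows "b = 0" "c = 0" "a = d"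
proof -
  have 1: "mob (a,b,c,d) Inf = Inf" "mob (a,b,c,d) (Pt 0) = Pt 0" "mob (a,b,c,d) (Pt 1) = Pt 1"
    using assms by simp_all
  show "c = 0" using 1(1) by (auto simp: mob_Inf split: if_splits)
  show "b = 0" using 1(2) by (auto simp: mob_Pt split: if_splits)
  have "of_real a + complex_of_real b = of_real c + of_real d"
    using 1(3) by (auto simp: mob_Pt split: if_splits)
  then show "a = d" using \<open>b = 0\<close> \<open>c = 0\<close> by simp
qed

lemma mob_eq_id_SL2: "M \<in> SL2 \<Longrightarrow> mob M = id \<Longrightarrow> M = (1,0,0,1) \<or> M = (-1,0,0,-1)"
proof -
  assume M: "M \<in> SL2" "mob M = id"
  obtain a b c d where abcd: "M = (a,b,c,d)" by (cases M) auto
  then have "b = 0" "c = 0" "d = a" using mob_eq_id[of a b c d] M(2) by auto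
  then have "a * a = 1" using M(1) abcd by simp
  then have "a = 1 \<or> a = -1" by (simp add: square_eq_1_iff)
  then show ?thesis using abcd \<open>b = 0\<close> \<open>c = 0\<close> \<open>d = a\<close> by auto
qed

lemma mob_uminus: "mob (-a,-b,-c,-d) = mob (a,b,c,d)"
proof (rule ext)
  fix w
  have *: "of_real (-a) * z + of_real (-b) = - (of_real a * z + of_real b)" for a b and z :: complex
    by simp
  show "mob (-a,-b,-c,-d) w = mob (a,b,c,d) w"
    by (cases w) (simp_all only: mob_Pt mob_Inf * minus_divide_divide neg_equal_0_iff_equal)
qed

lemma mob_inverse:
  assumes "M \<in> SL2"
  shows "mob M \<circ> mob (madj M) = id" "mob (madj M) \<circ> mob M = id"
  using assms by (simp_all add: mob_mmul[symmetric] SL2_det SL2_madj mmul_madj mob_one)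

lemma bij_mob: "M \<in> SL2 \<Longrightarrow> bij (mob M)"
  using mob_inverse o_bij by blast

lemma inv_mob: "M \<in> SL2 \<Longrightarrow> inv (mob M) = mob (madj M)"
  using mob_inverse inv_unique_comp by blast

lemma mob_madj_eq [simp]: "M \<in> SL2 \<Longrightarrow> mob M (mob (madj M) w) = w" "M \<in> SL2 \<Longrightarrow> mob (madj M) (mob M w) = w"
  by (metis mob_inverse(1) comp_apply id_apply, metis mob_inverse(2) comp_apply id_apply)

lemma mob_eq_iff: "M \<in> SL2 \<Longrightarrow> mob M w = mob M w' \<longleftrightarrow> w = w'"
  by (metis mob_madj_eq(2))

lemma SL2_denom:
  assumes "M \<in> SL2" "Im z > 0" "M = (a,b,c,d)"
  shows "of_real c * z + of_real d \<noteq> 0"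
proof
  assume "of_real c * z + of_real d = 0"
  then have "Im (of_real c * z + of_real d) = 0" "Re (of_real c * z + of_real d) = 0" by simp_all
  then have "c = 0" "d = 0" using assms(2) by auto
  then show False using assms by simp
qed

lemma SL2_denom': "of_real c * z + of_real d = 0 \<Longrightarrow> a*d - b*c = 1 \<Longrightarrow> Im z > 0 \<Longrightarrow> False"
  using SL2_denom[of "(a,b,c,d)" z a b c d] by simp

lemma mob_uhp: "M \<in> SL2 \<Longrightarrow> Im z > 0 \<Longrightarrow> mob M (Pt z) = Pt (mobz M z)"
  by (cases M) (auto simp: mob_Pt mobz_def dest: SL2_denom')

lemma Im_mobz:
  "Im (mobz (a,b,c,d) z) = (a*d - b*c) * Im z / (cmod (of_real c * z + of_real d))^2"
proof -
  have "Im (mobz (a,b,c,d) z) = Im ((of_real a * z + of_real b) * cnj (of_real c * z + of_real d)) / (cmod (of_real c * z + of_real d))^2"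
    by (simp add: mobz_def complex_div_cnj[of "of_real a * z + of_real b"] Im_divide_of_real flip: of_real_power)
  also have "Im ((of_real a * z + of_real b) * cnj (of_real c * z + of_real d)) = (a*d - b*c) * Im z"
    by (simp add: algebra_simps)
  finally show ?thesis .
qed

lemma Im_mobz_pos: "M \<in> SL2 \<Longrightarrow> Im z > 0 \<Longrightarrow> Im (mobz M z) > 0"
  by (cases M) (auto simp: Im_mobz intro!: divide_pos_pos dest: SL2_denom')

lemma continuous_on_mobz: "M \<in> SL2 \<Longrightarrow> continuous_on {z. Im z > 0} (mobz M)"
  by (cases M) (auto simp: mobz_def intro!: continuous_intros dest: SL2_denom')

lemma uhp_Pt [simp]: "Pt z \<in> uhp \<longleftrightarrow> Im z > 0" "Inf \<notin> uhp"
  by (auto simp: uhp_def)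

lemma bdry_Pt [simp]: "Pt z \<in> bdry \<longleftrightarrow> Im z = 0" "Inf \<in> bdry"
  by (auto simp: bdry_def complex_is_Real_iff[symmetric] elim: Reals_cases)

lemma uhp_bdry: "w \<in> uhp \<Longrightarrow> w \<notin> bdry"
  by (cases w) auto

lemma mob_in_uhp: "M \<in> SL2 \<Longrightarrow> mob M w \<in> uhp \<longleftrightarrow> w \<in> uhp"
proof -
  have *: "M \<in> SL2 \<Longrightarrow> w \<in> uhp \<Longrightarrow> mob M w \<in> uhp" for M w
    by (cases w) (auto simp: mob_uhp Im_mobz_pos)
  show "M \<in> SL2 \<Longrightarrow> mob M w \<in> uhp \<longleftrightarrow> w \<in> uhp"
    using *[of M w] *[of "madj M" "mob M w"] SL2_madj by auto
qed

lemma mob_in_bdry: "M \<in> SL2 \<Longrightarrow> mob M w \<in> bdry \<longleftrightarrow> w \<in> bdry"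
proof -
  have *: "M \<in> SL2 \<Longrightarrow> w \<in> bdry \<Longrightarrow> mob M w \<in> bdry" for M w
    by (cases M; cases w) (auto simp: mob_Pt mob_Inf Im_mobz[unfolded mobz_def, simplified])
  show "M \<in> SL2 \<Longrightarrow> mob M w \<in> bdry \<longleftrightarrow> w \<in> bdry"
    using *[of M w] *[of "madj M" "mob M w"] SL2_madj by auto
qed

section \<open>Discreteness\<close>

lemma norm_mat2: "norm (a::real,b::real,c::real,d::real) \<le> \<bar>a\<bar> + \<bar>b\<bar> + \<bar>c\<bar> + \<bar>d\<bar>"
proof -
  have "norm (a,b,c,d) \<le> norm a + (norm b + (norm c + norm d))"
    by (meson norm_Pair_le add_left_mono order_trans)
  then show ?thesis by simp
qed

lemma mat2_entry_le:
  assumes "norm (a::real,b::real,c::real,d::real) \<le> R"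
  shows "\<bar>a\<bar> \<le> R" "\<bar>b\<bar> \<le> R" "\<bar>c\<bar> \<le> R" "\<bar>d\<bar> \<le> R"
proof -
  have 1: "norm a \<le> norm (a,b,c,d)" "norm (b,c,d) \<le> norm (a,b,c,d)"
    "norm b \<le> norm (b,c,d)" "norm (c,d) \<le> norm (b,c,d)" "norm c \<le> norm (c,d)" "norm d \<le> norm (c,d)"
    using norm_fst_le norm_snd_le by fastforce+
  then show "\<bar>a\<bar> \<le> R" "\<bar>b\<bar> \<le> R" "\<bar>c\<bar> \<le> R" "\<bar>d\<bar> \<le> R"
    using assms by simp_all
qed

lemma continuous_on_mmul:
  "continuous_on S f \<Longrightarrow> continuous_on S g \<Longrightarrow> continuous_on S (\<lambda>x. mmul (f x) (g x))"
  by (simp add: mmul_def case_prod_unfold) (intro continuous_intros)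

lemma continuous_on_madj: "continuous_on S f \<Longrightarrow> continuous_on S (\<lambda>x. madj (f x))"
  by (simp add: madj_def case_prod_unfold) (intro continuous_intros)

lemma continuous_on_mdet: "continuous_on S mdet"
  by (simp add: mdet_def case_prod_unfold) (intro continuous_intros)

lemma closed_SL2: "closed SL2"
  using continuous_closed_preimage_constant[OF continuous_on_mdet closed_UNIV] by (simp add: SL2_def)

locale real_fuchsian_group =
  fixes G :: "(hpt \<Rightarrow> hpt) set" and c :: "hpt \<Rightarrow> hpt"
  assumes rf: "real_fuchsian G c"
begin

abbreviation "orb \<equiv> orbit G"
abbreviation "adm \<equiv> admissible G c"
abbreviation "special \<equiv> special_pts G c"

lemma G_PSL2: "g \<in> G \<Longrightarrow> \<exists>M\<in>SL2. g = mob M"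
  and G_id: "id \<in> G"
  and G_comp: "g \<in> G \<Longrightarrow> h \<in> G \<Longrightarrow> g \<circ> h \<in> G"
  and G_inv: "g \<in> G \<Longrightarrow> inv g \<in> G"
  and G_discrete: "discrete_psl G"
  using rf by (auto simp: real_fuchsian_def fuchsian_def PSL2_def)

lemma G_bij: "g \<in> G \<Longrightarrow> bij g"
  by (metis G_PSL2 bij_mob)

lemma G_inv_comp: "g \<in> G \<Longrightarrow> inv g \<circ> g = id" "g \<in> G \<Longrightarrow> g \<circ> inv g = id"
  using G_bij by (auto simp: bij_is_inj bij_is_surj surj_iff[symmetric])

lemma G_inv_ap [simp]: "g \<in> G \<Longrightarrow> inv g (g z) = z" "g \<in> G \<Longrightarrow> g (inv g z) = z"
  using G_bij by (auto simp: bij_is_inj bij_is_surj surj_f_inv_f)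

lemma G_eq_iff: "g \<in> G \<Longrightarrow> g z = g w \<longleftrightarrow> z = w"
  using G_bij by (auto simp: bij_is_inj inj_eq)

lemma G_uhp: "g \<in> G \<Longrightarrow> g z \<in> uhp \<longleftrightarrow> z \<in> uhp"
  by (metis G_PSL2 mob_in_uhp)

lemma G_bdry: "g \<in> G \<Longrightarrow> g z \<in> bdry \<longleftrightarrow> z \<in> bdry"
  by (metis G_PSL2 mob_in_bdry)

lemma c_c: "c \<circ> c = id" using rf by (simp add: real_fuchsian_def cplx_conjugation_def)

lemma c_c_ap [simp]: "c (c z) = z" using c_c by (metis comp_apply id_apply)

lemma c_antimob: "\<exists>M. mdet M = -1 \<and> c = antimob M"
  using rf by (simp add: real_fuchsian_def cplx_conjugation_def)

lemma twist_G: "g \<in> G \<Longrightarrow> twist c g \<in> G" using rf by (auto simp: real_fuchsian_def)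

lemma orbit_eq: "g \<in> G \<Longrightarrow> orb (g z) = orb z"
proof -
  have "g \<in> G \<Longrightarrow> orb (g z) \<subseteq> orb z" for g z
  proof
    fix w assume g: "g \<in> G" and "w \<in> orb (g z)"
    then obtain h where h: "h \<in> G" "w = (h \<circ> g) z" by (auto simp: orbit_def)
    show "w \<in> orb z" unfolding orbit_def h(2) using G_comp[OF h(1) g] by (rule imageI)
  qed
  from this[of g z] this[of "inv g" "g z"] show "g \<in> G \<Longrightarrow> orb (g z) = orb z"
    using G_inv by auto
qed

lemma orbit_self: "z \<in> orb z"
  unfolding orbit_def using G_id by (metis id_apply image_eqI)

lemma orbit_eq_iff: "orb z = orb w \<longleftrightarrow> (\<exists>g\<in>G. g z = w)"
proof
  assume "orb z = orb w"
  then have "w \<in> orb z" using orbit_self by simp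
  then show "\<exists>g\<in>G. g z = w" by (auto simp: orbit_def)
qed (auto simp: orbit_eq)

text \<open>Two distinct matrices \<open>M\<close>, \<open>N\<close> near an accumulation point would make \<open>M\<close>-inverse times \<open>N\<close> a nontrivial
  element near the identity.\<close>
lemma finite_bounded_mats: "finite {M \<in> SL2. mob M \<in> G \<and> norm M \<le> R}"
proof (rule ccontr)
  let ?S = "{M \<in> SL2. mob M \<in> G \<and> norm M \<le> R}"
  assume inf: "infinite ?S"
  have "bounded ?S" by (auto simp: bounded_iff)
  then obtain L where L: "L islimpt ?S"
    using inf bounded_infinite_imp_islimpt by blast
  have "?S \<subseteq> SL2" by auto
  then have LS: "L \<in> SL2" using L closed_SL2 by (meson closed_limpt islimpt_subset)
  have one: "(1,0,0,1) \<in> SL2" by simp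
  obtain e0 where e0: "e0 > 0" "\<And>N. N \<in> SL2 \<Longrightarrow> mob N \<in> G \<Longrightarrow> dist N (1,0,0,1) < e0 \<Longrightarrow> mob N = mob (1,0,0,1)"
    using G_discrete one G_id unfolding discrete_psl_def mob_one[symmetric] by (metis (no_types, lifting))
  let ?f = "\<lambda>p::mat2\<times>mat2. mmul (madj (fst p)) (snd p)"
  have cf: "continuous_on UNIV ?f" by (intro continuous_on_mmul continuous_on_madj continuous_intros)
  then have "isCont ?f (L,L)" using continuous_on_eq_continuous_at[OF open_UNIV] by blast
  moreover have fL: "?f (L,L) = (1,0,0,1)" using LS by (simp add: mmul_madj)
  \<comment> \<open>The bound 1 in \<open>min e0 1\<close> excludes minus the identity, which also
    acts as \<open>id\<close> but lies at distance at least 2.\<close>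
  ultimately obtain d where d: "d > 0" "\<And>p. dist p (L,L) < d \<Longrightarrow> dist (?f p) (1,0,0,1) < min e0 1"
    unfolding continuous_at_eps_delta fL using e0(1)
    by (metis min_less_iff_conj zero_less_one)
  have d2: "d/2 > 0" using d by simp
  obtain M where M: "M \<in> ?S" "M \<noteq> L" "dist M L < d/2"
    using L d2 unfolding islimpt_approachable by blast
  then have "dist M L > 0" by simp
  \<comment> \<open>\<open>N\<close> is taken strictly nearer to the limit than \<open>M\<close>,
    which makes the two distinct.\<close>
  then obtain N where N: "N \<in> ?S" "N \<noteq> L" "dist N L < dist M L"
    using L unfolding islimpt_approachable by blast
  have "M \<noteq> N" using N by auto
  have "dist (M,N) (L,L) \<le> dist M L + dist N L"
    by (simp add: dist_Pair_Pair real_sqrt_le_iff sqrt_sum_squares_le_sum)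
  then have "dist (M,N) (L,L) < d" using M N by linarith
  then have *: "dist (mmul (madj M) N) (1,0,0,1) < min e0 1" using d(2)[of "(M,N)"] by simp
  let ?K = "mmul (madj M) N"
  have MS: "M \<in> SL2" "N \<in> SL2" "mob M \<in> G" "mob N \<in> G" using M N by auto
  then have K: "?K \<in> SL2" by (simp add: SL2_mmul SL2_madj)
  have "mob ?K = inv (mob M) \<circ> mob N" using MS by (simp add: mob_mmul SL2_det SL2_madj inv_mob)
  then have "mob ?K \<in> G" using G_comp G_inv MS by simp
  then have "mob ?K = id" using e0(2)[OF K] * by (simp add: mob_one)
  then have "?K = (1,0,0,1) \<or> ?K = (-1,0,0,-1)" using mob_eq_id_SL2 K by blast
  moreover have "?K \<noteq> (-1,0,0,-1)"
  proof
    assume "?K = (-1,0,0,-1)"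
    then have "dist ?K (1,0,0,1) = norm (-2::real,0::real,0::real,-2::real)"
      by (simp add: dist_norm)
    then have "dist ?K (1,0,0,1) \<ge> 2" using mat2_entry_le(1)[of "-2" 0 0 "-2" "dist ?K (1,0,0,1)"] by simp
    then show False using * by simp
  qed
  ultimately have "mmul M ?K = M" by simp
  then have "N = M" using MS by (simp add: mmul_assoc[symmetric] mmul_madj)
  then show False using \<open>M \<noteq> N\<close> by simp
qed

text \<open>The lifts to \<open>SL2\<close> of the group conjugated by \<open>B\<close>: in this
  coordinate the cusp \<open>mob B Inf\<close> is at infinity and the axis of a reflection is the
  imaginary axis. Both signs of a matrix belong to the set.\<close>

definition mats :: "mat2 \<Rightarrow> mat2 set" where
  "mats B = {M \<in> SL2. \<exists>g\<in>G. g \<circ> mob B = mob B \<circ> mob M}"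

lemma matsI: "M \<in> SL2 \<Longrightarrow> g \<in> G \<Longrightarrow> g \<circ> mob B = mob B \<circ> mob M \<Longrightarrow> M \<in> mats B"
  by (auto simp: mats_def)

lemma mats_SL2: "M \<in> mats B \<Longrightarrow> M \<in> SL2"
  by (auto simp: mats_def)

lemma mats_mmul:
  assumes "M \<in> mats B" "N \<in> mats B" shows "mmul M N \<in> mats B"
proof -
  obtain g h where g: "g \<in> G" "g \<circ> mob B = mob B \<circ> mob M" and h: "h \<in> G" "h \<circ> mob B = mob B \<circ> mob N"
    using assms by (auto simp: mats_def)
  have S: "M \<in> SL2" "N \<in> SL2" using assms mats_SL2 by auto
  show ?thesis
  proof (rule matsI[OF SL2_mmul[OF S] G_comp[OF g(1) h(1)]])
    have "g \<circ> h \<circ> mob B = (g \<circ> mob B) \<circ> mob N" using h(2) by (simp add: o_assoc [symmetric])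
    then show "g \<circ> h \<circ> mob B = mob B \<circ> mob (mmul M N)"
      using g(2) S by (simp add: mob_mmul SL2_det o_assoc)
  qed
qed

lemma mats_madj:
  assumes "M \<in> mats B" shows "madj M \<in> mats B"
proof -
  obtain g where g: "g \<in> G" "g \<circ> mob B = mob B \<circ> mob M"
    using assms by (auto simp: mats_def)
  have S: "M \<in> SL2" using assms mats_SL2 by auto
  show ?thesis
  proof (rule matsI[OF SL2_madj[OF S] G_inv[OF g(1)]])
    have "mob B = g \<circ> mob B \<circ> mob (madj M)" using S by (simp add: g(2) mob_inverse o_assoc [symmetric])
    then have "inv g \<circ> mob B = inv g \<circ> (g \<circ> mob B \<circ> mob (madj M))" by simp
    also have "\<dots> = mob B \<circ> mob (madj M)" using G_inv_comp g(1) by (simp add: o_assoc)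
    finally show "inv g \<circ> mob B = mob B \<circ> mob (madj M)" .
  qed
qed

lemma mats_uminus: "(a,b,c',d) \<in> mats B \<Longrightarrow> (-a,-b,-c',-d) \<in> mats B"
  by (auto simp: mats_def mob_uminus)

lemma mats_one: "(1,0,0,1) \<in> mats B"
  using G_id by (intro matsI[of _ id]) (auto simp: mob_one)

text \<open>Conjugation by \<open>B\<close> is continuous and injective on matrices, so it sends a
  bounded part of \<open>mats B\<close> injectively into a bounded set of lifts of
  \<open>G\<close>.\<close>

lemma finite_mats:
  assumes B: "B \<in> SL2" shows "finite {M \<in> mats B. norm M \<le> R}"
proof -
  let ?f = "\<lambda>M. mmul (mmul B M) (madj B)"
  have "continuous_on (cball 0 R) ?f"
    by (intro continuous_on_mmul continuous_intros)
  then have "bounded (?f ` cball 0 R)"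
    by (intro compact_imp_bounded compact_continuous_image) auto
  then obtain R' where R': "\<And>M. norm M \<le> R \<Longrightarrow> norm (?f M) \<le> R'"
    unfolding bounded_iff by fastforce
  have "?f ` {M \<in> mats B. norm M \<le> R} \<subseteq> {M \<in> SL2. mob M \<in> G \<and> norm M \<le> R'}"
  proof (rule image_subsetI)
    fix M assume "M \<in> {M \<in> mats B. norm M \<le> R}"
    then have M: "M \<in> mats B" "norm M \<le> R" by auto
    then obtain g where g: "g \<in> G" "g \<circ> mob B = mob B \<circ> mob M" by (auto simp: mats_def)
    have S: "M \<in> SL2" using M mats_SL2 by auto
    have "mob (?f M) = mob B \<circ> mob M \<circ> mob (madj B)"
      using S B by (simp add: mob_mmul SL2_det SL2_madj SL2_mmul)
    also have "\<dots> = g" using B by (simp add: g(2)[symmetric] mob_inverse o_assoc [symmetric])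
    finally show "?f M \<in> {M \<in> SL2. mob M \<in> G \<and> norm M \<le> R'}"
      using g R' M S B by (simp add: SL2_mmul SL2_madj)
  qed
  then have "finite (?f ` {M \<in> mats B. norm M \<le> R})"
    using finite_bounded_mats finite_subset by blast
  moreover have "inj_on ?f {M \<in> mats B. norm M \<le> R}"
  proof -
    have "mmul (mmul (madj B) (?f M)) B = M" for M
    proof -
      have "mmul (mmul (madj B) (?f M)) B = mmul (mmul (mmul (madj B) B) M) (mmul (madj B) B)"
        by (simp only: mmul_assoc)
      then show ?thesis using B by (simp add: mmul_madj)
    qed
    then show ?thesis by (metis (no_types, lifting) inj_onI)
  qed
  ultimately show ?thesis by (rule finite_imageD)
qed

text \<open>Serves \<open>translation_not_contracted\<close> and \<open>shimizu\<close>, where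
  conjugation produces explicit sequences that discreteness forbids.\<close>

lemma mats_bounded_finite_inj:
  fixes f :: "nat \<Rightarrow> mat2"
  assumes "B \<in> SL2" "\<And>n. f n \<in> mats B" "\<And>n. norm (f n) \<le> R" "inj f"
  shows False
proof -
  have "range f \<subseteq> {M \<in> mats B. norm M \<le> R}" using assms by auto
  then have "finite (range f)" using finite_mats[OF assms(1)] finite_subset by blast
  then show False using assms(4) finite_imageD by blast
qed

text \<open>Proper discontinuity. If \<open>z\<close> is the image of \<open>w\<close> under
  (p,q,r,s), the formula for imaginary parts bounds \<open>r w + s\<close>; then
  \<open>p w + q = z (r w + s)\<close> is bounded as well, and since \<open>Im w\<close> stays away
  from 0 all four entries are bounded.\<close>

lemma finite_meeting:
  assumes K: "compact K" "\<And>z. z \<in> K \<Longrightarrow> Im z > 0" and L: "compact L" "\<And>z. z \<in> L \<Longrightarrow> Im z > 0"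
  shows "finite {g \<in> G. \<exists>w\<in>K. g (Pt w) \<in> Pt ` L}"
proof (cases "K = {} \<or> L = {}")
  case False
  have ex: "\<exists>l>0. \<forall>z\<in>A. Im z \<ge> l" if A: "compact A" "A \<noteq> {}" "\<And>z. z \<in> A \<Longrightarrow> Im z > 0" for A
  proof -
    have "continuous_on A Im" by (intro continuous_intros)
    then obtain x where "x \<in> A" "\<forall>y\<in>A. Im x \<le> Im y"
      using continuous_attains_inf[OF A(1,2)] by blast
    then show ?thesis using A(3) by blast
  qed
  obtain l where l: "l > 0" "\<And>z. z \<in> L \<Longrightarrow> Im z \<ge> l" using ex[OF L(1) _ L(2)] False by blast
  obtain k where k: "k > 0" "\<And>z. z \<in> K \<Longrightarrow> Im z \<ge> k" using ex[OF K(1) _ K(2)] False by blast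
  obtain b where b: "b \<ge> 0" "\<And>z. z \<in> K \<Longrightarrow> cmod z \<le> b" "\<And>z. z \<in> L \<Longrightarrow> cmod z \<le> b"
  proof -
    have "bounded (K \<union> L)" using K L by (simp add: compact_imp_bounded)
    then obtain b where "\<And>z. z \<in> K \<union> L \<Longrightarrow> cmod z \<le> b" by (auto simp: bounded_iff)
    then show ?thesis using that[of "max b 0"] by fastforce
  qed
  \<comment> \<open>\<open>E\<close> bounds the denominator, from \<open>Im w \<le> b\<close> and
    \<open>Im z \<ge> l\<close>; \<open>R\<close> is a generous sum of the resulting bounds for the
    entries.\<close>
  define E where "E = sqrt (b / l)"
  define R where "R = (b * E / k + (E + b * (E/k))) + (b * E / k + b*(b * E / k)) + (E + b * (E/k)) + b*E + E/k + E/k"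
  have E: "E \<ge> 0" using b l by (simp add: E_def)
  have "{g \<in> G. \<exists>w\<in>K. g (Pt w) \<in> Pt ` L} \<subseteq> mob ` {M \<in> SL2. mob M \<in> G \<and> norm M \<le> R}"
  proof clarify
    fix g w z assume g: "g \<in> G" "w \<in> K" "z \<in> L" "g (Pt w) = Pt z"
    then obtain M where M: "M \<in> SL2" "g = mob M" using G_PSL2 by blast
    obtain p q r s where pqrs: "M = (p,q,r,s)" by (cases M) auto
    have w: "Im w > 0" using g K by auto
    have z: "z = mobz M w" using g M w by (simp add: mob_uhp)
    let ?d = "of_real r * w + of_real s"
    have dn: "cmod ?d > 0" using SL2_denom[OF M(1) w pqrs] by simp
    have "Im z = Im w / (cmod ?d)^2"
      using M(1) unfolding z pqrs Im_mobz by simp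
    then have "l \<le> Im w / (cmod ?d)^2" using l(2) g by metis
    then have "(cmod ?d)^2 * l \<le> Im w" using dn by (simp add: field_simps)
    also have "\<dots> \<le> b" using b(2)[OF g(2)] abs_Im_le_cmod[of w] by linarith
    finally have "(cmod ?d)^2 \<le> b / l" using l by (simp add: field_simps)
    then have dE: "cmod ?d \<le> E" unfolding E_def by (rule real_le_rsqrt)
    \<comment> \<open>The imaginary part of the form bounds \<open>x\<close> because
      \<open>Im w \<ge> k\<close>; its real part then bounds \<open>y\<close>.\<close>
    have lin: "\<bar>x\<bar> \<le> C / k \<and> \<bar>y\<bar> \<le> C + b * (C / k)" if "cmod (of_real x * w + of_real y) \<le> C" for x y C
    proof -
      have "\<bar>Im (of_real x * w + of_real y)\<bar> \<le> C" "\<bar>Re (of_real x * w + of_real y)\<bar> \<le> C"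
        using that abs_Im_le_cmod abs_Re_le_cmod order_trans by blast+
      then have 1: "\<bar>x\<bar> * Im w \<le> C" "\<bar>x * Re w + y\<bar> \<le> C" using w by (simp_all add: abs_mult)
      have "\<bar>x\<bar> * k \<le> \<bar>x\<bar> * Im w" using k(2)[OF g(2)] by (simp add: mult_left_mono)
      then have 2: "\<bar>x\<bar> \<le> C / k" using 1 k by (simp add: field_simps)
      have "\<bar>Re w\<bar> \<le> b" using b(2)[OF g(2)] abs_Re_le_cmod[of w] by linarith
      then have "\<bar>x * Re w\<bar> \<le> (C/k) * b" unfolding abs_mult using 2 by (intro mult_mono) auto
      then show ?thesis using 1 2 by (auto simp: mult.commute)
    qed
    have "of_real p * w + of_real q = z * ?d" using z dn by (simp add: mobz_def pqrs)
    then have "cmod (of_real p * w + of_real q) = cmod z * cmod ?d" by (simp add: norm_mult)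
    also have "\<dots> \<le> b * E" using b(3)[OF g(3)] dE b(1) by (intro mult_mono) auto
    finally have "\<bar>p\<bar> \<le> b*E/k \<and> \<bar>q\<bar> \<le> b*E + b * (b*E / k)" by (rule lin)
    moreover have "\<bar>r\<bar> \<le> E/k \<and> \<bar>s\<bar> \<le> E + b * (E / k)" using lin[OF dE] .
    moreover have "norm M \<le> \<bar>p\<bar> + \<bar>q\<bar> + \<bar>r\<bar> + \<bar>s\<bar>" unfolding pqrs by (rule norm_mat2)
    moreover have "0 \<le> b * E" "0 \<le> b*(E/k)" "0 \<le> E / k" "0 \<le> b*E/k" using b E k by auto
    ultimately have "norm M \<le> R" unfolding R_def using E by linarith
    then show "g \<in> mob ` {M \<in> SL2. mob M \<in> G \<and> norm M \<le> R}" using M g by blast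
  qed
  then show ?thesis using finite_bounded_mats finite_subset by blast
qed auto

end

section \<open>Reflections and cusps\<close>

text \<open>The reflection in the imaginary axis, the standard form of every
  \<open>c \<circ> g\<close> with \<open>g\<close> admissible.\<close>

definition nu :: "hpt \<Rightarrow> hpt" where
  "nu = antimob (-1,0,0,1)"

lemma nu_simps [simp]: "nu (Pt z) = Pt (- cnj z)" "nu Inf = Inf"
  by (simp_all add: nu_def antimob_def mob_Pt mob_Inf)

text \<open>The parameter runs over the closed unit interval so that both ends of the geodesic are included.\<close>
definition line :: "mat2 \<Rightarrow> real \<Rightarrow> hpt" where
  "line B u = (if u = 1 then mob B Inf else mob B (Pt (Complex 0 (u / (1 - u)))))"

context real_fuchsian_group begin

text \<open>\<open>B\<close> carries the imaginary axis to the geodesic fixed by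
  \<open>c \<circ> g\<close>. It may still be changed by a dilation or by exchanging the ends, a
  freedom used through \<open>axis_scale\<close> and \<open>axis_flip\<close>.\<close>

definition refl_axis :: "(hpt \<Rightarrow> hpt) \<Rightarrow> mat2 \<Rightarrow> bool" where
  "refl_axis g B \<longleftrightarrow> B \<in> SL2 \<and> c \<circ> g \<circ> mob B = mob B \<circ> nu"

text \<open>For \<open>B\<close> in \<open>SL2\<close> this is the open unit interval together with
  those ends that are cusps.\<close>

definition ldom :: "mat2 \<Rightarrow> real set" where
  "ldom B = {u \<in> {0..1}. line B u \<in> hstar G}"

lemma admissible_G: "g \<in> adm \<Longrightarrow> g \<in> G"
  by (simp add: admissible_def)

text \<open>The twist is absorbed by passing from \<open>g\<close> to \<open>c \<circ> g\<close>,
  the same passage that turns twisted conjugacy into ordinary conjugacy in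
  \<open>twisted_iff\<close>.\<close>

lemma admissible_iff:
  assumes "g \<in> G" shows "g \<in> adm \<longleftrightarrow> c \<circ> g \<circ> (c \<circ> g) = id"
proof
  assume "g \<in> adm"
  then have "c \<circ> g \<circ> c = inv g" by (simp add: admissible_def twist_def)
  then have "c \<circ> g \<circ> c \<circ> g = inv g \<circ> g" by simp
  then show "c \<circ> g \<circ> (c \<circ> g) = id" using G_inv_comp assms by (simp add: o_assoc)
next
  assume "c \<circ> g \<circ> (c \<circ> g) = id"
  then have "(c \<circ> g \<circ> c) \<circ> g \<circ> inv g = id \<circ> inv g" by (simp add: o_assoc)
  then have "c \<circ> g \<circ> c = inv g" using G_inv_comp(2)[OF assms] by (simp add: o_assoc [symmetric])
  then show "g \<in> adm" using assms by (simp add: admissible_def twist_def)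
qed

text \<open>Covers all of \<open>G\<close>, because \<open>XR_lift\<close> has to derive
  admissibility from the matrix \<open>K\<close>.\<close>

lemma reflection_matrix0:
  assumes g: "g \<in> G" and A: "A \<in> SL2"
  shows "\<exists>K. mdet K = -1 \<and> c \<circ> g \<circ> mob A = mob A \<circ> antimob K"
proof -
  obtain M0 where M0: "mdet M0 = -1" "c = antimob M0" using c_antimob by auto
  obtain N where N: "N \<in> SL2" "g = mob N" using G_PSL2 g by blast
  have dN: "mdet N = 1" "mdet A = 1" using N A by (auto simp: SL2_def)
  let ?K = "mmul (madj A) (mmul (mmul M0 N) A)"
  have dK: "mdet ?K = -1" using M0 dN by (simp add: mdet_mmul mdet_madj)
  have "mob A \<circ> antimob ?K = antimob (mmul (mmul M0 N) A)"
    using dK dN A by (simp add: antimob_mob mmul_assoc[symmetric] mmul_madj)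
  also have "\<dots> = c \<circ> g \<circ> mob A"
    using M0 dN N by (simp add: antimob_mob mdet_mmul)
  finally show ?thesis using dK by metis
qed

text \<open>The square of the matrix acts trivially, hence is scalar. So either the trace vanishes
  or the matrix itself is scalar, and the latter would give -1 a real square root.\<close>

lemma reflection_matrix:
  assumes g: "g \<in> adm" and A: "A \<in> SL2"
  obtains p q r where "p\<^sup>2 + q * r = 1" "c \<circ> g \<circ> mob A = mob A \<circ> antimob (p,q,r,-p)"
proof -
  obtain K where K: "mdet K = -1" "c \<circ> g \<circ> mob A = mob A \<circ> antimob K"
    using reflection_matrix0[OF admissible_G[OF g] A] by auto
  obtain p q r s where pq: "K = (p,q,r,s)" by (cases K) auto
  have "mob A \<circ> (antimob K \<circ> antimob K) = c \<circ> g \<circ> (c \<circ> g) \<circ> mob A"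
    using K(2) by (simp add: o_assoc [symmetric]) (simp add: o_assoc)
  then have "mob A \<circ> (antimob K \<circ> antimob K) = mob A"
    using g admissible_iff[OF admissible_G[OF g]] by simp
  then have "mob (madj A) \<circ> (mob A \<circ> (antimob K \<circ> antimob K)) = mob (madj A) \<circ> mob A" by simp
  then have "mob (mmul K K) = id" using mob_inverse(2)[OF A] K(1) by (simp add: o_assoc antimob_mob)
  then have 1: "q * (p + s) = 0" "r * (p + s) = 0" "(p - s) * (p + s) = 0"
    unfolding pq mmul_simp using mob_eq_id[of "p * p + q * r" "p * q + q * s" "r * p + s * r" "r * q + s * s"]
    by (simp_all add: algebra_simps)
  have det: "p * s - q * r = -1" using K(1) pq by simp
  have "p + s = 0"
  proof (rule ccontr)
    assume "p + s \<noteq> 0"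
    then have "q = 0" "r = 0" "p = s" using 1 by auto
    then have "s * s = -1" using det by simp
    then show False by (metis not_square_less_zero neg_less_0_iff_less zero_less_one)
  qed
  then have s: "s = -p" by simp
  have "p\<^sup>2 + q * r = 1" using det s by (simp add: power2_eq_square)
  then show ?thesis using that K(2) pq s by blast
qed

lemma ex_axis:
  assumes "g \<in> adm" shows "\<exists>B. refl_axis g B"
proof -
  obtain p q r where K: "p\<^sup>2 + q * r = 1" "c \<circ> g \<circ> mob (1,0,0,1) = mob (1,0,0,1) \<circ> antimob (p,q,r,-p)"
    using reflection_matrix[OF assms, of "(1,0,0,1)"] by auto
  then have h: "c \<circ> g = antimob (p,q,r,-p)" by (simp add: mob_one)
  have d: "mdet (p,q,r,-p) = -1" "mdet (-1,0,0,1) = -1" using K(1) by (simp_all add: power2_eq_square)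
  have main: "refl_axis g B" if "B \<in> SL2" "mmul (p,q,r,-p) B = mmul B (-1,0,0,1)" for B
    using that d unfolding refl_axis_def h nu_def by (simp add: antimob_mob SL2_det)
  show ?thesis
  proof (cases "r = 0")
    case False
    \<comment> \<open>The columns are eigenvectors of the reflection matrix for -1 and 1, that is,
      the two ends of its axis, scaled to determinant 1.\<close>
    have "mmul (p,q,r,-p) (p-1, (p+1)/(-2*r), r, -1/2) = mmul (p-1, (p+1)/(-2*r), r, -1/2) (-1,0,0,1)"
      using False K(1) by (simp add: field_simps power2_eq_square) algebra
    moreover have "(p-1, (p+1)/(-2*r), r, -1/2) \<in> SL2" using False by (simp add: field_simps)
    ultimately show ?thesis using main by blast
  next
    case True
    then have "p = 1 \<or> p = -1" using K(1) by (simp add: power2_eq_1_iff)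
    then show ?thesis
    proof
      assume "p = 1"
      then show ?thesis using True by (intro exI[of _ "(-q/2,-1,1,0)"] main) auto
    next
      assume "p = -1"
      then show ?thesis using True by (intro exI[of _ "(1,q/2,0,1)"] main) auto
    qed
  qed
qed

lemma hstarE: assumes "z \<in> hstar G" shows "z \<in> uhp \<or> z \<in> bdry"
  using assms by (auto simp: hstar_def cusps_def)

lemma Cset_iff: "z \<in> Cset G c g \<longleftrightarrow> z \<in> hstar G \<and> c (g z) = z"
  unfolding Cset_def by (auto) (metis c_c_ap)

lemma axisD: "refl_axis g B \<Longrightarrow> B \<in> SL2" "refl_axis g B \<Longrightarrow> c (g (mob B w)) = mob B (nu w)"
  unfolding refl_axis_def by (auto dest: fun_cong)

lemma nu_fixed:
  assumes "w \<in> uhp \<or> w \<in> bdry" "nu w = w"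
  obtains "w = Inf" | y where "y \<ge> 0" "w = Pt (Complex 0 y)"
proof (cases w)
  case (Pt z)
  then have "- cnj z = z" using assms by simp
  then have "Re (- cnj z) = Re z" by metis
  then have "Re z = 0" by simp
  then have "w = Pt (Complex 0 (Im z))" using Pt by (simp add: complex_eq_iff)
  moreover have "Im z \<ge> 0" using assms Pt by auto
  ultimately show ?thesis using that by blast
qed (use that in auto)

lemma nu_line: "refl_axis g B \<Longrightarrow> c (g (line B u)) = line B u"
proof -
  assume "refl_axis g B"
  moreover have "nu (Pt (Complex 0 y)) = Pt (Complex 0 y)" for y by (simp add: complex_eq_iff)
  ultimately show ?thesis by (simp add: line_def axisD)
qed

text \<open>In the coordinate given by \<open>B\<close> the fixed points are those of
  \<open>nu\<close>, namely the nonnegative imaginary axis and infinity; \<open>y / (1 + y)\<close>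
  inverts the parametrisation.\<close>

lemma Cset_line:
  assumes ax: "refl_axis g B"
  shows "Cset G c g = line B ` ldom B"
proof
  show "line B ` ldom B \<subseteq> Cset G c g"
    using nu_line[OF ax] by (auto simp: ldom_def Cset_iff)
  show "Cset G c g \<subseteq> line B ` ldom B"
  proof
    fix z assume z: "z \<in> Cset G c g"
    have B: "B \<in> SL2" using ax axisD by blast
    define w where "w = mob (madj B) z"
    have zw: "z = mob B w" using B by (simp add: w_def)
    have wb: "w \<in> uhp \<or> w \<in> bdry" using z B hstarE[of z] mob_in_uhp mob_in_bdry unfolding zw Cset_iff by blast
    have "mob B (nu w) = mob B w" using z axisD(2)[OF ax] unfolding zw Cset_iff by metis
    then have "nu w = w" using mob_eq_iff B by blast
    from wb this show "z \<in> line B ` ldom B"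
    proof (cases rule: nu_fixed)
      case 1
      then have "line B 1 = z" using zw by (simp add: line_def)
      then show ?thesis using z by (intro image_eqI[of _ _ 1]) (auto simp: ldom_def Cset_iff)
    next
      case (2 y)
      have "y/(1+y) / (1 - y/(1+y)) = y" using 2 by (simp add: field_simps)
      moreover have "y/(1+y) \<noteq> 1" using 2 by (simp add: field_simps)
      ultimately have "line B (y/(1+y)) = z" using zw 2 by (simp add: line_def)
      then show ?thesis using z 2 by (intro image_eqI[of _ _ "y/(1+y)"]) (auto simp: ldom_def Cset_iff field_simps)
    qed
  qed
qed

lemma line_uhp: "B \<in> SL2 \<Longrightarrow> 0 < u \<Longrightarrow> u < 1 \<Longrightarrow> line B u \<in> uhp"
  by (simp add: line_def mob_in_uhp)

lemma line_bdry: "B \<in> SL2 \<Longrightarrow> line B 0 \<in> bdry" "B \<in> SL2 \<Longrightarrow> line B 1 \<in> bdry"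
  by (simp_all add: line_def mob_in_bdry)

lemma ldom_open: "B \<in> SL2 \<Longrightarrow> 0 < u \<Longrightarrow> u < 1 \<Longrightarrow> u \<in> ldom B"
  using line_uhp by (simp add: ldom_def hstar_def)

lemma ldom_0: "B \<in> SL2 \<Longrightarrow> 0 \<in> ldom B \<longleftrightarrow> line B 0 \<in> cusps G"
  and ldom_1: "B \<in> SL2 \<Longrightarrow> 1 \<in> ldom B \<longleftrightarrow> line B 1 \<in> cusps G"
  using line_bdry[of B] uhp_bdry by (auto simp: ldom_def hstar_def)

lemma ldom_cases:
  assumes "u \<in> ldom B" obtains "u = 0" | "u = 1" | "0 < u" "u < 1"
  using assms by (force simp: ldom_def)

section \<open>Cusps, translations and Shimizu's lemma\<close>

lemma parabolic_conj:
  assumes "parabolic g" "M \<in> SL2"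
  shows "parabolic (mob M \<circ> g \<circ> mob (madj M))"
proof -
  obtain p q r s where K: "(p,q,r,s) \<in> SL2" "g = mob (p,q,r,s)" "\<bar>p + s\<bar> = 2"
    using assms by (auto simp: parabolic_def)
  obtain a b c d where M: "M = (a,b,c,d)" by (cases M) auto
  obtain p' q' r' s' where K': "mmul (mmul M (p,q,r,s)) (madj M) = (p',q',r',s')"
    by (metis prod_cases4)
  have "p' + s' = (a*d - b*c) * (p + s)"
    using K' unfolding M by (auto simp: algebra_simps)
  then have "p' + s' = p + s" using assms(2) M by simp
  moreover have "mob M \<circ> g \<circ> mob (madj M) = mob (p',q',r',s')" "(p',q',r',s') \<in> SL2"
    unfolding K'[symmetric] using K assms(2) by (simp_all add: mob_mmul SL2_det SL2_mmul SL2_madj del: SL2_iff mdet_simp)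
  moreover have "mob M \<circ> g \<circ> mob (madj M) \<noteq> id"
  proof
    assume *: "mob M \<circ> g \<circ> mob (madj M) = id"
    have "g = mob (madj M) \<circ> (mob M \<circ> g \<circ> mob (madj M)) \<circ> mob M"
      using mob_inverse[OF assms(2)] by (simp add: o_assoc) (simp add: o_assoc [symmetric])
    then show False using assms(1) unfolding * parabolic_def using mob_inverse[OF assms(2)] by simp
  qed
  ultimately show ?thesis unfolding parabolic_def using K(3) by metis
qed

lemma cusps_G:
  assumes "g \<in> G" shows "g s \<in> cusps G \<longleftrightarrow> s \<in> cusps G"
proof -
  have *: "g s \<in> cusps G" if g: "g \<in> G" and s: "s \<in> cusps G" for g s
  proof -
    obtain h where h: "h \<in> G" "parabolic h" "h s = s" using s by (auto simp: cusps_def)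
    obtain M where M: "M \<in> SL2" "g = mob M" using G_PSL2 g by blast
    have "g \<circ> h \<circ> inv g \<in> G" using g h G_comp G_inv by simp
    moreover have "parabolic (g \<circ> h \<circ> inv g)" using parabolic_conj[OF h(2) M(1)] M by (simp add: inv_mob)
    moreover have "(g \<circ> h \<circ> inv g) (g s) = g s" using g h by simp
    ultimately show ?thesis using s G_bdry[OF g] unfolding cusps_def by blast
  qed
  show ?thesis using *[of g s] *[of "inv g" "g s"] assms G_inv by auto
qed

lemma hstar_G: "g \<in> G \<Longrightarrow> g z \<in> hstar G \<longleftrightarrow> z \<in> hstar G"
  by (simp add: hstar_def cusps_G G_uhp)

text \<open>A parabolic element fixing infinity is upper triangular; determinant 1 and trace 2 up to
  sign make the square of \<open>p - t\<close> vanish. The remaining sign is removed by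
  \<open>mats_uminus\<close>.\<close>

lemma cusp_translation:
  assumes A: "A \<in> SL2" and s: "mob A Inf \<in> cusps G"
  obtains \<tau> where "\<tau> \<noteq> 0" "(1,\<tau>,0,1) \<in> mats A"
proof -
  obtain g where g: "g \<in> G" "parabolic g" "g (mob A Inf) = mob A Inf"
    using s by (auto simp: cusps_def)
  have "parabolic (mob (madj A) \<circ> g \<circ> mob (madj (madj A)))" using parabolic_conj g A SL2_madj by blast
  moreover have "madj (madj A) = A" by (cases A) simp
  ultimately have par: "parabolic (mob (madj A) \<circ> g \<circ> mob A)" by simp
  then obtain p q r t where K: "(p,q,r,t) \<in> SL2" "mob (madj A) \<circ> g \<circ> mob A = mob (p,q,r,t)" "\<bar>p + t\<bar> = 2"
    by (auto simp: parabolic_def)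
  have "mob (p,q,r,t) Inf = Inf" using g A by (simp add: K(2)[symmetric])
  then have r: "r = 0" by (auto simp: mob_Inf split: if_splits)
  have "mob A \<circ> mob (p,q,r,t) = g \<circ> mob A"
    using mob_inverse[OF A] by (simp add: K(2)[symmetric] o_assoc)
  then have mats: "(p,q,r,t) \<in> mats A" using K g by (metis matsI)
  have pt: "p * t = 1" using K r by simp
  have id: "mob (p,q,r,t) \<noteq> id" using par K by (simp add: parabolic_def)
  have "(p + t)\<^sup>2 = 4" using K(3) by (metis power2_abs power2_eq_square num_double numeral_times_numeral)
  then have "(p - t)\<^sup>2 = 0" using pt by (simp add: power2_eq_square algebra_simps)
  then have "t = p" by simp
  then have "p = 1 \<or> p = -1" using pt by (simp add: square_eq_1_iff)
  then show ?thesis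
  proof
    assume p: "p = 1"
    then have "q \<noteq> 0" using id r \<open>t = p\<close> mob_one by auto
    then show ?thesis using that mats r p \<open>t = p\<close> by blast
  next
    assume p: "p = -1"
    then have "q \<noteq> 0" using id r \<open>t = p\<close> mob_one mob_uminus[of 1 0 0 1] by auto
    then show ?thesis using that[of "-q"] mats_uminus[OF mats] r p \<open>t = p\<close> by simp
  qed
qed

text \<open>Conjugating the translation by powers of a contraction gives translations by
  \<open>l^(2*n) * \<tau>\<close>, which accumulate at the identity. This is why a geodesic with a
  nontrivial dilation cannot end in a cusp.\<close>

lemma translation_not_contracted:
  assumes A: "A \<in> SL2" and t: "(1,\<tau>,0,1) \<in> mats A" "\<tau> \<noteq> 0" and l: "(l,0,0,1/l) \<in> mats A" "l > 0"
  shows "l = 1"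
proof -
  have *: False if l: "(l,0,0,1/l) \<in> mats A" "l > 0" "l < 1" for l
  proof -
    define f where "f n = (1::real, l^(2*n) * \<tau>, 0::real, 1::real)" for n
    have f: "f n \<in> mats A" for n
    proof (induction n)
      case (Suc n)
      have "mmul (mmul (l,0,0,1/l) (f n)) (madj (l,0,0,1/l)) = f (Suc n)"
        using l by (simp add: f_def power2_eq_square)
      then show ?case using mats_mmul mats_madj l Suc by metis
    qed (use t in \<open>simp add: f_def\<close>)
    show False
    proof (rule mats_bounded_finite_inj[OF A f])
      fix n
      have "\<bar>l^(2*n) * \<tau>\<bar> \<le> \<bar>\<tau>\<bar>" using l by (simp add: abs_mult power_le_one mult_left_le_one_le)
      then show "norm (f n) \<le> 2 + \<bar>\<tau>\<bar>"
        unfolding f_def using norm_mat2[of 1 "l^(2*n) * \<tau>" 0 1] by simp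
    next
      show "inj f"
      proof (rule injI)
        fix m n assume "f m = f n"
        then have "l^(2*m) = l^(2*n)" using t by (simp add: f_def)
        then show "m = n" using l power_inject_exp'[of l "2*m" "2*n"] by simp
      qed
    qed
  qed
  moreover have "(1/l,0,0,1/(1/l)) \<in> mats A" using mats_madj[OF l(1)] by simp
  ultimately show ?thesis using *[of l] *[of "1/l"] l by (cases l "1::real" rule: linorder_cases) auto
qed

text \<open>Shimizu's lemma: otherwise iterating \<open>M \<mapsto> M T M\<close>-inverse, with \<open>T\<close> the translation by \<open>\<tau>\<close>, gives
  infinitely many bounded matrices, their lower left entries strictly decreasing in absolute value.\<close>
lemma shimizu:
  assumes A: "A \<in> SL2" and t: "(1,\<tau>,0,1) \<in> mats A" and M: "(p,q,r,s) \<in> mats A" "r \<noteq> 0"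
    and False: "\<tau> \<noteq> 0"
  shows "\<bar>r * \<tau>\<bar> \<ge> 1"
proof (rule ccontr)
  assume lt: "\<not> \<bar>r * \<tau>\<bar> \<ge> 1"
  define k where "k = \<bar>r * \<tau>\<bar>"
  have k: "0 \<le> k" "k < 1" using lt by (simp_all add: k_def)
  define f where "f = rec_nat (p,q,r,s) (\<lambda>_ M. mmul (mmul M (1,\<tau>,0,1)) (madj M))"
  have f0: "f 0 = (p,q,r,s)" and fS: "f (Suc n) = mmul (mmul (f n) (1,\<tau>,0,1)) (madj (f n))" for n
    by (simp_all add: f_def)
  \<comment> \<open>\<open>A0\<close> is made to satisfy \<open>1 + A0 * k \<le> A0\<close>, so that
    the bound \<open>\<bar>a n\<bar> \<le> A0\<close> survives the recursion
    \<open>a (Suc n) = 1 - a n * e n * \<tau>\<close>.\<close>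
  define A0 where "A0 = \<bar>p\<bar> + 1 / (1 - k)"
  have A0: "A0 \<ge> \<bar>p\<bar>" "1 + A0 * k \<le> A0"
  proof -
    show "A0 \<ge> \<bar>p\<bar>" using k by (simp add: A0_def)
    have "A0 * (1 - k) = \<bar>p\<bar> * (1 - k) + 1" using k by (simp add: A0_def algebra_simps)
    then have "A0 * (1 - k) \<ge> 1" using k by simp
    then show "1 + A0 * k \<le> A0" by (simp add: algebra_simps)
  qed
  have fm: "f n \<in> mats A" for n
    by (induction n) (use M t in \<open>auto simp: f0 fS intro!: mats_mmul mats_madj\<close>)
  define a where "a n = fst (f n)" for n
  define e where "e n = fst (snd (snd (f n)))" for n
  have step: "f (Suc n) = (1 - a n * e n * \<tau>, a n * a n * \<tau>, - (e n * e n * \<tau>), 1 + a n * e n * \<tau>)" for n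
  proof -
    obtain x y z w where xyz: "f n = (x,y,z,w)" by (metis prod_cases4)
    then have "x * w - y * z = 1" using fm[of n] mats_SL2 by fastforce
    moreover have "a n = x" "e n = z" using xyz by (simp_all add: a_def e_def)
    ultimately show ?thesis unfolding fS xyz by (simp add: algebra_simps)
  qed
  have aS: "a (Suc n) = 1 - a n * e n * \<tau>" and eS: "e (Suc n) = - (e n * e n * \<tau>)" for n
    unfolding a_def[of "Suc n"] e_def[of "Suc n"] step by simp_all
  have inv: "\<bar>a n\<bar> \<le> A0 \<and> e n \<noteq> 0 \<and> \<bar>e n * \<tau>\<bar> \<le> k" for n
  proof (induction n)
    case 0
    then show ?case using A0 M by (simp add: a_def e_def f0 k_def)
  next
    case (Suc n)
    have "\<bar>a n * (e n * \<tau>)\<bar> \<le> A0 * k" unfolding abs_mult[of "a n"] using Suc by (intro mult_mono) auto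
    then have 1: "\<bar>a (Suc n)\<bar> \<le> A0" using A0 unfolding aS by (simp add: mult.assoc)
    have "\<bar>e n * \<tau>\<bar> * \<bar>e n * \<tau>\<bar> \<le> k * 1" using Suc k by (intro mult_mono) auto
    then have "\<bar>e (Suc n) * \<tau>\<bar> \<le> k" unfolding eS by (simp add: abs_mult mult_ac)
    then show ?case using 1 Suc False by (simp add: eS)
  qed
  have dec: "\<bar>e (Suc n)\<bar> < \<bar>e n\<bar>" for n
  proof -
    have "\<bar>e (Suc n)\<bar> = \<bar>e n\<bar> * \<bar>e n * \<tau>\<bar>" by (simp add: eS abs_mult)
    also have "\<dots> < \<bar>e n\<bar> * 1" using inv[of n] k by (intro mult_strict_left_mono) auto
    finally show ?thesis by simp
  qed
  then have "strict_mono (\<lambda>n. - \<bar>e n\<bar>)" by (simp add: strict_mono_Suc_iff)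
  then have "inj (\<lambda>n. - \<bar>e n\<bar>)" by (rule strict_mono_imp_inj_on)
  then have injf: "inj f" unfolding inj_def e_def by metis
  have e0: "\<bar>e n\<bar> \<le> \<bar>r\<bar>" for n
  proof (induction n)
    case (Suc n)
    then show ?case using dec[of n] by simp
  qed (simp add: e_def f0)
  \<comment> \<open>The sequence is taken from index 1 on, where \<open>step\<close> expresses all
    four entries by \<open>a n\<close> and \<open>e n\<close>.\<close>
  show False
  proof (rule mats_bounded_finite_inj[OF A, of "\<lambda>n. f (Suc n)"])
    show "inj (\<lambda>n. f (Suc n))" using injf by (intro injI) (auto dest: injD)
    fix n
    show "f (Suc n) \<in> mats A" by (rule fm)
    have "\<bar>a n * e n * \<tau>\<bar> \<le> A0 * k" unfolding abs_mult[of "a n"] mult.assoc using inv[of n] by (intro mult_mono) auto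
    moreover have "\<bar>a n * a n * \<tau>\<bar> \<le> A0 * A0 * \<bar>\<tau>\<bar>" unfolding abs_mult using inv[of n] by (intro mult_mono) auto
    moreover have "\<bar>- (e n * e n * \<tau>)\<bar> \<le> \<bar>r\<bar>" using e0[of "Suc n"] eS by simp
    ultimately show "norm (f (Suc n)) \<le> (1 + A0 * k) + A0*A0*\<bar>\<tau>\<bar> + \<bar>r\<bar> + (1 + A0*k)"
      using norm_mat2[of "1 - a n * e n * \<tau>" "a n * a n * \<tau>" "- (e n * e n * \<tau>)" "1 + a n * e n * \<tau>"]
      unfolding step by linarith
  qed
qed

text \<open>If the reflection \<open>h = c \<circ> g\<close> has lower left entry \<open>r\<close> and \<open>T\<close> is the translation by \<open>\<tau>\<close>, then \<open>h T h\<close>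
  lies in \<open>G\<close> and has lower left entry \<open>r\<^sup>2 \<tau>\<close>; Shimizu's lemma then forces \<open>r = 0\<close>.\<close>
lemma high_axis_vertical:
  assumes A: "A \<in> SL2" and t: "(1,\<tau>,0,1) \<in> mats A" "\<tau> \<noteq> 0" and g: "g \<in> adm"
    and v: "Im v > \<bar>\<tau>\<bar>" "c (g (mob A (Pt v))) = mob A (Pt v)"
  shows "c (g (mob A (Pt (Complex (Re v) y)))) = mob A (Pt (Complex (Re v) y))"
    "c (g (mob A Inf)) = mob A Inf"
proof -
  obtain p q r where K: "p\<^sup>2 + q * r = 1" "c \<circ> g \<circ> mob A = mob A \<circ> antimob (p,q,r,-p)"
    using reflection_matrix[OF g A] .
  have h: "c (g (mob A w)) = mob A (antimob (p,q,r,-p) w)" for w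
    using K(2) by (metis comp_apply)
  have fx: "antimob (p,q,r,-p) (Pt v) = Pt v" using v(2) A mob_eq_iff unfolding h by blast
  let ?x = "Re v" and ?y = "Im v"
  have y: "?y > 0" using v t by linarith
  have nz: "of_real r * cnj v + of_real (-p) \<noteq> 0" using fx by (auto simp: antimob_def mob_Pt split: if_splits)
  then have "(of_real p * cnj v + of_real q) = v * (of_real r * cnj v + of_real (-p))"
    using fx by (simp add: antimob_def mob_Pt field_simps split: if_splits)
  then have "Re (of_real p * cnj v + of_real q) = Re (v * (of_real r * cnj v + of_real (-p)))" by metis
  then have re: "2 * p * ?x + q = r * (?x\<^sup>2 + ?y\<^sup>2)" by (simp add: algebra_simps power2_eq_square)
  have "r = 0"
  proof (rule ccontr)
    assume r: "r \<noteq> 0"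
    \<comment> \<open>For nonzero \<open>r\<close> the axis is the semicircle of radius 1/|r| about
      p/r, so no point on it is higher than 1/|r|.\<close>
    have "(r * ?x - p)\<^sup>2 + (r * ?y)\<^sup>2 = r * (r * (?x\<^sup>2 + ?y\<^sup>2)) - 2 * r * p * ?x + p\<^sup>2"
      by (simp add: power2_eq_square algebra_simps)
    also have "\<dots> = 1" using K(1) unfolding re[symmetric] by (simp add: algebra_simps)
    finally have "(r * ?y)\<^sup>2 \<le> 1" by (smt (verit) zero_le_power2)
    then have ry: "\<bar>r\<bar> * ?y \<le> 1" using y by (simp add: power2_le_iff_abs_le abs_mult abs_square_le_1)
    obtain t' where t': "t' \<in> G" "t' \<circ> mob A = mob A \<circ> mob (1,\<tau>,0,1)" using t by (auto simp: mats_def)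
    have d: "mdet (p,q,r,-p) = -1" using K(1) by (simp add: power2_eq_square)
    let ?N = "mmul (mmul (p,q,r,-p) (1,\<tau>,0,1)) (p,q,r,-p)"
    have "?N \<in> mats A"
    proof (rule matsI)
      show "?N \<in> SL2" using d by (simp only: SL2_def mdet_mmul mem_Collect_eq) simp
      \<comment> \<open>Unfolded this is \<open>c g t' c g\<close>, the translation conjugated by
        the reflection, in a form that visibly lies in \<open>G\<close>.\<close>
      show "twist c (g \<circ> t') \<circ> g \<in> G" using g t' admissible_G by (intro G_comp twist_G) auto
      have dT: "mdet (1,\<tau>,0,1) = 1" by simp
      have d2: "mdet (mmul (p,q,r,-p) (1,\<tau>,0,1)) = -1" using d by (simp only: mdet_mmul) simp
      show "twist c (g \<circ> t') \<circ> g \<circ> mob A = mob A \<circ> mob ?N"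
      proof
        fix w
        have t'w: "t' (mob A w) = mob A (mob (1,\<tau>,0,1) w)" for w using t'(2) by (metis comp_apply)
        have "(twist c (g \<circ> t') \<circ> g \<circ> mob A) w = mob A ((antimob (p,q,r,-p) \<circ> mob (1,\<tau>,0,1) \<circ> antimob (p,q,r,-p)) w)"
          by (simp add: twist_def h t'w)
        also have "antimob (p,q,r,-p) \<circ> mob (1,\<tau>,0,1) \<circ> antimob (p,q,r,-p) = mob ?N"
          using d d2 dT by (simp add: antimob_mob del: mdet_simp mmul_simp)
        finally show "(twist c (g \<circ> t') \<circ> g \<circ> mob A) w = (mob A \<circ> mob ?N) w" by (simp only: comp_def)
      qed
    qed
    moreover have "?N = (fst ?N, fst (snd ?N), r * r * \<tau>, snd (snd (snd ?N)))"
      by (simp add: algebra_simps)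
    ultimately have "\<bar>r * r * \<tau> * \<tau>\<bar> \<ge> 1" using shimizu[OF A t(1), of "fst ?N" "fst (snd ?N)" "r*r*\<tau>" "snd (snd (snd ?N))"] r t(2) by simp
    moreover have "\<bar>r * r * \<tau> * \<tau>\<bar> < 1"
    proof -
      have "\<bar>r\<bar> * \<bar>\<tau>\<bar> < \<bar>r\<bar> * ?y" using r v by simp
      then have "\<bar>r * \<tau>\<bar> < 1" using ry by (simp add: abs_mult)
      then have "\<bar>r * \<tau>\<bar> * \<bar>r * \<tau>\<bar> < 1" by (metis abs_ge_zero mult_strict_mono' mult_1)
      then show ?thesis by (simp add: abs_mult mult_ac)
    qed
    ultimately show False by simp
  qed
  then have p: "p = 1 \<or> p = -1" using K by (simp add: power2_eq_1_iff)
  have "antimob (p,q,r,-p) Inf = Inf" using \<open>r = 0\<close> by (simp add: antimob_def mob_Inf)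
  then show "c (g (mob A Inf)) = mob A Inf" by (simp add: h)
  have q: "q = - 2 * p * ?x" using re \<open>r = 0\<close> by simp
  have "antimob (p,q,r,-p) (Pt (Complex ?x y)) = Pt (Complex ?x y)"
    using p unfolding q \<open>r = 0\<close> by (auto simp: antimob_def mob_Pt complex_eq_iff)
  then show "c (g (mob A (Pt (Complex (Re v) y)))) = mob A (Pt (Complex (Re v) y))" by (simp add: h)
qed

end

section \<open>The topology of the extended half-plane\<close>

text \<open>Expanding the square cancels \<open>r\<^sup>2\<close>; the inequality becomes linear in
  \<open>r\<close>, which makes monotonicity and the behaviour under \<open>mob\<close> easy to read
  off.\<close>

lemma horoball_Pt_iff:
  assumes "r > 0" shows "Pt z \<in> horoball (Pt (of_real x)) r \<longleftrightarrow> (cmod (z - of_real x))\<^sup>2 < 2 * r * Im z"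
proof -
  have "Pt z \<in> horoball (Pt (of_real x)) r \<longleftrightarrow> (cmod (z - (of_real x + \<i> * of_real r)))\<^sup>2 < r\<^sup>2"
    using assms by (simp add: horoball_def abs_le_square_iff[symmetric] power_less_imp_less_base
      power2_less_imp_less flip: not_le)
  also have "(cmod (z - (of_real x + \<i> * of_real r)))\<^sup>2 = (cmod (z - of_real x))\<^sup>2 - 2 * r * Im z + r\<^sup>2"
    unfolding cmod_power2 by (simp add: power2_eq_square algebra_simps)
  finally show ?thesis by simp
qed

text \<open>For nonzero \<open>c\<close> the squared distance of the image from a/c is
  \<open>1 / (c\<^sup>2 * m)\<close> and its height is \<open>Im w / m\<close>, with
  \<open>m\<close> the squared modulus of the denominator. The factor \<open>m\<close> cancels, so
  horoballs pull back to half-planes.\<close>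

lemma horoball_mob_iff:
  assumes A: "(a,b,c,d) \<in> SL2" and r: "r > 0" and w: "Im w > 0"
  shows "mob (a,b,c,d) (Pt w) \<in> horoball (mob (a,b,c,d) Inf) r \<longleftrightarrow> Im w > (if c = 0 then r / a\<^sup>2 else 1 / (2 * r * c\<^sup>2))"
proof (cases "c = 0")
  case True
  then have ad: "a * d = 1" using A by simp
  then have a0: "a \<noteq> 0" by auto
  then have a: "a \<noteq> 0" "d = 1 / a" using ad by (auto simp: field_simps)
  have "Im (mobz (a,b,c,d) w) = a\<^sup>2 * Im w" using True ad a
    by (simp add: Im_mobz norm_divide power_divide)
  moreover have "mob (a,b,c,d) (Pt w) \<in> horoball (mob (a,b,c,d) Inf) r \<longleftrightarrow> r < Im (mobz (a,b,c,d) w)"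
    unfolding mob_uhp[OF A w] using True by (simp add: mob_Inf horoball_def)
  ultimately show ?thesis using True a0 by (simp add: field_simps)
next
  case False
  let ?e = "of_real c * w + of_real d"
  have e: "?e \<noteq> 0" using SL2_denom[OF A w] by simp
  have "mobz (a,b,c,d) w - of_real (a/c) = (of_real (b*c - a*d)) / (of_real c * ?e)"
    using False e by (simp add: mobz_def field_simps)
  also have "b*c - a*d = -1" using A by simp
  finally have 1: "(cmod (mobz (a,b,c,d) w - of_real (a/c)))\<^sup>2 = 1 / (c\<^sup>2 * (cmod ?e)\<^sup>2)"
    by (simp add: norm_divide norm_mult power_divide power_mult_distrib)
  have 2: "Im (mobz (a,b,c,d) w) = Im w / (cmod ?e)\<^sup>2" using A by (simp add: Im_mobz)
  have "mob (a,b,c,d) (Pt w) \<in> horoball (mob (a,b,c,d) Inf) r \<longleftrightarrow> 1 / (c\<^sup>2 * (cmod ?e)\<^sup>2) < 2 * r * (Im w / (cmod ?e)\<^sup>2)"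
    using False A w r horoball_Pt_iff[OF r, of "mobz (a,b,c,d) w" "a/c"] 1 2
    by (simp add: mob_uhp mob_Inf del: SL2_iff)
  also have "\<dots> \<longleftrightarrow> Im w > 1 / (2 * r * c\<^sup>2)"
    using False e r by (simp add: field_simps)
  finally show ?thesis using False by simp
qed

lemma horoball_uhp:
  assumes "s \<in> bdry" "r > 0" shows "horoball s r \<subseteq> uhp"
proof
  fix z assume z: "z \<in> horoball s r"
  show "z \<in> uhp"
  proof (cases s)
    case Inf
    then show ?thesis using z assms by (auto simp: horoball_def)
  next
    case (Pt x)
    then obtain w where w: "z = Pt w" using z by (auto simp: horoball_def)
    have x: "x = of_real (Re x)" using assms Pt by (simp add: complex_eq_iff)
    have "(cmod (w - of_real (Re x)))\<^sup>2 < 2 * r * Im w"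
      using horoball_Pt_iff[OF assms(2), of w "Re x"] z unfolding w Pt x[symmetric] by simp
    then have "0 < 2 * r * Im w" by (smt (verit) zero_le_power2)
    then show ?thesis using assms w by (simp add: zero_less_mult_iff)
  qed
qed

text \<open>Together with \<open>horoball_high\<close> this lets neighbourhoods of a cusp be handled
  as half-planes \<open>Im w > R\<close> in a coordinate with the cusp at infinity.\<close>

lemma horoball_deep:
  assumes A: "A \<in> SL2"
  shows "\<exists>r>0. \<forall>z\<in>horoball (mob A Inf) r. \<exists>w. z = mob A (Pt w) \<and> Im w > 0 \<and> Im w > R"
proof -
  obtain a b c d where abcd: "A = (a,b,c,d)" by (cases A) auto
  \<comment> \<open>Solves the threshold of \<open>horoball_mob_iff\<close> for the value
    \<open>max R 1\<close>; the 1 keeps \<open>r\<close> positive for every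
    \<open>R\<close>.\<close>
  define r where "r = (if c = 0 then (max R 1) * a\<^sup>2 else 1 / (2 * max R 1 * c\<^sup>2))"
  have r: "r > 0" using A abcd by (cases "a = 0") (auto simp: r_def intro!: mult_pos_pos)
  have thr: "(if c = 0 then r / a\<^sup>2 else 1 / (2 * r * c\<^sup>2)) = max R 1"
  proof -
    have "a \<noteq> 0" if "c = 0" using that A abcd by auto
    then show ?thesis by (auto simp: r_def)
  qed
  show ?thesis
  proof (intro exI[of _ r] conjI r ballI)
    fix z assume z: "z \<in> horoball (mob A Inf) r"
    have "mob A Inf \<in> bdry" using A by (simp add: mob_in_bdry)
    then have zu: "z \<in> uhp" using z horoball_uhp r by blast
    have "mob (madj A) z \<in> uhp" using zu A SL2_madj mob_in_uhp by blast
    then obtain w where w: "mob (madj A) z = Pt w" "Im w > 0" by (auto simp: uhp_def)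
    then have "z = mob A (Pt w)" using A by (metis mob_madj_eq(1))
    then show "\<exists>w. z = mob A (Pt w) \<and> Im w > 0 \<and> Im w > R"
      using horoball_mob_iff[of a b c d r w] z A r w thr abcd by fastforce
  qed
qed

lemma horoball_high:
  assumes A: "A \<in> SL2" and r: "r > 0"
  shows "\<exists>R>0. \<forall>w. Im w > R \<longrightarrow> mob A (Pt w) \<in> horoball (mob A Inf) r"
proof -
  obtain a b c d where abcd: "A = (a,b,c,d)" by (cases A) auto
  define R where "R = (if c = 0 then r / a\<^sup>2 else 1 / (2 * r * c\<^sup>2))"
  have "a \<noteq> 0" if "c = 0" using that A abcd by auto
  then have "R > 0" using r by (auto simp: R_def)
  then show ?thesis
    using horoball_mob_iff[of a b c d r] A r abcd unfolding R_def[symmetric] by (intro exI[of _ R]) auto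
qed

lemma ex_mob_Inf: "s \<in> bdry \<Longrightarrow> \<exists>A\<in>SL2. mob A Inf = s"
proof (cases s)
  case Inf
  then show ?thesis by (intro bexI[of _ "(1,0,0,1)"]) (auto simp: mob_Inf)
next
  case (Pt z)
  assume "s \<in> bdry"
  then have "z = of_real (Re z)" using Pt by (simp add: complex_eq_iff)
  then show ?thesis using Pt by (intro bexI[of _ "(Re z,-1,1,0)"]) (auto simp: mob_Inf)
qed

text \<open>Horoballs at infinity shrink as the parameter grows, all others grow.\<close>
lemma horoball_mono: "0 < r \<Longrightarrow> r \<le> r' \<Longrightarrow> s \<in> bdry \<Longrightarrow> horoball s r' \<inter> horoball s r = horoball s (if s = Inf then r' else r)"
proof (cases s)
  case Inf
  assume "r \<le> r'"
  then show ?thesis using Inf by (auto simp: horoball_def)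
next
  case (Pt x)
  assume r: "0 < r" "r \<le> r'" and s: "s \<in> bdry"
  have x: "x = of_real (Re x)" using s Pt by (simp add: complex_eq_iff)
  have "horoball s r \<subseteq> horoball s r'"
  proof
    fix z assume z: "z \<in> horoball s r"
    then obtain w where w: "z = Pt w" unfolding Pt by (auto simp: horoball_def)
    have h: "(cmod (w - of_real (Re x)))\<^sup>2 < 2 * r * Im w" "Im w > 0"
      using horoball_Pt_iff[OF r(1), of w "Re x"] z w horoball_uhp[OF s r(1)] unfolding Pt x[symmetric] by auto
    have "2 * r * Im w \<le> 2 * r' * Im w" using r h by simp
    then have "(cmod (w - of_real (Re x)))\<^sup>2 < 2 * r' * Im w" using h(1) by (rule order.strict_trans2[rotated])
    then show "z \<in> horoball s r'" using horoball_Pt_iff[of r' w "Re x"] h r unfolding w Pt x[symmetric] by simp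
  qed
  then show ?thesis using Pt by auto
qed

lemma istopology_hstar: "istopology (hstar_open G)"
  unfolding istopology_def
proof (rule conjI; intro allI impI)
  fix S T assume S: "hstar_open G S" and T: "hstar_open G T"
  have "{z. Pt z \<in> S \<inter> T \<and> 0 < Im z} = {z. Pt z \<in> S \<and> 0 < Im z} \<inter> {z. Pt z \<in> T \<and> 0 < Im z}" by auto
  then have "open {z. Pt z \<in> S \<inter> T \<and> 0 < Im z}" using S T by (auto simp: hstar_open_def)
  moreover have "\<exists>r>0. horoball s r \<subseteq> S \<inter> T" if s: "s \<in> (S \<inter> T) \<inter> cusps G" for s
  proof -
    obtain r1 r2 where r: "r1 > 0" "horoball s r1 \<subseteq> S" "r2 > 0" "horoball s r2 \<subseteq> T"
    proof -
      have "\<exists>r>0. horoball s r \<subseteq> S" "\<exists>r>0. horoball s r \<subseteq> T" using S T s unfolding hstar_open_def by blast+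
      then show ?thesis using that by blast
    qed
    have s': "s \<in> bdry" using s by (auto simp: cusps_def)
    show ?thesis
      using horoball_mono[OF r(1) _ s', of r2] horoball_mono[OF r(3) _ s', of r1] r
      by (cases "r1 \<le> r2") (auto 0 4 split: if_splits intro: exI[of _ r1] exI[of _ r2])
  qed
  ultimately show "hstar_open G (S \<inter> T)" using S T by (auto simp: hstar_open_def)
next
  fix K assume K: "\<forall>S\<in>K. hstar_open G S"
  have "{z. Pt z \<in> \<Union>K \<and> 0 < Im z} = (\<Union>S\<in>K. {z. Pt z \<in> S \<and> 0 < Im z})" by auto
  then have "open {z. Pt z \<in> \<Union>K \<and> 0 < Im z}" using K by (auto simp: hstar_open_def)
  moreover have "\<exists>r>0. horoball s r \<subseteq> \<Union>K" if s: "s \<in> \<Union>K \<inter> cusps G" for s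
  proof -
    obtain S where S: "S \<in> K" "s \<in> S \<inter> cusps G" using s by blast
    then obtain r where "r > 0" "horoball s r \<subseteq> S" using K unfolding hstar_open_def by blast
    then show ?thesis using S by blast
  qed
  ultimately show "hstar_open G (\<Union>K)" using K by (auto simp: hstar_open_def)
qed

lemma openin_hstar: "openin (hstar_top G) U \<longleftrightarrow> hstar_open G U"
  by (simp add: hstar_top_def topology_inverse' istopology_hstar)

lemma topspace_hstar: "topspace (hstar_top G) = hstar G"
proof -
  have "{z. Pt z \<in> hstar G \<and> 0 < Im z} = {z. 0 < Im z}" by (auto simp: hstar_def)
  then have "open {z. Pt z \<in> hstar G \<and> 0 < Im z}" by (simp add: open_halfspace_Im_gt)
  moreover have "horoball s 1 \<subseteq> hstar G" if "s \<in> cusps G" for s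
    using that horoball_uhp[of s 1] by (auto simp: hstar_def cusps_def)
  ultimately have "hstar_open G (hstar G)" unfolding hstar_open_def using zero_less_one by blast
  then have "openin (hstar_top G) (hstar G)" by (simp add: openin_hstar)
  moreover have "U \<subseteq> hstar G" if "openin (hstar_top G) U" for U
    using that by (simp add: openin_hstar hstar_open_def)
  ultimately show ?thesis by (metis openin_subset openin_topspace subset_antisym)
qed

lemma openin_quot: "openin (quot_top T f) U \<longleftrightarrow> U \<subseteq> f ` topspace T \<and> openin T {x \<in> topspace T. f x \<in> U}"
  by (simp add: quot_top_def topology_inverse' istopology_quot)

lemma topspace_quot: "topspace (quot_top T f) = f ` topspace T"
proof -
  have "{x \<in> topspace T. f x \<in> f ` topspace T} = topspace T" by auto
  then have "openin (quot_top T f) (f ` topspace T)" by (simp add: openin_quot)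
  moreover have "U \<subseteq> f ` topspace T" if "openin (quot_top T f) U" for U
    using that by (simp add: openin_quot)
  ultimately show ?thesis by (metis openin_subset openin_topspace subset_antisym)
qed

lemma openin_X: "openin (X_top G) U \<longleftrightarrow> U \<subseteq> orbit G ` hstar G \<and> hstar_open G {z \<in> hstar G. orbit G z \<in> U}"
  by (simp add: X_top_def openin_quot openin_hstar topspace_hstar)

lemma topspace_X: "topspace (X_top G) = orbit G ` hstar G"
  by (simp add: X_top_def topspace_quot topspace_hstar)

lemma line_interior:
  assumes "B \<in> SL2" "0 < u" "u < 1"
  shows "line B u = Pt (mobz B (Complex 0 (u / (1 - u))))"
  using assms by (simp add: line_def mob_uhp)

text \<open>Composition with z to -1/z, which exchanges the two ends of the imaginary axis; claims
  about the end 0 follow from those about the end at infinity.\<close>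

definition flip :: "mat2 \<Rightarrow> mat2" where
  "flip B = mmul B (0,-1,1,0)"

lemma flip_SL2: "B \<in> SL2 \<Longrightarrow> flip B \<in> SL2"
  by (simp add: flip_def SL2_mmul del: mmul_simp)

lemma mob_flip: "B \<in> SL2 \<Longrightarrow> mob (flip B) = mob B \<circ> mob (0,-1,1,0)"
  by (simp add: flip_def mob_mmul SL2_det)

lemma mob_J: "y \<noteq> 0 \<Longrightarrow> mob (0,-1,1,0) (Pt (Complex 0 y)) = Pt (Complex 0 (1 / y))"
  by (auto simp: mob_Pt complex_eq_iff Re_divide Im_divide power2_eq_square)

lemma line_flip:
  assumes "B \<in> SL2" shows "line (flip B) u = line B (1 - u)"
proof -
  consider "u = 0" | "u = 1" | "u \<noteq> 0" "u \<noteq> 1" by blast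
  then show ?thesis
  proof cases
    case 3
    then have "mob (0,-1,1,0) (Pt (Complex 0 (u / (1 - u)))) = Pt (Complex 0 ((1 - u) / u))"
      using mob_J[of "u / (1-u)"] by simp
    then show ?thesis using 3 assms by (simp add: line_def mob_flip)
  qed (use assms in \<open>simp_all add: line_def mob_flip mob_Pt mob_Inf zero_complex.code[symmetric] Complex_eq_0\<close>)
qed

context real_fuchsian_group begin

lemma axis_flip: "refl_axis g B \<Longrightarrow> refl_axis g (flip B)"
proof -
  assume ax: "refl_axis g B"
  have "nu \<circ> mob (0,-1,1,0) = mob (0,-1,1,0) \<circ> nu"
  proof -
    have "antimob (0,-1,-1,0) = antimob (0,1,1,0)" using mob_uminus[of 0 1 1 0] by (simp add: antimob_def)
    then show ?thesis by (simp add: nu_def antimob_mob)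
  qed
  then have "c \<circ> g \<circ> (mob B \<circ> mob (0,-1,1,0)) = mob B \<circ> mob (0,-1,1,0) \<circ> nu"
    using ax unfolding refl_axis_def by (metis o_assoc)
  then show ?thesis using ax flip_SL2 by (simp add: refl_axis_def mob_flip)
qed

lemma ldom_flip: "B \<in> SL2 \<Longrightarrow> u \<in> ldom (flip B) \<longleftrightarrow> 1 - u \<in> ldom B"
  by (auto simp: ldom_def line_flip)

lemma openin_ldom_flip:
  assumes "B \<in> SL2" "openin (top_of_set (ldom B)) {u \<in> ldom B. P (line B u)}"
  shows "openin (top_of_set (ldom (flip B))) {u \<in> ldom (flip B). P (line (flip B) u)}"
proof -
  have "openin (top_of_set (ldom (flip B))) (ldom (flip B) \<inter> (\<lambda>u. 1 - u) -` {u \<in> ldom B. P (line B u)})"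
    using assms by (intro continuous_openin_preimage[OF _ _ assms(2)] continuous_intros) (auto simp: ldom_flip)
  moreover have "ldom (flip B) \<inter> (\<lambda>u. 1 - u) -` {u \<in> ldom B. P (line B u)} = {u \<in> ldom (flip B). P (line (flip B) u)}"
    using assms by (auto simp: ldom_flip line_flip)
  ultimately show ?thesis by simp
qed

lemma line_continuous:
  assumes B: "B \<in> SL2" and U: "hstar_open G U"
  shows "openin (top_of_set (ldom B)) {u \<in> ldom B. line B u \<in> U}"
proof -
  \<comment> \<open>Proved for every \<open>B\<close>, so that the excluded parameter 0 can be
    recovered from the parameter 1 of \<open>flip B\<close>.\<close>
  have at: "\<exists>e>0. \<forall>u'\<in>ldom B. dist u' u < e \<longrightarrow> line B u' \<in> U" if B: "B \<in> SL2" and u: "u \<in> ldom B" "line B u \<in> U" "u \<noteq> 0" for B u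
    using u(1)
  proof (cases rule: ldom_cases)
    case 1
    then show ?thesis using u by simp
  next
    case 2
    have "line B 1 \<in> cusps G" using ldom_1[OF B] u 2 by simp
    then obtain r where r: "r > 0" "horoball (line B 1) r \<subseteq> U" using U u 2 unfolding hstar_open_def by blast
    then obtain R where R: "R > 0" "\<And>w. Im w > R \<Longrightarrow> mob B (Pt w) \<in> horoball (line B 1) r"
      using horoball_high[OF B r(1)] by (auto simp: line_def)
    \<comment> \<open>For \<open>u < 1\<close> the condition \<open>u / (1 - u) > R\<close> is the
      same as \<open>1 - u < 1/(1+R)\<close>.\<close>
    show ?thesis
    proof (intro exI[of _ "1/(1+R)"] conjI ballI impI)
      fix u' assume u': "u' \<in> ldom B" "dist u' u < 1/(1+R)"
      show "line B u' \<in> U"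
      proof (cases "u' = 1")
        case False
        then have "u' < 1" using u' by (auto simp: ldom_def)
        then have "1 - u' < 1/(1+R)" using u' 2 by (simp add: dist_real_def)
        then have "(1 - u') * (1 + R) < 1" using R by (simp add: field_simps)
        then have "u' / (1 - u') > R" using \<open>u' < 1\<close> by (simp add: field_simps)
        then show ?thesis using R(2)[of "Complex 0 (u' / (1 - u'))"] r False by (auto simp: line_def)
      qed (use u 2 in simp)
    qed (use R in simp)
  next
    case 3
    let ?f = "\<lambda>u. mobz B (Complex 0 (u / (1 - u)))"
    have "continuous_on {0<..<1} ?f"
      unfolding Complex_eq
      by (intro continuous_on_compose2[OF continuous_on_mobz[OF B]] continuous_intros) auto
    moreover have "open {z. Pt z \<in> U \<and> Im z > 0}" using U by (simp add: hstar_open_def)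
    ultimately have "open ({0<..<1} \<inter> ?f -` {z. Pt z \<in> U \<and> Im z > 0})"
      by (intro continuous_open_preimage) auto
    moreover have "u \<in> {0<..<1} \<inter> ?f -` {z. Pt z \<in> U \<and> Im z > 0}"
      using u 3 line_interior[OF B 3] Im_mobz_pos[OF B] by simp
    ultimately obtain e where e: "e > 0" "ball u e \<subseteq> {0<..<1} \<inter> ?f -` {z. Pt z \<in> U \<and> Im z > 0}"
      by (meson open_contains_ball)
    have "line B u' \<in> U" if "dist u' u < e" for u'
    proof -
      have "u' \<in> ball u e" using that by (simp add: dist_commute)
      then have "u' \<in> {0<..<1} \<inter> ?f -` {z. Pt z \<in> U \<and> Im z > 0}" using e(2) by blast
      then show ?thesis using line_interior[OF B, of u'] by auto
    qed
    then show ?thesis using e(1) by blast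
  qed
  have "\<exists>e>0. \<forall>u'\<in>ldom B. dist u' u < e \<longrightarrow> line B u' \<in> U" if u: "u \<in> ldom B" "line B u \<in> U" for u
  proof (cases "u = 0")
    case True
    have "\<exists>e>0. \<forall>u'\<in>ldom (flip B). dist u' 1 < e \<longrightarrow> line (flip B) u' \<in> U"
      using u True B by (intro at) (auto simp: flip_SL2 ldom_flip line_flip)
    then obtain e where e: "e > 0" "\<And>u'. u' \<in> ldom (flip B) \<Longrightarrow> dist u' 1 < e \<Longrightarrow> line (flip B) u' \<in> U" by blast
    have "line B u' \<in> U" if "u' \<in> ldom B" "dist u' u < e" for u'
      using e(2)[of "1 - u'"] that True B by (auto simp: ldom_flip line_flip dist_real_def)
    then show ?thesis using e(1) by blast
  qed (use at B u in auto)
  then show ?thesis by (auto simp: openin_euclidean_subtopology_iff)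
qed

end

section \<open>The topology of the real locus\<close>

lemma nu_nu: "nu \<circ> nu = id"
  by (rule ext, case_tac x) simp_all

context real_fuchsian_group begin

lemma c_factor: "\<exists>N\<in>SL2. c = nu \<circ> mob N"
proof -
  obtain M where M: "mdet M = -1" "c = antimob M" using c_antimob by auto
  let ?N = "mmul (-1,0,0,1) M"
  have "nu \<circ> c = mob ?N" using M by (simp add: nu_def antimob_mob)
  then have "nu \<circ> mob ?N = nu \<circ> (nu \<circ> c)" by (rule arg_cong[OF sym])
  then have "c = nu \<circ> mob ?N" unfolding o_assoc nu_nu by simp
  moreover have "?N \<in> SL2" using M(1) by (simp only: SL2_def mem_Collect_eq mdet_mmul) simp
  ultimately show ?thesis by blast
qed

text \<open>At a fixed point \<open>g\<close> moves \<open>w\<close> to \<open>c w\<close>, so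
  \<open>g\<close> sends a point of \<open>K\<close> into the compact set \<open>c K\<close> and
  \<open>finite_meeting\<close> applies.\<close>

lemma finite_axes:
  assumes K: "compact K" "\<And>z. z \<in> K \<Longrightarrow> Im z > 0"
  shows "finite {g \<in> G. \<exists>w\<in>K. c (g (Pt w)) = Pt w}"
proof -
  obtain N where N: "N \<in> SL2" "c = nu \<circ> mob N" using c_factor by auto
  let ?f = "\<lambda>w. - cnj (mobz N w)"
  have cf: "c (Pt w) = Pt (?f w)" if "Im w > 0" for w using N that by (simp add: mob_uhp)
  have "continuous_on K ?f"
    using K by (intro continuous_intros continuous_on_subset[OF continuous_on_mobz[OF N(1)]]) auto
  then have "compact (?f ` K)" using K compact_continuous_image by blast
  moreover have "Im z > 0" if "z \<in> ?f ` K" for z using that K Im_mobz_pos[OF N(1)] by auto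
  ultimately have "finite {g \<in> G. \<exists>w\<in>K. g (Pt w) \<in> Pt ` (?f ` K)}" using K by (intro finite_meeting; blast)
  moreover have "{g \<in> G. \<exists>w\<in>K. c (g (Pt w)) = Pt w} \<subseteq> {g \<in> G. \<exists>w\<in>K. g (Pt w) \<in> Pt ` (?f ` K)}"
  proof clarify
    fix g w assume g: "g \<in> G" "w \<in> K" "c (g (Pt w)) = Pt w"
    then have "g (Pt w) = Pt (?f w)" using cf[of w] K by (metis c_c_ap)
    then show "\<exists>w\<in>K. g (Pt w) \<in> Pt ` (?f ` K)" using g by blast
  qed
  ultimately show ?thesis using finite_subset by blast
qed

text \<open>Some \<open>g\<close> in \<open>G\<close> sends \<open>z\<close> to \<open>c z\<close>;
  the point is its admissibility. The imaginary part of the fixed point equation of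
  \<open>c \<circ> g\<close> at an interior point makes the trace zero, and a trace-zero matrix of
  determinant -1 squares to the identity.\<close>

lemma XR_lift:
  assumes z: "z \<in> uhp" and "orb z \<in> XR G c"
  shows "\<exists>g\<in>adm. c (g z) = z"
proof -
  have "c z \<in> c ` orb z" using orbit_self by blast
  then have "c z \<in> orb z" using assms by (simp add: XR_def)
  then obtain g where g: "g \<in> G" "g z = c z" by (auto simp: orbit_def)
  then have fx: "c (g z) = z" by simp
  obtain w where w: "z = Pt w" "Im w > 0" using z by (auto simp: uhp_def)
  obtain K where K: "mdet K = -1" "c \<circ> g = antimob K"
    using reflection_matrix0[OF g(1), of "(1,0,0,1)"] by (auto simp: mob_one)
  obtain p q r s where pq: "K = (p,q,r,s)" by (cases K) auto
  have 1: "antimob (p,q,r,s) (Pt w) = Pt w" using fx K(2) w pq by (metis comp_apply)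
  then have "(of_real p * cnj w + of_real q) = w * (of_real r * cnj w + of_real s)"
    by (auto simp: antimob_def mob_Pt field_simps split: if_splits)
  then have "Im (of_real p * cnj w + of_real q) = Im (w * (of_real r * cnj w + of_real s))" by metis
  then have "Im w * (p + s) = 0" by (simp add: algebra_simps)
  then have s: "s = - p" using w by simp
  have d: "p * p + q * r = 1" using K(1) pq s by simp
  then have "mmul K K = (1,0,0,1)" using pq s by (simp add: algebra_simps)
  then have "antimob K \<circ> antimob K = id" using K(1) by (simp add: antimob_mob mob_one)
  then have "g \<in> adm" using admissible_iff[OF g(1)] K(2) by simp
  then show ?thesis using fx by blast
qed

text \<open>Stability of \<open>G\<close> under the twist makes \<open>c\<close> map orbits to
  orbits, and on the fixed set \<open>c z = g z\<close> stays in the orbit of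
  \<open>z\<close>.\<close>

lemma Cset_XR:
  assumes g: "g \<in> G" and z: "z \<in> Cset G c g" shows "orb z \<in> XR G c"
proof -
  have zh: "z \<in> hstar G" "g z = c z" using z by (auto simp: Cset_def)
  have "c ` orb w \<subseteq> orb (c w)" for w
  proof
    fix x assume "x \<in> c ` orb w"
    then obtain h where h: "h \<in> G" "x = c (h w)" by (auto simp: orbit_def)
    then have "x = twist c h (c w)" by (simp add: twist_def)
    then show "x \<in> orb (c w)" using twist_G[OF h(1)] by (auto simp: orbit_def)
  qed
  from this[of z] image_mono[OF this[of "c z"], of c]
  have "c ` orb z = orb (c z)" by (auto simp: image_image)
  then have "c ` orb z = orb z" using zh(2) orbit_eq[OF g] by metis
  then show ?thesis using zh by (simp add: XR_def topspace_X)
qed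

text \<open>Extends the inverse of \<open>line B\<close> continuously from the axis to the whole
  half-plane: on the axis the modulus of \<open>v\<close> is its height.\<close>

definition ucoord :: "mat2 \<Rightarrow> complex \<Rightarrow> real" where
  "ucoord B w = (let v = mobz (madj B) w in cmod v / (1 + cmod v))"

lemma axis_point:
  assumes ax: "refl_axis g B" and w: "Im w > 0" "c (g (Pt w)) = Pt w"
  shows "Re (mobz (madj B) w) = 0" "line B (ucoord B w) = Pt w" "0 < ucoord B w" "ucoord B w < 1"
proof -
  have B: "B \<in> SL2" using axisD ax by blast
  define v where "v = mobz (madj B) w"
  have v: "Im v > 0" using B w Im_mobz_pos SL2_madj by (simp add: v_def)
  have Pv: "Pt w = mob B (Pt v)" using B w by (metis mob_uhp SL2_madj mob_madj_eq(1) v_def)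
  then have "mob B (nu (Pt v)) = mob B (Pt v)" using axisD(2)[OF ax] w by metis
  then have "Pt (- cnj v) = Pt v" using mob_eq_iff[OF B] by simp
  then have "Re (- cnj v) = Re v" by simp
  then show re: "Re (mobz (madj B) w) = 0" by (simp add: v_def)
  have v2: "v = Complex 0 (cmod v)" using re v by (simp add: v_def[symmetric] complex_eq_iff cmod_def)
  have v0: "cmod v > 0" using v by auto
  have gen: "0 < m / (1 + m)" "m / (1 + m) < 1" "m / (1 + m) / (1 - m / (1 + m)) = m" if "m > 0" for m :: real
    using that by (simp_all add: field_simps)
  show "0 < ucoord B w" "ucoord B w < 1" using gen[OF v0] by (simp_all add: ucoord_def v_def[symmetric])
  have "cmod v / (1 + cmod v) / (1 - cmod v / (1 + cmod v)) = cmod v" using gen[OF v0] by simp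
  then show "line B (ucoord B w) = Pt w"
    using \<open>ucoord B w < 1\<close> Pv v2 by (simp add: line_def ucoord_def v_def[symmetric])
qed

lemma ucoord_cont: "B \<in> SL2 \<Longrightarrow> continuous_on {w. Im w > 0} (ucoord B)"
  unfolding ucoord_def Let_def
  by (intro continuous_intros continuous_on_mobz SL2_madj) (auto simp: add_nonneg_eq_0_iff)

text \<open>Openness along one parametrised geodesic, its cusp ends included; \<open>P\<close> will
  say that the orbit of a point lies in, or avoids, a given set.\<close>

definition line_open :: "(hpt \<Rightarrow> bool) \<Rightarrow> mat2 \<Rightarrow> bool" where
  "line_open P B \<longleftrightarrow> openin (top_of_set (ldom B)) {u \<in> ldom B. P (line B u)}"

text \<open>The neighbourhood joins the complement of the axis to the points whose extended
  coordinate \<open>ucoord\<close> lies in the open set of good parameters. It controls a single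
  axis; \<open>open_avoiding\<close> intersects finitely many.\<close>

lemma local_nbhd:
  assumes ax: "refl_axis g B" and op: "line_open P B" and w0: "Im w0 > 0" and P0: "c (g (Pt w0)) = Pt w0 \<Longrightarrow> P (Pt w0)"
  shows "\<exists>Q. open Q \<and> w0 \<in> Q \<and> (\<forall>w\<in>Q. Im w > 0 \<and> (c (g (Pt w)) = Pt w \<longrightarrow> P (Pt w)))"
proof -
  have B: "B \<in> SL2" using axisD ax by blast
  obtain T where T: "open T" "{u \<in> ldom B. P (line B u)} = T \<inter> ldom B"
    using op unfolding line_open_def openin_open by auto
  let ?H = "{w. Im w > 0}"
  define Q where "Q = (?H \<inter> mobz (madj B) -` {v. Re v \<noteq> 0}) \<union> (?H \<inter> ucoord B -` T)"
  have oH: "open ?H" by (simp add: open_halfspace_Im_gt)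
  have oR: "open {v. Re v \<noteq> 0}"
    by (intro open_Collect_neq continuous_intros)
  have "open Q" unfolding Q_def
    by (intro open_Un continuous_open_preimage continuous_on_mobz SL2_madj B ucoord_cont oH oR T)
  have on_axis: "P (Pt w) \<longleftrightarrow> ucoord B w \<in> T" if w: "Im w > 0" "c (g (Pt w)) = Pt w" for w
  proof -
    note p = axis_point[OF ax w]
    have "ucoord B w \<in> ldom B" using ldom_open[OF B] p by blast
    then have "P (line B (ucoord B w)) \<longleftrightarrow> ucoord B w \<in> T" using T(2) by blast
    then show ?thesis using p(2) by simp
  qed
  have axisI: "c (g (Pt w)) = Pt w" if "Im w > 0" and re: "Re (mobz (madj B) w) = 0" for w
  proof -
    have "Pt w = mob B (Pt (mobz (madj B) w))" using B that by (metis mob_uhp SL2_madj mob_madj_eq(1))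
    moreover have "nu (Pt (mobz (madj B) w)) = Pt (mobz (madj B) w)" using re by (simp add: complex_eq_iff)
    ultimately show ?thesis using axisD(2)[OF ax] by metis
  qed
  have "w0 \<in> Q"
  proof (cases "Re (mobz (madj B) w0) = 0")
    case True
    then have "c (g (Pt w0)) = Pt w0" using axisI w0 by blast
    then have "ucoord B w0 \<in> T" using on_axis w0 P0 by blast
    then show ?thesis using w0 by (simp add: Q_def)
  qed (use w0 in \<open>simp add: Q_def\<close>)
  moreover have "Im w > 0 \<and> (c (g (Pt w)) = Pt w \<longrightarrow> P (Pt w))" if w: "w \<in> Q" for w
  proof -
    have "Im w > 0" using w unfolding Q_def by blast
    moreover have "P (Pt w)" if *: "c (g (Pt w)) = Pt w"
    proof -
      have "Re (mobz (madj B) w) = 0" using axis_point(1)[OF ax \<open>Im w > 0\<close> *] .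
      then have "ucoord B w \<in> T" using w unfolding Q_def by blast
      then show ?thesis using on_axis[OF \<open>Im w > 0\<close> *] by blast
    qed
    ultimately show ?thesis by blast
  qed
  ultimately show ?thesis using \<open>open Q\<close> by blast
qed

text \<open>Converts openness at an end of the parameter interval into a height bound in the
  coordinate \<open>A\<close>. After a possible flip the end is at 1; then \<open>madj A\<close>
  times \<open>B'\<close> fixes infinity and multiplies heights by \<open>p\<^sup>2\<close>.\<close>

lemma cusp_end:
  assumes ax: "refl_axis g B" and op: "line_open P B" and A: "A \<in> SL2" and s: "mob A Inf \<in> cusps G" "c (g (mob A Inf)) = mob A Inf"
    and P: "P (mob A Inf)"
  shows "\<exists>R. \<forall>v. Im v > R \<longrightarrow> Im v > 0 \<longrightarrow> c (g (mob A (Pt v))) = mob A (Pt v) \<longrightarrow> P (mob A (Pt v))"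
proof -
  obtain B' where ax': "refl_axis g B'" and op': "line_open P B'" and B's: "line B' 1 = mob A Inf"
  proof -
    have B: "B \<in> SL2" using axisD ax by blast
    have "mob A Inf \<in> Cset G c g" using s by (simp add: Cset_iff hstar_def)
    then obtain u where u: "u \<in> ldom B" "line B u = mob A Inf" using Cset_line[OF ax] by auto
    have "mob A Inf \<notin> uhp" using A by (simp add: mob_in_uhp)
    then have "\<not> (0 < u \<and> u < 1)" using line_uhp[OF B, of u] u(2) by auto
    then consider "u = 1" | "u = 0" using u(1) by (force simp: ldom_def)
    then show ?thesis
    proof cases
      case 1
      then show ?thesis using that[OF ax op] u by simp
    next
      case 2
      have "line_open P (flip B)" using openin_ldom_flip[OF B] op by (simp add: line_open_def)
      moreover have "line (flip B) 1 = mob A Inf" using 2 u B by (simp add: line_flip)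
      ultimately show ?thesis using that[OF axis_flip[OF ax]] by simp
    qed
  qed
  have B: "B' \<in> SL2" using axisD ax' by blast
  have one: "1 \<in> {u \<in> ldom B'. P (line B' u)}" using ldom_1[OF B] s B's P by simp
  then obtain e where e: "e > 0" "\<And>u. u \<in> ldom B' \<Longrightarrow> dist u 1 < e \<Longrightarrow> P (line B' u)"
    using op' unfolding line_open_def openin_euclidean_subtopology_iff by blast
  obtain p q r t where K: "mmul (madj A) B' = (p,q,r,t)" by (metis prod_cases4)
  have KS: "(p,q,r,t) \<in> SL2" using K A B by (metis SL2_mmul SL2_madj)
  have mK: "mob A (mob (p,q,r,t) w) = mob B' w" for w
    using A B by (simp add: K[symmetric] mob_mmul SL2_det SL2_madj)
  have "mob A (mob (p,q,r,t) Inf) = mob A Inf" using mK B's by (simp add: line_def)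
  then have "mob (p,q,r,t) Inf = Inf" using mob_eq_iff A by blast
  then have r: "r = 0" by (auto simp: mob_Inf split: if_splits)
  then have pt: "p * t = 1" using KS by simp
  then have p0: "p \<noteq> 0" by auto
  \<comment> \<open>On the axis \<open>Im v = p\<^sup>2 * y\<close> with
    \<open>u = y / (1 + y)\<close>, so beyond the height \<open>p\<^sup>2 / e\<close> the parameter
    is within \<open>e\<close> of 1.\<close>
  show ?thesis
  proof (intro exI[of _ "p\<^sup>2 / e"] allI impI)
    fix v assume v: "Im v > p\<^sup>2 / e" "Im v > 0" "c (g (mob A (Pt v))) = mob A (Pt v)"
    have Av: "mob A (Pt v) \<in> uhp" using A v by (simp add: mob_in_uhp)
    then have "mob A (Pt v) \<in> Cset G c g" using v by (simp add: Cset_iff hstar_def)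
    then obtain u where u: "u \<in> ldom B'" "line B' u = mob A (Pt v)" using Cset_line[OF ax'] by auto
    have u01: "0 < u" "u < 1" using u(1)
      by (cases rule: ldom_cases; use u(2) Av line_bdry[OF B] uhp_bdry in metis)+
    define y where "y = u / (1 - u)"
    have y: "y > 0" using u01 by (simp add: y_def)
    have "mob A (Pt v) = mob A (mob (p,q,r,t) (Pt (Complex 0 y)))"
      using u(2) u01 unfolding mK by (simp add: line_def y_def)
    then have "Pt v = mob (p,q,r,t) (Pt (Complex 0 y))" using mob_eq_iff A by blast
    then have "v = mobz (p,q,r,t) (Complex 0 y)" using mob_uhp[OF KS, of "Complex 0 y"] y by simp
    then have "Im v = Im (mobz (p,q,r,t) (Complex 0 y))" by simp
    then have "Im v = y / t\<^sup>2" using KS r unfolding Im_mobz by (simp add: norm_mult)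
    also have "t = 1 / p" using pt p0 by (simp add: field_simps)
    then have "y / t\<^sup>2 = p\<^sup>2 * y" using p0 by (simp add: power_divide)
    finally have "p\<^sup>2 * y > p\<^sup>2 / e" using v by simp
    then have "p\<^sup>2 * (1 / e) < p\<^sup>2 * y" by simp
    then have "y > 1 / e" using p0 by (metis mult_less_cancel_left_pos zero_less_power2)
    then have "u * e > 1 - u" using u01 e by (simp add: y_def field_simps)
    moreover have "u * e \<le> e" using u01 e by simp
    ultimately have "dist u 1 < e" using u01 by (simp add: dist_real_def)
    then show "P (mob A (Pt v))" using e(2)[OF u(1)] u(2) by simp
  qed
qed

section \<open>Local finiteness of the geodesics and the weak topology\<close>

lemma finite_uniform_bound:
  fixes Q :: "'a \<Rightarrow> real \<Rightarrow> bool"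
  assumes "finite S" "\<And>x. x \<in> S \<Longrightarrow> \<exists>R. \<forall>t>R. Q x t"
  shows "\<exists>R. \<forall>x\<in>S. \<forall>t>R. Q x t"
proof -
  obtain f where f: "\<And>x t. x \<in> S \<Longrightarrow> t > f x \<Longrightarrow> Q x t" using assms(2) by metis
  have "\<forall>x\<in>S. f x \<le> Max (insert 0 (f ` S))" using assms(1) by auto
  then show ?thesis using f by (intro exI[of _ "Max (insert 0 (f ` S))"]) force
qed

text \<open>By \<open>XR_lift\<close> every half-plane point with orbit in \<open>F\<close> lies on
  some axis, and only finitely many axes meet a closed disc about \<open>w0\<close>; the
  neighbourhoods they give are intersected.\<close>

lemma open_avoiding:
  assumes F: "F \<subseteq> XR G c" and H: "\<And>g. g \<in> adm \<Longrightarrow> \<exists>B. refl_axis g B \<and> line_open (\<lambda>z. orb z \<notin> F) B"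
  shows "open {w. Im w > 0 \<and> orb (Pt w) \<notin> F}"
proof (subst open_subopen, rule ballI)
  fix w0 assume w0: "w0 \<in> {w. Im w > 0 \<and> orb (Pt w) \<notin> F}"
  define r where "r = Im w0 / 2"
  have r: "r > 0" using w0 by (simp add: r_def)
  have K: "Im z > 0" if "z \<in> cball w0 r" for z
  proof -
    have "\<bar>Im (w0 - z)\<bar> \<le> r" using that abs_Im_le_cmod[of "w0 - z"] by (simp add: dist_norm)
    moreover have "Im w0 > 0" using w0 by simp
    ultimately show ?thesis unfolding r_def minus_complex.sel by linarith
  qed
  let ?S = "{g \<in> adm. \<exists>w\<in>cball w0 r. c (g (Pt w)) = Pt w}"
  have "finite {g \<in> G. \<exists>w\<in>cball w0 r. c (g (Pt w)) = Pt w}" using finite_axes[OF compact_cball K] .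
  then have fin: "finite ?S" by (rule finite_subset[rotated]) (auto simp: admissible_G)
  define nb where "nb g Q \<longleftrightarrow> open Q \<and> w0 \<in> Q \<and> (\<forall>w\<in>Q. Im w > 0 \<and> (c (g (Pt w)) = Pt w \<longrightarrow> orb (Pt w) \<notin> F))" for g Q
  have "\<exists>Q. nb g Q" if "g \<in> ?S" for g
  proof -
    have "g \<in> adm" using that by simp
    then obtain B where "refl_axis g B" "line_open (\<lambda>z. orb z \<notin> F) B" using H by blast
    then show ?thesis unfolding nb_def using local_nbhd[of g B "\<lambda>z. orb z \<notin> F" w0] w0 by auto
  qed
  then have "\<forall>g\<in>?S. \<exists>Q. nb g Q" by blast
  then obtain Q where "\<forall>g\<in>?S. nb g (Q g)" by (rule bchoice[THEN exE])
  then have Q: "open (Q g)" "w0 \<in> Q g" "\<And>w. w \<in> Q g \<Longrightarrow> c (g (Pt w)) = Pt w \<Longrightarrow> orb (Pt w) \<notin> F"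
    if "g \<in> ?S" for g
    using that unfolding nb_def by blast+
  let ?T = "ball w0 r \<inter> (\<Inter>g\<in>?S. Q g)"
  have "open ?T" using fin Q by (intro open_Int open_INT open_ball) auto
  moreover have "w0 \<in> ?T" using Q r by auto
  moreover have "?T \<subseteq> {w. Im w > 0 \<and> orb (Pt w) \<notin> F}"
  proof
    fix w assume w: "w \<in> ?T"
    have Iw: "Im w > 0" using w K[of w] by auto
    moreover have "orb (Pt w) \<notin> F"
    proof
      assume "orb (Pt w) \<in> F"
      then obtain g where g: "g \<in> adm" "c (g (Pt w)) = Pt w" using XR_lift[of "Pt w"] F Iw by auto
      moreover have "w \<in> cball w0 r" using w by auto
      ultimately have "g \<in> ?S" by blast
      then show False using Q(3)[of g w] w g \<open>orb (Pt w) \<in> F\<close> by blast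
    qed
    ultimately show "w \<in> {w. Im w > 0 \<and> orb (Pt w) \<notin> F}" by simp
  qed
  ultimately show "\<exists>T. open T \<and> w0 \<in> T \<and> T \<subseteq> {w. Im w > 0 \<and> orb (Pt w) \<notin> F}" by blast
qed

text \<open>Above height |\<open>\<tau>\<close>| all axes are vertical by
  \<open>high_axis_vertical\<close>. Up to translation they cross a compact segment at height 1, so
  finitely many remain, and the largest of their bounds from \<open>cusp_end\<close> gives the
  horoball.\<close>

lemma horoball_avoiding:
  assumes F: "F \<subseteq> XR G c" and H: "\<And>g. g \<in> adm \<Longrightarrow> \<exists>B. refl_axis g B \<and> line_open (\<lambda>z. orb z \<notin> F) B"
    and s: "s \<in> cusps G" "orb s \<notin> F"
  shows "\<exists>r>0. \<forall>z\<in>horoball s r. orb z \<notin> F"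
proof -
  obtain A where A: "A \<in> SL2" "mob A Inf = s" using ex_mob_Inf s unfolding cusps_def by blast
  obtain \<tau> where \<tau>: "\<tau> \<noteq> 0" "(1,\<tau>,0,1) \<in> mats A" using cusp_translation A s by metis
  obtain t where t: "t \<in> G" "t \<circ> mob A = mob A \<circ> mob (1,\<tau>,0,1)" using \<tau> by (auto simp: mats_def)
  \<comment> \<open>A cross-section of the vertical axes up to translation; any positive height
    would do.\<close>
  let ?I = "(\<lambda>x. Complex x 1) ` {0..\<bar>\<tau>\<bar>}"
  let ?K = "mobz A ` ?I"
  have "compact ?K"
  proof (intro compact_continuous_image)
    show "continuous_on ?I (mobz A)" by (rule continuous_on_subset[OF continuous_on_mobz[OF A(1)]]) auto
    show "continuous_on {0..\<bar>\<tau>\<bar>} (\<lambda>x. Complex x 1)" unfolding Complex_eq by (intro continuous_intros)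
  qed auto
  moreover have "Im z > 0" if "z \<in> ?K" for z using that Im_mobz_pos[OF A(1)] by auto
  ultimately have fin0: "finite {g \<in> G. \<exists>w\<in>?K. c (g (Pt w)) = Pt w}" by (rule finite_axes)
  let ?S = "{g \<in> adm. (\<exists>w\<in>?K. c (g (Pt w)) = Pt w) \<and> c (g s) = s}"
  have fin: "finite ?S" by (rule finite_subset[OF _ fin0]) (auto simp: admissible_G)
  define Q where "Q g y \<longleftrightarrow> (\<forall>v. Im v = y \<longrightarrow> Im v > 0 \<longrightarrow> c (g (mob A (Pt v))) = mob A (Pt v) \<longrightarrow> orb (mob A (Pt v)) \<notin> F)" for g y
  have "\<exists>R. \<forall>y>R. Q g y" if g: "g \<in> ?S" for g
  proof -
    obtain B where B: "refl_axis g B" "line_open (\<lambda>z. orb z \<notin> F) B" using H g by blast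
    show ?thesis unfolding Q_def using cusp_end[OF B A(1)] A(2) s g by auto
  qed
  from finite_uniform_bound[OF fin this] obtain R where R0: "\<forall>g\<in>?S. \<forall>y>R. Q g y" ..
  have R: "orb (mob A (Pt v)) \<notin> F"
    if "g \<in> ?S" "Im v > R" "Im v > 0" "c (g (mob A (Pt v))) = mob A (Pt v)" for g v
    using bspec[OF R0 that(1)] that(2-4) unfolding Q_def by simp
  obtain r where r: "r > 0" "\<And>z. z \<in> horoball s r \<Longrightarrow> \<exists>w. z = mob A (Pt w) \<and> Im w > 0 \<and> Im w > max R \<bar>\<tau>\<bar>"
    using horoball_deep[OF A(1), of "max R \<bar>\<tau>\<bar>"] A(2) by auto
  have shift: "orb (mob A (Pt (v + of_real (of_int k * \<tau>)))) = orb (mob A (Pt v))" for k :: int and v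
  proof -
    have 1: "orb (mob A (Pt (v + of_real \<tau>))) = orb (mob A (Pt v))" for v
    proof -
      have "t (mob A (Pt v)) = mob A (Pt (v + of_real \<tau>))"
        using fun_cong[OF t(2), of "Pt v"] by (simp add: mob_Pt)
      then show ?thesis using orbit_eq[OF t(1)] by metis
    qed
    have n: "orb (mob A (Pt (v + of_real (of_nat n * \<tau>)))) = orb (mob A (Pt v))" for n :: nat and v
    proof (induction n)
      case (Suc n)
      have "v + of_real (of_nat (Suc n) * \<tau>) = v + of_real (of_nat n * \<tau>) + of_real \<tau>" by (simp add: algebra_simps)
      then show ?case using 1 Suc by metis
    qed simp
    show ?thesis
    proof (cases k rule: int_cases2)
      case (nonneg m)
      then show ?thesis using n by simp
    next
      case (nonpos m)
      then show ?thesis using n[of "v + of_real (of_int k * \<tau>)" m] by (simp add: algebra_simps)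
    qed
  qed
  have "orb z \<notin> F" if zr: "z \<in> horoball s r" for z
  proof
    assume zF: "orb z \<in> F"
    obtain w where w: "z = mob A (Pt w)" "Im w > 0" "Im w > R" "Im w > \<bar>\<tau>\<bar>" using r(2)[OF zr] by auto
    \<comment> \<open>Translation into the strip over \<open>?I\<close>; the sign of the shift
      depends on the sign of \<open>\<tau>\<close>.\<close>
    obtain k :: int where k: "0 \<le> Re w + of_int k * \<tau>" "Re w + of_int k * \<tau> \<le> \<bar>\<tau>\<bar>"
    proof -
      define m where "m = \<lfloor>Re w / \<bar>\<tau>\<bar>\<rfloor>"
      have "of_int m * \<bar>\<tau>\<bar> \<le> Re w" "Re w < (of_int m + 1) * \<bar>\<tau>\<bar>"
        using \<tau> floor_divide_lower[of "\<bar>\<tau>\<bar>" "Re w"] floor_divide_upper[of "\<bar>\<tau>\<bar>" "Re w"] by (simp_all add: m_def)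
      then show ?thesis using that[of "- m"] that[of m] \<tau>(1)
        by (cases "\<tau>" "0::real" rule: linorder_cases) (auto simp: algebra_simps)
    qed
    define v where "v = w + of_real (of_int k * \<tau>)"
    have v: "Im v > 0" "Im v > R" "Im v > \<bar>\<tau>\<bar>" "Re v \<in> {0..\<bar>\<tau>\<bar>}" using w k by (auto simp: v_def)
    have vF: "orb (mob A (Pt v)) \<in> F" using zF w shift by (simp add: v_def)
    moreover have "mob A (Pt v) \<in> uhp" using v A by (simp add: mob_in_uhp)
    ultimately obtain g where g: "g \<in> adm" "c (g (mob A (Pt v))) = mob A (Pt v)"
      using XR_lift F by blast
    note h = high_axis_vertical[OF A(1) \<tau>(2,1) g(1) v(3) g(2)]
    have "mobz A (Complex (Re v) 1) \<in> ?K" using v by blast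
    moreover have "c (g (Pt (mobz A (Complex (Re v) 1)))) = Pt (mobz A (Complex (Re v) 1))"
      using h(1)[of 1] mob_uhp[OF A(1), of "Complex (Re v) 1"] by simp
    moreover have "c (g s) = s" using h(2) A(2) by simp
    ultimately have "g \<in> ?S" using g by blast
    then show False using R[of g v] v(1,2) g(2) vF by blast
  qed
  then show ?thesis using r(1) by blast
qed

text \<open>The real locus carries the weak topology of the images of the geodesics fixed by the reflections
  \<open>c \<circ> g\<close>; this is what makes a continuous bijection from the graph a homeomorphism.\<close>
lemma closed_criterion:
  assumes F: "F \<subseteq> XR G c" and H: "\<And>g. g \<in> adm \<Longrightarrow> \<exists>B. refl_axis g B \<and> line_open (\<lambda>z. orb z \<notin> F) B"
  shows "closedin (X_top G) F"
proof -
  have sub: "F \<subseteq> topspace (X_top G)" using F by (auto simp: XR_def)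
  have eq: "{z \<in> hstar G. orb z \<in> topspace (X_top G) - F} = {z \<in> hstar G. orb z \<notin> F}"
    by (auto simp: topspace_X)
  have "{z. Pt z \<in> {z \<in> hstar G. orb z \<notin> F} \<and> 0 < Im z} = {w. Im w > 0 \<and> orb (Pt w) \<notin> F}"
    by (auto simp: hstar_def)
  moreover have "\<exists>r>0. horoball s r \<subseteq> {z \<in> hstar G. orb z \<notin> F}" if s: "s \<in> cusps G" "orb s \<notin> F" for s
  proof -
    obtain r where "r > 0" "\<forall>z\<in>horoball s r. orb z \<notin> F" using horoball_avoiding[OF F H s] by blast
    moreover have "horoball s r \<subseteq> uhp" using s horoball_uhp \<open>r > 0\<close> by (auto simp: cusps_def)
    ultimately show ?thesis by (intro exI[of _ r]) (auto simp: hstar_def)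
  qed
  ultimately have "hstar_open G {z \<in> hstar G. orb z \<notin> F}"
    using open_avoiding[OF F H] by (auto simp: hstar_open_def)
  then have "openin (X_top G) (topspace (X_top G) - F)"
    unfolding openin_X eq by (auto simp: topspace_X)
  then show ?thesis using sub by (simp add: closedin_def)
qed

end

section \<open>Half-turns and twisted conjugacy\<close>

lemma even_card_involution:
  assumes "finite S" "\<And>x. x \<in> S \<Longrightarrow> f x \<in> S" "\<And>x. x \<in> S \<Longrightarrow> f (f x) = x" "\<And>x. x \<in> S \<Longrightarrow> f x \<noteq> x"
  shows "even (card S)"
  using assms
proof (induction "card S" arbitrary: S rule: less_induct)
  case less
  show ?case
  proof (cases "S = {}")
    case False
    then obtain x where x: "x \<in> S" by blast
    let ?T = "S - {x, f x}"
    have fx: "f x \<in> S" "f x \<noteq> x" "f (f x) = x" using less.prems x by auto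
    have c: "card S = card ?T + 2"
    proof -
      have "card {x, f x} = 2" using fx by auto
      moreover have "card ?T = card S - card {x, f x}" using x fx by (intro card_Diff_subset) auto
      moreover have "card {x, f x} \<le> card S" using x fx less.prems(1) by (intro card_mono) auto
      ultimately show ?thesis by simp
    qed
    have "even (card ?T)"
    proof (rule less.hyps)
      show "card ?T < card S" using c by simp
      fix y assume y: "y \<in> ?T"
      have "f y \<noteq> x" "f y \<noteq> f x" using y less.prems(3) x fx by (metis DiffE insertCI)+
      then show "f y \<in> ?T" using y less.prems(2) by blast
    qed (use less.prems in auto)
    then show ?thesis using c by simp
  qed simp
qed

context real_fuchsian_group begin

text \<open>Stands for even order of the stabiliser (\<open>even_stab_iff\<close>), but is easier to
  transport along orbits and to read off from matrices.\<close>

definition half_turn :: "hpt \<Rightarrow> bool" where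
  "half_turn z \<longleftrightarrow> (\<exists>\<iota>\<in>G. \<iota> \<noteq> id \<and> \<iota> \<circ> \<iota> = id \<and> \<iota> z = z)"

lemma half_turn_G:
  assumes d: "d \<in> G" shows "half_turn (d z) \<longleftrightarrow> half_turn z"
proof -
  have *: "half_turn (d z)" if d: "d \<in> G" and h: "half_turn z" for d z
  proof -
    obtain i where i: "i \<in> G" "i \<noteq> id" "i \<circ> i = id" "i z = z" using h by (auto simp: half_turn_def)
    have ii: "i (i x) = x" for x using i(3) by (metis comp_apply id_apply)
    let ?j = "d \<circ> i \<circ> inv d"
    have "?j \<in> G" using d i G_comp G_inv by simp
    moreover have "?j \<noteq> id"
    proof
      assume j: "?j = id"
      have "i x = x" for x
      proof -
        have "?j (d x) = d x" unfolding j by simp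
        then show ?thesis using d G_eq_iff by simp
      qed
      then show False using i(2) by auto
    qed
    moreover have "?j \<circ> ?j = id" using d by (simp add: fun_eq_iff ii)
    moreover have "?j (d z) = d z" using d i by simp
    ultimately show ?thesis unfolding half_turn_def by blast
  qed
  show ?thesis using *[OF d, of z] *[OF G_inv[OF d], of "d z"] d by auto
qed

lemma half_turn_orbit: "orb z = orb w \<Longrightarrow> half_turn z \<longleftrightarrow> half_turn w"
  using half_turn_G orbit_eq_iff by metis

lemma finite_stab: "z \<in> uhp \<Longrightarrow> finite (stab G z)"
proof -
  assume "z \<in> uhp"
  then obtain w where w: "z = Pt w" "Im w > 0" by (auto simp: uhp_def)
  have "finite {g \<in> G. \<exists>x\<in>{w}. g (Pt x) \<in> Pt ` {w}}" using w by (intro finite_meeting) auto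
  then show ?thesis using w by (simp add: stab_def)
qed

lemma stab_G: "g \<in> stab G z \<Longrightarrow> g \<in> G" "g \<in> stab G z \<Longrightarrow> g z = z"
  by (auto simp: stab_def)

lemma stab_comp: "g \<in> stab G z \<Longrightarrow> h \<in> stab G z \<Longrightarrow> g \<circ> h \<in> stab G z"
  using G_comp by (simp add: stab_def)

lemma stab_inv: "g \<in> stab G z \<Longrightarrow> inv g \<in> stab G z"
  using G_inv G_inv_ap(1) unfolding stab_def by (metis (mono_tags, lifting) mem_Collect_eq)

text \<open>Multiplication by the involution pairs off the stabiliser. Conversely, without an
  involution, inversion would pair off the elements other than \<open>id\<close> and leave an odd
  total.\<close>

lemma even_stab_iff: 
  assumes z: "z \<in> uhp" shows "even (card (stab G z)) \<longleftrightarrow> half_turn z"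
proof
  assume "half_turn z"
  then obtain i where i: "i \<in> G" "i \<noteq> id" "i \<circ> i = id" "i z = z" by (auto simp: half_turn_def)
  have "i \<in> stab G z" using i by (simp add: stab_def)
  show "even (card (stab G z))"
  proof (rule even_card_involution[where f = "\<lambda>g. g \<circ> i"])
    show "finite (stab G z)" using finite_stab z .
    fix g assume g: "g \<in> stab G z"
    show "g \<circ> i \<in> stab G z" using g \<open>i \<in> stab G z\<close> by (rule stab_comp)
    show "g \<circ> i \<circ> i = g" using i(3) by (simp add: o_assoc [symmetric])
    show "g \<circ> i \<noteq> g"
    proof
      assume *: "g \<circ> i = g"
      have "i x = x" for x using fun_cong[OF *, of x] g stab_G G_eq_iff by simp
      then show False using i(2) by auto
    qed
  qed
next
  assume ev: "even (card (stab G z))"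
  have id: "id \<in> stab G z" using G_id by (simp add: stab_def)
  have "\<exists>i\<in>stab G z - {id}. inv i = i"
  proof (rule ccontr)
    assume no: "\<not> ?thesis"
    have "even (card (stab G z - {id}))"
    proof (rule even_card_involution[where f = inv])
      show "finite (stab G z - {id})" using finite_stab z by simp
      fix g assume g: "g \<in> stab G z - {id}"
      then have bij: "bij g" using stab_G G_bij by blast
      then show "inv (inv g) = g" by (rule inv_inv_eq)
      then show "inv g \<in> stab G z - {id}" using g stab_inv by (metis Diff_iff inv_id singleton_iff)
      show "inv g \<noteq> g" using no g by blast
    qed
    moreover have "card (stab G z) = Suc (card (stab G z - {id}))"
      using finite_stab[OF z] id by (rule card.remove)
    ultimately show False using ev by simp
  qed
  then obtain i where i: "i \<in> stab G z" "i \<noteq> id" "inv i = i" by blast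
  then have "i \<circ> i = id" using G_inv_comp(1)[of i] stab_G by metis
  then show "half_turn z" using i by (auto simp: half_turn_def stab_def)
qed

lemma uhp_orbit_not_cusp: "z \<in> uhp \<Longrightarrow> s \<in> cusps G \<Longrightarrow> orb z \<noteq> orb s"
proof
  assume z: "z \<in> uhp" "s \<in> cusps G" "orb z = orb s"
  then obtain g where "g \<in> G" "g z = s" using orbit_eq_iff by blast
  then show False using z G_uhp uhp_bdry by (auto simp: cusps_def)
qed

lemma special_iff:
  assumes z: "z \<in> uhp" and XR: "orb z \<in> XR G c"
  shows "orb z \<in> special \<longleftrightarrow> half_turn z"
proof
  assume "orb z \<in> special"
  then obtain w where "w \<in> uhp" "orb z = orb w" "even (card (stab G w))"
    using uhp_orbit_not_cusp[OF z] by (auto simp: special_pts_def)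
  then show "half_turn z" using even_stab_iff half_turn_orbit by blast
next
  assume "half_turn z"
  then have "even (card (stab G z))" using even_stab_iff z by blast
  then show "orb z \<in> special" using finite_stab z XR by (auto simp: special_pts_def)
qed

lemma mob_diag: "l > 0 \<Longrightarrow> mob (l,0,0,1/l) (Pt w) = Pt (of_real (l\<^sup>2) * w)" "l > 0 \<Longrightarrow> mob (l,0,0,1/l) Inf = Inf"
  by (simp_all add: mob_Pt mob_Inf power2_eq_square)

lemma axis_scale:
  assumes ax: "refl_axis g B" and l: "l > 0"
  shows "refl_axis g (mmul B (l,0,0,1/l))"
proof -
  have B: "B \<in> SL2" using ax axisD by blast
  have S: "(l,0,0,1/l) \<in> SL2" using l by simp
  have "nu \<circ> mob (l,0,0,1/l) = mob (l,0,0,1/l) \<circ> nu"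
    using l by (intro ext, case_tac x) (simp_all add: mob_diag)
  then have "c \<circ> g \<circ> (mob B \<circ> mob (l,0,0,1/l)) = mob B \<circ> mob (l,0,0,1/l) \<circ> nu"
    using ax unfolding refl_axis_def by (metis o_assoc)
  then show ?thesis using B S l by (simp add: refl_axis_def mob_mmul SL2_det SL2_mmul del: SL2_iff mmul_simp)
qed

lemma axis_point_at_i:
  assumes ax: "refl_axis g B" and z: "z \<in> uhp" "c (g z) = z"
  obtains B' where "refl_axis g B'" "mob B' (Pt \<i>) = z"
proof -
  have B: "B \<in> SL2" using ax axisD by blast
  have "z \<in> Cset G c g" using z by (simp add: Cset_iff hstar_def)
  then obtain u where u: "u \<in> ldom B" "z = line B u" using Cset_line[OF ax] by auto
  have u01: "0 < u" "u < 1" using u(1)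
    by (cases rule: ldom_cases; use u(2) z(1) line_bdry[OF B] uhp_bdry in metis)+
  define y where "y = u / (1 - u)"
  have y: "y > 0" using u01 by (simp add: y_def)
  \<comment> \<open>The square root appears because the diagonal matrix with entries
    \<open>l\<close> and \<open>1/l\<close> acts by \<open>l\<^sup>2\<close>.\<close>
  let ?D = "(sqrt y, 0, 0, 1 / sqrt y)"
  have S: "?D \<in> SL2" using y by simp
  have "mob ?D (Pt \<i>) = Pt (Complex 0 y)" using y by (subst mob_diag) (simp_all add: complex_eq_iff)
  then have "mob (mmul B ?D) (Pt \<i>) = z" using B S u01 u(2) by (simp add: mob_mmul SL2_det line_def y_def del: SL2_iff)
  then show ?thesis using that axis_scale[OF ax, of "sqrt y"] y by simp
qed

text \<open>The stabiliser of \<open>z\<close> is abelian of odd order, so squaring is bijective on it, and \<open>k \<sigma>\<close> \<open>k\<close>-inverse is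
  \<open>k\<^sup>2 \<sigma>\<close> for a reflection \<open>\<sigma>\<close> through \<open>z\<close>.\<close>
lemma reflections_conj:
  assumes g: "g \<in> adm" "g' \<in> adm" and z: "z \<in> uhp" "c (g z) = z" "c (g' z) = z" and nh: "\<not> half_turn z"
  shows "\<exists>k\<in>G. k z = z \<and> c \<circ> g' = k \<circ> (c \<circ> g) \<circ> inv k"
proof -
  obtain B0 where "refl_axis g B0" using ex_axis g by blast
  then obtain B where ax: "refl_axis g B" and Bi: "mob B (Pt \<i>) = z" using axis_point_at_i z by blast
  have B: "B \<in> SL2" using ax axisD by blast
  define \<sigma> where "\<sigma> = c \<circ> g"
  have \<sigma>\<sigma>: "\<sigma> (\<sigma> x) = x" for x using admissible_iff[OF admissible_G[OF g(1)]] g(1) unfolding \<sigma>_def by (metis comp_apply id_apply)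
  have \<sigma>B: "\<sigma> (mob B w) = mob B (nu w)" for w using axisD(2)[OF ax] by (simp add: \<sigma>_def)
  \<comment> \<open>The stabiliser of \<open>\<i>\<close> in \<open>SL2\<close> is the rotation
    group, which is what makes the stabiliser of \<open>z\<close> commutative.\<close>
  have rot: "\<exists>a b. a\<^sup>2 + b\<^sup>2 = 1 \<and> (\<forall>w. k (mob B w) = mob B (mob (a,b,-b,a) w))" if k: "k \<in> stab G z" for k
  proof -
    obtain N where N: "N \<in> SL2" "k = mob N" using k stab_G G_PSL2 by blast
    obtain p q r s where K: "mmul (madj B) (mmul N B) = (p,q,r,s)" by (metis prod_cases4)
    have KS: "(p,q,r,s) \<in> SL2" unfolding K[symmetric] using B N by (intro SL2_mmul SL2_madj)
    have kB: "k (mob B w) = mob B (mob (p,q,r,s) w)" for w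
      unfolding K[symmetric] using B N by (simp add: mob_mmul SL2_det SL2_madj SL2_mmul)
    have "mob B (mob (p,q,r,s) (Pt \<i>)) = mob B (Pt \<i>)" using kB[of "Pt \<i>"] Bi stab_G(2)[OF k] by simp
    then have fx: "mob (p,q,r,s) (Pt \<i>) = Pt \<i>" using mob_eq_iff B by blast
    have "of_real r * \<i> + of_real s \<noteq> 0" using SL2_denom[OF KS, of \<i>] by simp
    then have "of_real p * \<i> + of_real q = \<i> * (of_real r * \<i> + of_real s)"
      using fx by (auto simp: mob_Pt field_simps split: if_splits)
    then have "p = s" "q = - r" by (auto simp: complex_eq_iff)
    then have "r = - q" "s = p" by auto
    then show ?thesis using kB KS by (intro exI[of _ p] exI[of _ q]) (auto simp: power2_eq_square)
  qed
  have onB: "h = h'" if "\<And>w. h (mob B w) = h' (mob B w)" for h h' :: "hpt \<Rightarrow> hpt"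
    by (rule ext) (metis that B mob_madj_eq(1))
  have comm: "k \<circ> k' = k' \<circ> k" if k: "k \<in> stab G z" "k' \<in> stab G z" for k k'
  proof (rule onB)
    obtain a b where ab: "a\<^sup>2 + b\<^sup>2 = 1" "\<And>w. k (mob B w) = mob B (mob (a,b,-b,a) w)" using rot k by metis
    obtain a' b' where ab': "a'\<^sup>2 + b'\<^sup>2 = 1" "\<And>w. k' (mob B w) = mob B (mob (a',b',-b',a') w)" using rot k by metis
    have d: "mdet (a,b,-b,a) \<noteq> 0" "mdet (a',b',-b',a') \<noteq> 0" using ab ab' by (simp_all add: power2_eq_square)
    have "mob (a,b,-b,a) \<circ> mob (a',b',-b',a') = mob (a',b',-b',a') \<circ> mob (a,b,-b,a)"
      unfolding mob_mmul[OF d, symmetric] mob_mmul[OF d(2,1), symmetric] by (simp add: algebra_simps)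
    then show "(k \<circ> k') (mob B w) = (k' \<circ> k) (mob B w)" for w by (simp add: ab ab' fun_eq_iff)
  qed
  \<comment> \<open>A reflection through the centre inverts rotations.\<close>
  have refl: "\<sigma> (k (\<sigma> x)) = inv k x" if k: "k \<in> stab G z" for k x
  proof -
    obtain a b where ab: "a\<^sup>2 + b\<^sup>2 = 1" "\<And>w. k (mob B w) = mob B (mob (a,b,-b,a) w)" using rot k by metis
    have R: "(a,b,-b,a) \<in> SL2" using ab by (simp add: power2_eq_square)
    have "nu \<circ> mob (a,b,-b,a) \<circ> nu = mob (madj (a,b,-b,a))"
    proof -
      have "nu \<circ> mob (a,b,-b,a) = antimob (-a,-b,-b,a)" using R by (simp add: nu_def antimob_mob)
      then have "nu \<circ> mob (a,b,-b,a) \<circ> nu = antimob (-a,-b,-b,a) \<circ> nu" by simp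
      also have "\<dots> = mob (a,-b,b,a)"
        unfolding nu_def using R by (subst antimob_mob) (auto simp: algebra_simps)
      finally show ?thesis by simp
    qed
    then have n: "nu (mob (a,b,-b,a) (nu w)) = mob (madj (a,b,-b,a)) w" for w by (metis comp_apply)
    have "(\<sigma> \<circ> k \<circ> \<sigma>) = inv k"
    proof (rule onB)
      fix w
      have "k (\<sigma> (k (\<sigma> (mob B w)))) = mob B w" using R by (simp add: \<sigma>B ab n del: SL2_iff madj_simp)
      then have "inv k (k (\<sigma> (k (\<sigma> (mob B w))))) = inv k (mob B w)" by simp
      then show "(\<sigma> \<circ> k \<circ> \<sigma>) (mob B w) = inv k (mob B w)" using k stab_G by simp
    qed
    then show ?thesis by (metis comp_apply)
  qed
  \<comment> \<open>The product of the two reflections, \<open>c g' c g\<close>: a rotation about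
    \<open>z\<close> whose square root is the wanted \<open>k\<close>.\<close>
  define \<rho> where "\<rho> = twist c g' \<circ> g"
  have \<rho>: "\<rho> \<in> stab G z"
  proof -
    have "\<rho> \<in> G" unfolding \<rho>_def using g admissible_G twist_G G_comp by blast
    moreover have "\<rho> z = z" using z by (simp add: \<rho>_def twist_def)
    ultimately show ?thesis by (simp add: stab_def)
  qed
  have \<rho>\<sigma>: "\<rho> (\<sigma> x) = c (g' x)" for x
  proof -
    have "\<rho> (\<sigma> x) = c (g' (\<sigma> (\<sigma> x)))" by (simp add: \<rho>_def \<sigma>_def twist_def)
    then show ?thesis by (simp add: \<sigma>\<sigma>)
  qed
  \<comment> \<open>If two elements have equal squares, commutativity makes their quotient square to
    \<open>id\<close>; it fixes \<open>z\<close>, so it is trivial because \<open>z\<close> has no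
    half-turn.\<close>
  have "inj_on (\<lambda>k. k \<circ> k) (stab G z)"
  proof (rule inj_onI)
    fix k k' assume k: "k \<in> stab G z" "k' \<in> stab G z" "k \<circ> k = k' \<circ> k'"
    define m where "m = k \<circ> inv k'"
    have m: "m \<in> stab G z" unfolding m_def using k stab_comp stab_inv by blast
    have ik: "inv k' \<in> stab G z" using k stab_inv by blast
    have kk: "k (k x) = k' (k' x)" for x using k(3) by (metis comp_apply)
    have "m (m x) = x" for x
    proof -
      have "m (m x) = k (inv k' (k (inv k' x)))" by (simp add: m_def)
      also have "inv k' (k (inv k' x)) = k (inv k' (inv k' x))" using comm[OF ik k(1)] by (metis comp_apply)
      finally show ?thesis using k(2) stab_G by (simp add: kk)
    qed
    then have "m \<circ> m = id" by auto
    then have mid: "m = id" using nh m by (auto simp: half_turn_def stab_def)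
    show "k = k'"
    proof
      fix x
      have "m (k' x) = k' x" unfolding mid by simp
      then show "k x = k' x" using k(2) stab_G by (simp add: m_def)
    qed
  qed
  moreover have "(\<lambda>k. k \<circ> k) ` stab G z \<subseteq> stab G z" using stab_comp by blast
  ultimately have "(\<lambda>k. k \<circ> k) ` stab G z = stab G z" using endo_inj_surj finite_stab z by blast
  then obtain k where k: "k \<in> stab G z" "\<rho> = k \<circ> k" using \<rho> by blast
  have kG: "k \<in> G" "k z = z" using k stab_G by auto
  have "c \<circ> g' = k \<circ> \<sigma> \<circ> inv k"
  proof
    fix x
    have "\<sigma> (inv k x) = \<sigma> (\<sigma> (k (\<sigma> x)))" using refl[OF k(1)] by simp
    then have "\<sigma> (inv k x) = k (\<sigma> x)" by (simp add: \<sigma>\<sigma>)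
    then have "(k \<circ> \<sigma> \<circ> inv k) x = \<rho> (\<sigma> x)" by (simp add: k(2))
    then show "(c \<circ> g') x = (k \<circ> \<sigma> \<circ> inv k) x" by (simp add: \<rho>\<sigma>)
  qed
  then show ?thesis using kG by (intro bexI[of _ k]) (simp_all add: \<sigma>_def)
qed

lemma admissible_conj:
  assumes g: "g \<in> adm" and d: "d \<in> G"
  shows "twist c d \<circ> g \<circ> inv d \<in> adm"
    and "c \<circ> (twist c d \<circ> g \<circ> inv d) = d \<circ> (c \<circ> g) \<circ> inv d"
proof -
  show e: "c \<circ> (twist c d \<circ> g \<circ> inv d) = d \<circ> (c \<circ> g) \<circ> inv d"
    by (simp add: fun_eq_iff twist_def)
  have gg: "c (g (c (g x))) = x" for x
    using g admissible_iff[OF admissible_G[OF g]] by (metis comp_apply id_apply)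
  have G: "twist c d \<circ> g \<circ> inv d \<in> G" using admissible_G[OF g] d by (intro G_comp twist_G G_inv)
  show "twist c d \<circ> g \<circ> inv d \<in> adm"
    unfolding admissible_iff[OF G] e using d by (simp add: fun_eq_iff gg)
qed

text \<open>Some \<open>d\<close> carries \<open>z\<close> to \<open>w\<close> and the first
  reflection to one through \<open>w\<close>; \<open>reflections_conj\<close> corrects this by an
  element fixing \<open>w\<close>. With \<open>g = g'\<close> the result commutes with the
  reflection and so preserves its axis, which is how \<open>pt_equiv\<close> uses it.\<close>

lemma same_edge:
  assumes g: "g \<in> adm" "g' \<in> adm"
    and z: "z \<in> uhp" "c (g z) = z" "c (g' w) = w" "orb z = orb w" and nh: "\<not> half_turn z"
  shows "\<exists>d\<in>G. d z = w \<and> c \<circ> g' = d \<circ> (c \<circ> g) \<circ> inv d"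
proof -
  obtain d where d: "d \<in> G" "d z = w" using z orbit_eq_iff by blast
  let ?g = "twist c d \<circ> g \<circ> inv d"
  have cg: "c (?g x) = d (c (g (inv d x)))" for x
    using admissible_conj(2)[OF g(1) d(1)] by (metis comp_apply)
  have "c (?g w) = w" unfolding cg using d z by (metis G_inv_ap(1))
  moreover have "w \<in> uhp" using d z G_uhp by blast
  moreover have "\<not> half_turn w" using half_turn_G d nh by blast
  ultimately obtain k where k: "k \<in> G" "k w = w" "c \<circ> g' = k \<circ> (c \<circ> ?g) \<circ> inv k"
    using reflections_conj[OF admissible_conj(1)[OF g(1) d(1)] g(2)] z by blast
  have "c \<circ> g' = (k \<circ> d) \<circ> (c \<circ> g) \<circ> inv (k \<circ> d)"
    unfolding k(3) admissible_conj(2)[OF g(1) d(1)] o_inv_distrib[OF G_bij[OF k(1)] G_bij[OF d(1)]]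
    by (simp add: o_assoc)
  moreover have "(k \<circ> d) z = w" using k d by simp
  ultimately show ?thesis using G_comp[OF k(1) d(1)] by blast
qed

end

section \<open>The stabiliser of a geodesic\<close>

lemma mob_eq_mob:
  assumes K: "(a',b',c',d') \<in> SL2" and M: "(a,b,c,d) \<in> SL2" and eq: "mob (a',b',c',d') = mob (a,b,c,d)"
  shows "(a',b',c',d') = (a,b,c,d) \<or> (a',b',c',d') = (-a,-b,-c,-d)"
proof -
  let ?K = "(a',b',c',d')" and ?M = "(a,b,c,d)"
  have "mob (mmul (madj ?M) ?K) = mob (madj ?M) \<circ> mob ?M"
    by (simp only: mob_mmul[OF SL2_det[OF SL2_madj[OF M]] SL2_det[OF K]] eq)
  then have "mob (mmul (madj ?M) ?K) = id" using mob_inverse(2)[OF M] by simp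
  moreover have "mmul (madj ?M) ?K \<in> SL2" using K M by (intro SL2_mmul SL2_madj)
  ultimately have "mmul (madj ?M) ?K = (1,0,0,1) \<or> mmul (madj ?M) ?K = (-1,0,0,-1)"
    by (rule mob_eq_id_SL2[rotated])
  moreover have "?K = mmul ?M (mmul (madj ?M) ?K)"
    using mmul_madj(1)[OF M] by (simp only: mmul_assoc[symmetric] mmul_one)
  ultimately have "?K = mmul ?M (1,0,0,1) \<or> ?K = mmul ?M (-1,0,0,-1)" by metis
  then show ?thesis by simp
qed

text \<open>The multiplicative coordinate of the axis, in which the stabiliser acts by scaling and
  inversion; \<open>line\<close> uses \<open>u / (1 - u)\<close> in its place.\<close>

definition axis_pt :: "mat2 \<Rightarrow> real \<Rightarrow> hpt" where
  "axis_pt B y = mob B (Pt (Complex 0 y))"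

lemma line_pt: "u \<noteq> 1 \<Longrightarrow> line B u = axis_pt B (u / (1 - u))"
  by (simp add: line_def axis_pt_def)

lemma pt_uhp: "B \<in> SL2 \<Longrightarrow> y > 0 \<Longrightarrow> axis_pt B y \<in> uhp"
  by (simp add: axis_pt_def mob_in_uhp)

lemma pt_line: "y > 0 \<Longrightarrow> axis_pt B y = line B (y / (1 + y))"
proof -
  assume y: "y > 0"
  then have "y / (1 + y) \<noteq> 1" "y / (1 + y) / (1 - y / (1 + y)) = y" by (simp_all add: field_simps)
  then show ?thesis by (simp add: line_pt)
qed

lemma mob_diag_pt: "l \<noteq> 0 \<Longrightarrow> a * l = 1 \<Longrightarrow> mob (a,0,0,l) (Pt (Complex 0 y)) = Pt (Complex 0 (a\<^sup>2 * y))"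
proof -
  assume l: "l \<noteq> 0" "a * l = 1"
  then have "a = 1 / l" by (simp add: field_simps)
  then show ?thesis using l by (simp add: mob_Pt complex_eq_iff power2_eq_square)
qed

lemma mob_antidiag_pt: "- b * p = 1 \<Longrightarrow> y \<noteq> 0 \<Longrightarrow> mob (0,b,p,0) (Pt (Complex 0 y)) = Pt (Complex 0 (b\<^sup>2 / y))"
proof -
  assume l: "- b * p = 1" "y \<noteq> 0"
  then have "b \<noteq> 0" by auto
  then have p: "p = - 1 / b" using l by (simp add: field_simps)
  then show ?thesis using l(2) \<open>b \<noteq> 0\<close> unfolding p
    by (simp add: mob_Pt complex_eq_iff Re_divide Im_divide power2_eq_square field_simps)
qed

context real_fuchsian_group begin

text \<open>On the geodesic with coordinate \<open>i y\<close>, an element \<open>l\<close> of \<open>dilations\<close> acts by \<open>y \<mapsto> l\<^sup>2 y\<close> and an element \<open>f\<close>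
  of \<open>turn_points\<close> by the half-turn \<open>y \<mapsto> f\<^sup>2 / y\<close> about \<open>i f\<close>.\<close>
definition dilations :: "mat2 \<Rightarrow> real set" where
  "dilations B = {l. l > 0 \<and> (l,0,0,1/l) \<in> mats B}"

definition turn_points :: "mat2 \<Rightarrow> real set" where
  "turn_points B = {f. f > 0 \<and> (0,f,-1/f,0) \<in> mats B}"

lemma mats_orbit: "M \<in> mats B \<Longrightarrow> orb (mob B (mob M w)) = orb (mob B w)"
proof -
  assume "M \<in> mats B"
  then obtain g where g: "g \<in> G" "g \<circ> mob B = mob B \<circ> mob M" by (auto simp: mats_def)
  then show ?thesis using orbit_eq[OF g(1), of "mob B w"] by (metis comp_apply)
qed

lemma dilations_orbit: "l \<in> dilations B \<Longrightarrow> orb (axis_pt B (l\<^sup>2 * y)) = orb (axis_pt B y)"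
  using mats_orbit[of "(l,0,0,1/l)" B "Pt (Complex 0 y)"] by (simp add: dilations_def axis_pt_def mob_diag_pt)

lemma turn_points_orbit: "f \<in> turn_points B \<Longrightarrow> y \<noteq> 0 \<Longrightarrow> orb (axis_pt B (f\<^sup>2 / y)) = orb (axis_pt B y)"
  using mats_orbit[of "(0,f,-1/f,0)" B "Pt (Complex 0 y)"] by (simp add: turn_points_def axis_pt_def mob_antidiag_pt)

lemma turn_points_ends: "f \<in> turn_points B \<Longrightarrow> orb (axis_pt B 0) = orb (mob B Inf)"
  using mats_orbit[of "(0,f,-1/f,0)" B Inf] by (simp add: turn_points_def axis_pt_def mob_Inf zero_complex.code[symmetric] Complex_eq_0)

lemma ex_mats:
  assumes B: "B \<in> SL2" and d: "d \<in> G"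
  obtains a b p q where "(a,b,p,q) \<in> mats B" "\<And>w. d (mob B w) = mob B (mob (a,b,p,q) w)"
proof -
  obtain D where D: "D \<in> SL2" "d = mob D" using G_PSL2 d by blast
  obtain a b p q where M: "mmul (madj B) (mmul D B) = (a,b,p,q)" by (metis prod_cases4)
  have S: "(a,b,p,q) \<in> SL2" unfolding M[symmetric] using B D by (intro SL2_mmul SL2_madj)
  have ap: "d (mob B w) = mob B (mob (a,b,p,q) w)" for w
    unfolding M[symmetric] using B D by (simp add: mob_mmul SL2_det SL2_madj SL2_mmul)
  then have "(a,b,p,q) \<in> mats B" using S d by (intro matsI[of _ d]) (auto simp: fun_eq_iff)
  then show ?thesis using that ap by blast
qed

text \<open>The element from \<open>same_edge\<close> commutes with the reflection, so its matrix
  commutes with \<open>nu\<close>. Conjugation by \<open>nu\<close> negates the off-diagonal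
  entries; hence, up to sign, the matrix is diagonal (a dilation) or antidiagonal (a
  half-turn).\<close>

lemma pt_equiv:
  assumes g: "g \<in> adm" and ax: "refl_axis g B" and y: "y > 0" "y' > 0"
    and eq: "orb (axis_pt B y) = orb (axis_pt B y')" and nh: "\<not> half_turn (axis_pt B y)"
  shows "(\<exists>l\<in>dilations B. y' = l\<^sup>2 * y) \<or> (\<exists>f\<in>turn_points B. y' = f\<^sup>2 / y)"
proof -
  have B: "B \<in> SL2" using ax axisD by blast
  have ons: "c (g (axis_pt B y)) = axis_pt B y" if "y > 0" for y using nu_line[OF ax] pt_line[OF that] by metis
  obtain d where d: "d \<in> G" "d (axis_pt B y) = axis_pt B y'" "c \<circ> g = d \<circ> (c \<circ> g) \<circ> inv d"
    using same_edge[OF g g pt_uhp[OF B y(1)] ons[OF y(1)] ons[OF y(2)] eq nh] by blast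
  have comm: "c (g (d x)) = d (c (g x))" for x
    using fun_cong[OF d(3), of "d x"] d(1) by simp
  obtain a b p q where M: "(a,b,p,q) \<in> mats B" and dB: "\<And>w. d (mob B w) = mob B (mob (a,b,p,q) w)"
    using ex_mats[OF B d(1)] by blast
  have S: "(a,b,p,q) \<in> SL2" using M mats_SL2 by blast
  have "mob (a,b,p,q) (nu w) = nu (mob (a,b,p,q) w)" for w
  proof -
    have "mob B (mob (a,b,p,q) (nu w)) = mob B (nu (mob (a,b,p,q) w))"
      using comm[of "mob B w"] by (simp only: dB axisD(2)[OF ax])
    then show ?thesis using mob_eq_iff B by blast
  qed
  then have "mob (a,b,p,q) \<circ> nu = nu \<circ> mob (a,b,p,q)" by auto
  then have "antimob (mmul (a,b,p,q) (-1,0,0,1)) = antimob (mmul (-1,0,0,1) (a,b,p,q))"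
    using S by (simp add: nu_def antimob_mob)
  then have "antimob (mmul (a,b,p,q) (-1,0,0,1)) \<circ> nu = antimob (mmul (-1,0,0,1) (a,b,p,q)) \<circ> nu" by simp
  then have "mob (a,b,p,q) = mob (a,-b,-p,q)"
    using S unfolding nu_def by (simp add: antimob_mob)
  then have "(a,b,p,q) = (a,-b,-p,q) \<or> (a,b,p,q) = (-a,b,p,-q)"
    using mob_eq_mob[OF S, of a "-b" "-p" q] S by simp
  then have cs: "(b = 0 \<and> p = 0) \<or> (a = 0 \<and> q = 0)" by auto
  have dy: "mob (a,b,p,q) (Pt (Complex 0 y)) = Pt (Complex 0 y')"
    using d(2) dB[of "Pt (Complex 0 y)"] mob_eq_iff[OF B] unfolding axis_pt_def by metis
  show ?thesis
  proof (cases "b = 0 \<and> p = 0")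
    case True
    then have aq: "a * q = 1" using S by simp
    then have a0: "a \<noteq> 0" "q \<noteq> 0" by auto
    then have q: "q = 1 / a" using aq by (simp add: field_simps)
    have "(\<bar>a\<bar>,0,0,1/\<bar>a\<bar>) \<in> mats B"
      using M mats_uminus[OF M] True q by (cases "a > 0") auto
    then have "\<bar>a\<bar> \<in> dilations B" using a0 by (simp add: dilations_def)
    moreover have "y' = \<bar>a\<bar>\<^sup>2 * y" using dy True mob_diag_pt[OF a0(2) aq, of y] by simp
    ultimately show ?thesis by blast
  next
    case False
    then have aq: "a = 0" "q = 0" using cs by auto
    then have bp: "- b * p = 1" using S by simp
    then have b0: "b \<noteq> 0" by auto
    then have p: "p = - 1 / b" using bp by (simp add: field_simps)
    have "(0,\<bar>b\<bar>,-1/\<bar>b\<bar>,0) \<in> mats B"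
      using M mats_uminus[OF M] aq p by (cases "b > 0") auto
    then have "\<bar>b\<bar> \<in> turn_points B" using b0 by (simp add: turn_points_def)
    moreover have "y' = \<bar>b\<bar>\<^sup>2 / y" using dy aq mob_antidiag_pt[OF bp, of y] y by simp
    ultimately show ?thesis by blast
  qed
qed

text \<open>A nontrivial involution in \<open>SL2\<close> modulo sign has trace zero, and fixing the
  point at height \<open>y\<close> on the imaginary axis then leaves only the antidiagonal matrix
  with entries \<open>y\<close> and \<open>-1/y\<close>, up to sign.\<close>

lemma half_turn_pt:
  assumes B: "B \<in> SL2" and y: "y > 0"
  shows "half_turn (axis_pt B y) \<longleftrightarrow> y \<in> turn_points B"
proof
  assume "y \<in> turn_points B"
  then have M: "(0,y,-1/y,0) \<in> mats B" by (simp add: turn_points_def)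
  then obtain g where g: "g \<in> G" "\<And>w. g (mob B w) = mob B (mob (0,y,-1/y,0) w)"
    unfolding mats_def by (auto simp: fun_eq_iff)
  have MS: "(0,y,-1/y,0) \<in> SL2" using y by simp
  have "mob (0,y,-1/y,0) \<circ> mob (0,y,-1/y,0) = mob (-1,0,0,-1)"
    using y by (simp add: mob_mmul[symmetric])
  also have "\<dots> = id" using mob_uminus[of 1 0 0 1] mob_one by simp
  finally have MM: "mob (0,y,-1/y,0) (mob (0,y,-1/y,0) w) = w" for w by (metis comp_apply id_apply)
  have "g \<circ> g = id"
  proof
    fix x show "(g \<circ> g) x = id x" using g(2) MM B by (metis comp_apply id_apply mob_madj_eq(1))
  qed
  moreover have "g \<noteq> id"
  proof
    assume "g = id"
    then have "mob (0,y,-1/y,0) w = w" for w using g(2)[of w] mob_eq_iff[OF B] by simp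
    then have "mob (0,y,-1/y,0) = id" by auto
    then show False using mob_eq_id(1) y by fastforce
  qed
  moreover have "g (axis_pt B y) = axis_pt B y"
    using mob_antidiag_pt[of y "-1/y" y] y by (simp add: axis_pt_def g(2) power2_eq_square)
  ultimately show "half_turn (axis_pt B y)" using g(1) by (auto simp: half_turn_def)
next
  assume "half_turn (axis_pt B y)"
  then obtain i where i: "i \<in> G" "i \<noteq> id" "i \<circ> i = id" "i (axis_pt B y) = axis_pt B y" by (auto simp: half_turn_def)
  obtain a b p q where M: "(a,b,p,q) \<in> mats B" and iB: "\<And>w. i (mob B w) = mob B (mob (a,b,p,q) w)"
    using ex_mats[OF B i(1)] by blast
  have S: "(a,b,p,q) \<in> SL2" using M mats_SL2 by blast
  have "mob (a,b,p,q) (mob (a,b,p,q) w) = w" for w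
    using iB i(3) mob_eq_iff[OF B] by (metis comp_apply id_apply)
  then have "mob (a,b,p,q) \<circ> mob (a,b,p,q) = id" by auto
  then have "mob (mmul (a,b,p,q) (a,b,p,q)) = id" by (simp only: mob_mmul[OF SL2_det[OF S] SL2_det[OF S]])
  then have 1: "b * (a + q) = 0" "p * (a + q) = 0" "(a - q) * (a + q) = 0"
    unfolding mmul_simp using mob_eq_id[of "a*a+b*p" "a*b+b*q" "p*a+q*p" "p*b+q*q"]
    by (simp_all add: algebra_simps)
  have aq: "q = - a"
  proof (rule ccontr)
    assume "q \<noteq> - a"
    then have "a + q \<noteq> 0" by linarith
    then have z: "b = 0" "p = 0" "q = a" using 1 by auto
    then have "a * a = 1" using S by simp
    then have "a = 1 \<or> a = -1" by (simp add: square_eq_1_iff)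
    then have "mob (a,b,p,q) = id" using z mob_one mob_uminus[of 1 0 0 1] by auto
    then have "i (mob B w) = mob B w" for w using iB by simp
    then have "i x = x" for x using B by (metis mob_madj_eq(1))
    then show False using i(2) by auto
  qed
  have fx: "mob (a,b,p,q) (Pt (Complex 0 y)) = Pt (Complex 0 y)"
    using i(4) iB mob_eq_iff[OF B] unfolding axis_pt_def by metis
  have "of_real p * Complex 0 y + of_real q \<noteq> 0" using SL2_denom[OF S, of "Complex 0 y"] y by simp
  then have "of_real a * Complex 0 y + of_real b = Complex 0 y * (of_real p * Complex 0 y + of_real q)"
    using fx by (auto simp: mob_Pt field_simps split: if_splits)
  then have "a * y = y * q" "b = - (y * (p * y))" by (auto simp: complex_eq_iff)
  then have a: "a = 0" and b: "b = - (p * y * y)" using aq y by auto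
  have "(p * y) * (p * y) = 1" using S a b by (simp add: mult_ac)
  then have "p * y = 1 \<or> p * y = -1" by (simp add: square_eq_1_iff)
  then have "(p = 1 / y \<and> b = - y) \<or> (p = - 1 / y \<and> b = y)" proof
    assume py: "p * y = 1"
    then have "b = - y" "p = 1 / y" using b y by (simp_all add: field_simps)
    then show ?thesis by simp
  next
    assume py: "p * y = -1"
    then have "b = y" "p = - 1 / y" using b y by (simp_all add: field_simps)
    then show ?thesis by simp
  qed
  then have "(0,y,-1/y,0) \<in> mats B" using M mats_uminus[OF M] a aq by auto
  then show "y \<in> turn_points B" using y by (simp add: turn_points_def)
qed

section \<open>The dilation group and the transport of axes\<close>

lemma dilations_pos: "l \<in> dilations B \<Longrightarrow> l > 0" and turn_points_pos: "f \<in> turn_points B \<Longrightarrow> f > 0"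
  by (auto simp: dilations_def turn_points_def)

lemma dilations_one: "1 \<in> dilations B"
  using mats_one by (simp add: dilations_def)

lemma dilations_mult: "l \<in> dilations B \<Longrightarrow> m \<in> dilations B \<Longrightarrow> l * m \<in> dilations B"
  using mats_mmul[of "(l,0,0,1/l)" B "(m,0,0,1/m)"] by (simp add: dilations_def)

lemma dilations_inverse: "l \<in> dilations B \<Longrightarrow> 1 / l \<in> dilations B"
  using mats_madj[of "(l,0,0,1/l)" B] by (simp add: dilations_def)

lemma dilations_turn_points: "l \<in> dilations B \<Longrightarrow> f \<in> turn_points B \<Longrightarrow> l * f \<in> turn_points B"
  using mats_mmul[of "(l,0,0,1/l)" B "(0,f,-1/f,0)"] by (simp add: dilations_def turn_points_def)

lemma turn_points_divide: "f \<in> turn_points B \<Longrightarrow> f' \<in> turn_points B \<Longrightarrow> f / f' \<in> dilations B"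
  using mats_mmul[OF _ mats_madj, of "(0,f,-1/f,0)" B "(0,f',-1/f',0)"] by (simp add: dilations_def turn_points_def)

lemma finite_dilations: "B \<in> SL2 \<Longrightarrow> finite {l \<in> dilations B. 1 \<le> l \<and> l \<le> K}"
proof -
  assume B: "B \<in> SL2"
  have "(\<lambda>l. (l,0::real,0::real,1/l)) ` {l \<in> dilations B. 1 \<le> l \<and> l \<le> K} \<subseteq> {M \<in> mats B. norm M \<le> K + 1}"
  proof clarify
    fix l assume l: "l \<in> dilations B" "1 \<le> l" "l \<le> K"
    have "\<bar>1/l\<bar> \<le> 1" using l by simp
    then have "norm (l,0::real,0::real,1/l) \<le> K + 1" using norm_mat2[of l 0 0 "1/l"] l by linarith
    then show "(l,0,0,1/l) \<in> mats B \<and> norm (l,0::real,0::real,1/l) \<le> K + 1" using l by (simp add: dilations_def)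
  qed
  then have "finite ((\<lambda>l. (l,0::real,0::real,1/l)) ` {l \<in> dilations B. 1 \<le> l \<and> l \<le> K})"
    using finite_mats[OF B] finite_subset by blast
  then show ?thesis by (rule finite_imageD) (auto simp: inj_on_def)
qed

lemma dilations_power: "l \<in> dilations B \<Longrightarrow> l ^ n \<in> dilations B"
  by (induction n) (use dilations_one dilations_mult in auto)

text \<open>A discrete subgroup of the positive reals is generated by its least element above 1. The
  minimum is taken over the finite set up to some \<open>l1\<close>, and a floor gives the
  exponent.\<close>

lemma dilations_cyclic:
  assumes B: "B \<in> SL2" and nt: "dilations B \<noteq> {1}"
  obtains L where "L > 0" "dilations B = range (\<lambda>k::int. exp (of_int k * L))"
proof -
  obtain l where "l \<in> dilations B" "l \<noteq> 1" using nt dilations_one by blast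
  then obtain l1 where l1: "l1 \<in> dilations B" "l1 > 1"
    using dilations_inverse[of l B] dilations_pos[of l B] by (cases "l > 1") (force simp: field_simps)+
  let ?S = "{l \<in> dilations B. 1 < l \<and> l \<le> l1}"
  have fin: "finite ?S" by (rule finite_subset[OF _ finite_dilations[OF B, of l1]]) auto
  have ne: "?S \<noteq> {}" using l1 by auto
  define l0 where "l0 = Min ?S"
  define L where "L = ln l0"
  have l0S: "l0 \<in> ?S" unfolding l0_def using fin ne by (rule Min_in)
  then have L: "L > 0" and l0: "l0 = exp L" by (auto simp: L_def)
  have l0min: "l0 \<le> l" if "l \<in> dilations B" "l > 1" for l
  proof (cases "l \<le> l1")
    case True
    then show ?thesis unfolding l0_def using that fin by (intro Min_le) auto
  next
    case False
    then show ?thesis using l0S by simp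
  qed
  have pow: "exp (of_int k * L) \<in> dilations B" for k :: int
  proof -
    have n: "exp (of_nat n * L) \<in> dilations B" for n
      using dilations_power[of l0 B n] l0S by (simp add: l0 exp_of_nat_mult)
    show ?thesis
      using n dilations_inverse[OF n] by (cases k rule: int_cases2) (auto simp: exp_minus inverse_eq_divide)
  qed
  have "l \<in> range (\<lambda>k::int. exp (of_int k * L))" if l: "l \<in> dilations B" for l
  proof -
    define k where "k = \<lfloor>ln l / L\<rfloor>"
    define m where "m = l * exp (of_int (- k) * L)"
    have m: "m \<in> dilations B" unfolding m_def using l pow by (intro dilations_mult)
    have le: "ln m = ln l - of_int k * L" using dilations_pos[OF l] by (simp add: m_def ln_mult)
    have "of_int k * L \<le> ln l" "ln l < (of_int k + 1) * L"
      using L floor_divide_lower[OF L, of "ln l"] floor_divide_upper[OF L, of "ln l"] by (simp_all add: k_def)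
    then have "0 \<le> ln m" "ln m < L" unfolding le by (simp_all add: algebra_simps)
    then have "exp 0 \<le> exp (ln m)" "exp (ln m) < exp L"
      by (simp_all only: exp_le_cancel_iff exp_less_cancel_iff)
    then have "1 \<le> m" "m < l0" using dilations_pos[OF m] by (simp_all add: l0)
    then have "m = 1" using l0min[OF m] by (cases "m > 1") auto
    then have "ln l = of_int k * L" using le by simp
    then show ?thesis using dilations_pos[OF l] by (metis exp_ln rangeI)
  qed
  then show ?thesis using that[OF L] pow by blast
qed

lemma axis_transport:
  assumes ax: "refl_axis g B" and d: "d \<in> G" "c \<circ> g' = d \<circ> (c \<circ> g) \<circ> inv d"
  obtains B' where "refl_axis g' B'" "\<And>u. line B' u = d (line B u)" "ldom B' = ldom B"
proof -
  have B: "B \<in> SL2" using ax axisD by blast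
  obtain D where D: "D \<in> SL2" "d = mob D" using G_PSL2 d by blast
  let ?B = "mmul D B"
  have m: "mob ?B = d \<circ> mob B" using B D by (simp add: mob_mmul SL2_det)
  have "c \<circ> g' \<circ> mob ?B = mob ?B \<circ> nu"
  proof
    fix w
    show "(c \<circ> g' \<circ> mob ?B) w = (mob ?B \<circ> nu) w"
      unfolding m d(2) using d(1) axisD(2)[OF ax] by simp
  qed
  then have "refl_axis g' ?B" using B D by (simp add: refl_axis_def SL2_mmul)
  moreover have ln: "line ?B u = d (line B u)" for u by (simp add: line_def m)
  moreover have "ldom ?B = ldom B" by (simp add: ldom_def ln hstar_G[OF d(1)])
  ultimately show ?thesis using that by blast
qed

text \<open>Moving the parametrisation by \<open>d\<close> changes no orbit, so openness along a
  geodesic passes through its whole twisted class.\<close>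

lemma line_open_transport:
  assumes "refl_axis g B" and d: "d \<in> G" "c \<circ> g' = d \<circ> (c \<circ> g) \<circ> inv d" and op: "line_open (\<lambda>z. orb z \<in> U) B"
  shows "\<exists>B'. refl_axis g' B' \<and> line_open (\<lambda>z. orb z \<in> U) B'"
proof -
  obtain B' where B': "refl_axis g' B'" "\<And>u. line B' u = d (line B u)" "ldom B' = ldom B"
    using axis_transport[OF assms(1-3)] by blast
  have "line_open (\<lambda>z. orb z \<in> U) B'"
    using op unfolding line_open_def B'(2,3) orbit_eq[OF d(1)] .
  then show ?thesis using B' by blast
qed

lemma line_XR: "g \<in> adm \<Longrightarrow> refl_axis g B \<Longrightarrow> u \<in> ldom B \<Longrightarrow> orb (line B u) \<in> XR G c"
  using Cset_XR[OF admissible_G] Cset_line by (metis imageI)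

lemma pt_XR: "g \<in> adm \<Longrightarrow> refl_axis g B \<Longrightarrow> y > 0 \<Longrightarrow> orb (axis_pt B y) \<in> XR G c"
  using line_XR[of g B "y/(1+y)"] ldom_open[of B "y/(1+y)"] axisD(1) pt_line[of y B] by (simp add: field_simps)

text \<open>If the end at infinity were not a cusp, the images of the points \<open>i n\<close> would form an infinite closed
  discrete subset of the compact quotient.\<close>
lemma end_is_cusp:
  assumes comp: "compact_space (X_top G)" and g: "g \<in> adm" and ax: "refl_axis g B"
    and L: "dilations B = {1}" and F: "turn_points B \<subseteq> {1}"
  shows "1 \<in> ldom B"
proof (rule ccontr)
  assume n1: "1 \<notin> ldom B"
  have B: "B \<in> SL2" using ax axisD by blast
  \<comment> \<open>Starting at 2 avoids the only possible turn point, at height 1, and keeps the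
    integers apart from their reciprocals.\<close>
  define C where "C m = (\<lambda>n. orb (axis_pt B (of_nat n))) ` {m + 2..}" for m :: nat
  have nh: "\<not> half_turn (axis_pt B (of_nat n))" if "n \<ge> 2" for n :: nat
    using half_turn_pt[OF B, of "of_nat n"] F that by auto
  have equiv: "y = of_nat n \<or> (1 \<in> turn_points B \<and> y = 1 / of_nat n)"
    if "orb (axis_pt B y) = orb (axis_pt B (of_nat n))" "n \<ge> 2" "y > 0" for y and n :: nat
    using pt_equiv[OF g ax, of "of_nat n" y] that nh[of n] L F by auto
  \<comment> \<open>A half-turn about height 1 exchanges the ends, so the end 0 is no cusp either;
    hence \<open>(1 - u) / u\<close> is continuous on \<open>ldom B\<close>.\<close>
  have n0: "0 \<notin> ldom B" if f1: "1 \<in> turn_points B"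
  proof
    assume "0 \<in> ldom B"
    then have "axis_pt B 0 \<in> cusps G" using ldom_0[OF B] by (simp add: line_pt)
    moreover obtain d where "d \<in> G" "d (axis_pt B 0) = mob B Inf" using turn_points_ends[OF f1] orbit_eq_iff by blast
    ultimately have "line B 1 \<in> cusps G" using cusps_G by (metis line_def)
    then show False using n1 ldom_1[OF B] by simp
  qed
  have CXR: "C m \<subseteq> XR G c" for m unfolding C_def
    by (rule image_subsetI) (rule pt_XR[OF g ax], simp)
  have nocusp: "orb s \<notin> C m" if "s \<in> cusps G" for s m
  proof
    assume "orb s \<in> C m"
    then obtain n where n: "n \<ge> m + 2" "orb (axis_pt B (of_nat n)) = orb s" by (auto simp: C_def)
    then have "axis_pt B (of_nat n) \<in> uhp" by (intro pt_uhp B) simp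
    then show False using uhp_orbit_not_cusp that n(2) by blast
  qed
  have lo: "line_open (\<lambda>z. orb z \<in> - C m) B" for m
  proof -
    let ?N = "of_nat ` {m + 2..} :: real set"
    have cl: "open (- ?N)" using closed_of_nat_image by auto
    have sub: "ldom B \<subseteq> {0..<1}"
    proof
      fix u assume "u \<in> ldom B"
      then have "u \<noteq> 1" "u \<in> {0..1}" using n1 by (auto simp: ldom_def)
      then show "u \<in> {0..<1}" by simp
    qed
    have c1: "continuous_on (ldom B) (\<lambda>u. u / (1 - u))"
      using sub by (intro continuous_intros) auto
    \<comment> \<open>With a half-turn present, heights 1/n have the same orbits as heights n and
      have to be removed as well.\<close>
    define S where "S = (if 1 \<in> turn_points B then ldom B \<inter> (\<lambda>u. (1 - u) / u) -` (- ?N) else ldom B)"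
    have S: "openin (top_of_set (ldom B)) S"
    proof (cases "1 \<in> turn_points B")
      case True
      have "continuous_on (ldom B) (\<lambda>u. (1 - u) / u)"
        using n0[OF True] by (intro continuous_intros) auto
      then show ?thesis using True cl by (simp add: S_def continuous_openin_preimage_gen)
    qed (simp add: S_def)
    have op: "openin (top_of_set (ldom B)) ((ldom B \<inter> (\<lambda>u. u / (1 - u)) -` (- ?N)) \<inter> S)"
      using continuous_openin_preimage_gen[OF c1 cl] S by (rule openin_Int)
    have iff: "orb (line B u) \<in> - C m \<longleftrightarrow> u \<in> (ldom B \<inter> (\<lambda>u. u / (1 - u)) -` (- ?N)) \<inter> S" if u: "u \<in> ldom B" for u
    proof (cases "u = 0")
      case True
      then have "line B u \<in> cusps G" using ldom_0[OF B] u by simp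
      then have "orb (line B u) \<in> - C m" using nocusp by simp
      moreover have "u \<in> S" using True n0 u by (auto simp: S_def)
      ultimately show ?thesis using True u by auto
    next
      case False
      then have u01: "0 < u" "u < 1" using u sub by force+
      let ?y = "u / (1 - u)"
      have y: "?y > 0" "line B u = axis_pt B ?y" using u01 by (simp_all add: line_pt)
      have "orb (axis_pt B ?y) \<in> C m \<longleftrightarrow> (\<exists>n\<ge>m+2. orb (axis_pt B ?y) = orb (axis_pt B (of_nat n)))"
        by (auto simp: C_def)
      also have "\<dots> \<longleftrightarrow> (\<exists>n\<ge>m+2. ?y = of_nat n \<or> (1 \<in> turn_points B \<and> ?y = 1 / of_nat n))"
      proof (intro ex_cong1 conj_cong refl iffI)
        fix n assume n: "m + 2 \<le> n" and cs: "?y = of_nat n \<or> (1 \<in> turn_points B \<and> ?y = 1 / of_nat n)"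
        from cs show "orb (axis_pt B ?y) = orb (axis_pt B (of_nat n))"
        proof (elim disjE conjE)
          assume f1: "1 \<in> turn_points B" and y1: "?y = 1 / of_nat n"
          show ?thesis unfolding y1 using turn_points_orbit[OF f1, of "of_nat n"] n by simp
        qed (simp only:)
      next
        fix n assume n: "m + 2 \<le> n" and eq: "orb (axis_pt B ?y) = orb (axis_pt B (of_nat n))"
        have "n \<ge> 2" using n by simp
        from equiv[OF eq this y(1)] show "?y = of_nat n \<or> (1 \<in> turn_points B \<and> ?y = 1 / of_nat n)" .
      qed
      also have "\<dots> \<longleftrightarrow> ?y \<in> ?N \<or> (1 \<in> turn_points B \<and> (1 - u) / u \<in> ?N)"
      proof -
        have "?y = 1 / of_nat n \<longleftrightarrow> (1 - u) / u = of_nat n" if "n \<ge> m + 2" for n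
          using u01 that by (auto simp: field_simps)
        then show ?thesis by (auto simp: image_iff)
      qed
      finally show ?thesis using u y by (auto simp: S_def)
    qed
    have "{u \<in> ldom B. orb (line B u) \<in> - C m} = (ldom B \<inter> (\<lambda>u. u / (1 - u)) -` (- ?N)) \<inter> S"
      using iff by blast
    then show ?thesis unfolding line_open_def using op by (simp only:)
  qed
  \<comment> \<open>A geodesic meeting \<open>C m\<close> is conjugate to the given one by
    \<open>same_edge\<close>, so \<open>lo\<close> can be transported; every other geodesic avoids
    \<open>C m\<close>.\<close>
  have "closedin (X_top G) (C m)" for m
  proof (rule closed_criterion[OF CXR])
    fix g' assume g': "g' \<in> adm"
    show "\<exists>B'. refl_axis g' B' \<and> line_open (\<lambda>z. orb z \<notin> C m) B'"
    proof (cases "\<exists>w\<in>Cset G c g'. orb w \<in> C m")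
      case True
      then obtain w n where w: "w \<in> Cset G c g'" "n \<ge> m + 2" "orb (axis_pt B (of_nat n)) = orb w"
        by (auto simp: C_def)
      have n: "0 < real n" "n \<ge> 2" using w by auto
      have "c (g (axis_pt B (of_nat n))) = axis_pt B (of_nat n)" using nu_line[OF ax] pt_line n by metis
      then obtain d where "d \<in> G" "c \<circ> g' = d \<circ> (c \<circ> g) \<circ> inv d"
        using same_edge[OF g g' pt_uhp[OF B n(1)] _ _ w(3) nh[OF n(2)]] w(1) Cset_iff by blast
      from line_open_transport[OF ax this lo] show ?thesis by simp
    next
      case False
      obtain B' where B': "refl_axis g' B'" using ex_axis g' by blast
      then have "{u \<in> ldom B'. orb (line B' u) \<notin> C m} = ldom B'" using False Cset_line[OF B'] by auto
      then have "line_open (\<lambda>z. orb z \<notin> C m) B'" by (simp add: line_open_def)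
      then show ?thesis using B' by blast
    qed
  qed
  moreover have "C m \<noteq> {}" for m by (simp add: C_def)
  moreover have "decseq C" by (auto simp: decseq_def C_def)
  \<comment> \<open>A point common to all tails would be the orbit of two different integer
    heights.\<close>
  ultimately have "(\<Inter>m. C m) \<noteq> {}" using compact_space_imp_nest[OF comp] by blast
  then obtain Q where Q: "\<And>m. Q \<in> C m" by blast
  have ex: "\<exists>n\<ge>m + 2. Q = orb (axis_pt B (of_nat n))" for m using Q[of m] by (force simp: C_def)
  obtain n where n: "n \<ge> 2" "Q = orb (axis_pt B (of_nat n))" using ex[of 0] by (metis add_0)
  obtain n' where n': "n' \<ge> n + 1 + 2" "Q = orb (axis_pt B (of_nat n'))" using ex[of "n + 1"] by blast
  have "real n = of_nat n' \<or> real n = 1 / of_nat n'" using equiv[of "of_nat n" n'] n n' by auto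
  then show False
  proof
    assume "real n = 1 / of_nat n'"
    then have "real n * real n' = 1" using n' by (simp add: field_simps)
    then have "n * n' = 1" by (metis of_nat_1 of_nat_eq_iff of_nat_mult)
    then show False using n by simp
  qed (use n' in simp)
qed

end

section \<open>Parametrising the edges\<close>

text \<open>The logistic function: the parameter of the point at height \<open>exp x\<close>. In the
  coordinate \<open>x\<close> dilations act as translations and half-turns as point
  reflections.\<close>

definition expu :: "real \<Rightarrow> real" where
  "expu x = exp x / (1 + exp x)"

lemma expu_bounds: "0 < expu x" "expu x < 1"
  by (simp_all add: expu_def add_pos_pos)

lemma continuous_on_expu: "continuous_on S f \<Longrightarrow> continuous_on S (\<lambda>x. expu (f x))"
  unfolding expu_def by (intro continuous_intros) (auto simp: add_nonneg_eq_0_iff)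

lemma line_expu: "line B (expu x) = axis_pt B (exp x)"
  by (simp add: expu_def pt_line)

lemma pt_exp_line: "0 < u \<Longrightarrow> u < 1 \<Longrightarrow> axis_pt B (exp (ln (u / (1 - u)))) = line B u"
  by (simp add: line_pt)

context real_fuchsian_group begin

lemma mats_mm_right:
  assumes B: "B \<in> SL2" and J: "J \<in> SL2" and M: "M \<in> SL2"
  shows "M \<in> mats (mmul B J) \<longleftrightarrow> mmul (mmul J M) (madj J) \<in> mats B"
proof -
  let ?K = "mmul (mmul J M) (madj J)"
  have K: "?K \<in> SL2" using J M by (intro SL2_mmul SL2_madj)
  have Kw: "mob ?K w = mob J (mob M (mob (madj J) w))" for w
    using J M by (simp add: mob_mmul SL2_det SL2_mmul SL2_madj)
  have Bw: "mob (mmul B J) w = mob B (mob J w)" for w using B J by (simp add: mob_mmul SL2_det)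
  have "g \<circ> mob (mmul B J) = mob (mmul B J) \<circ> mob M \<longleftrightarrow> g \<circ> mob B = mob B \<circ> mob ?K" for g
  proof
    assume "g \<circ> mob (mmul B J) = mob (mmul B J) \<circ> mob M"
    then have "g (mob (mmul B J) w) = mob (mmul B J) (mob M w)" for w by (metis comp_apply)
    then have "g (mob B w) = mob B (mob ?K w)" for w
      unfolding Bw Kw using J by (metis mob_madj_eq(1))
    then show "g \<circ> mob B = mob B \<circ> mob ?K" by auto
  next
    assume "g \<circ> mob B = mob B \<circ> mob ?K"
    then have "g (mob B w) = mob B (mob ?K w)" for w by (metis comp_apply)
    then show "g \<circ> mob (mmul B J) = mob (mmul B J) \<circ> mob M" using J by (auto simp: Bw Kw)
  qed
  then show ?thesis using K M by (simp add: mats_def)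
qed

lemma dilations_flip: "B \<in> SL2 \<Longrightarrow> l \<in> dilations (flip B) \<longleftrightarrow> 1 / l \<in> dilations B"
  using mats_mm_right[of B "(0,-1,1,0)" "(l,0,0,1/l)"] by (auto simp: dilations_def flip_def)

lemma turn_points_flip: "B \<in> SL2 \<Longrightarrow> f \<in> turn_points (flip B) \<longleftrightarrow> 1 / f \<in> turn_points B"
  using mats_mm_right[of B "(0,-1,1,0)" "(0,f,-1/f,0)"] by (auto simp: turn_points_def flip_def)

text \<open>A cusp at infinity would bring a translation that
  \<open>translation_not_contracted\<close> forbids beside a nontrivial dilation; the end 0 follows
  by \<open>flip\<close>.\<close>

lemma no_cusp_ends:
  assumes B: "B \<in> SL2" and L: "dilations B \<noteq> {1}"
  shows "ldom B = {0<..<1}"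
proof -
  have *: "1 \<notin> ldom B" if B: "B \<in> SL2" and L: "dilations B \<noteq> {1}" for B
  proof
    assume "1 \<in> ldom B"
    then have "mob B Inf \<in> cusps G" using ldom_1[OF B] by (simp add: line_def)
    then obtain \<tau> where "\<tau> \<noteq> 0" "(1,\<tau>,0,1) \<in> mats B" using cusp_translation[OF B] by blast
    then have "l = 1" if "l \<in> dilations B" for l
      using translation_not_contracted[OF B] that by (simp add: dilations_def)
    then show False using L dilations_one by blast
  qed
  obtain l where "l \<in> dilations B" "l \<noteq> 1" using L dilations_one by blast
  then have "1 / l \<in> dilations (flip B)" "1 / l \<noteq> 1" using dilations_flip[OF B] dilations_pos by auto
  then have "dilations (flip B) \<noteq> {1}" by blast
  then have "0 \<notin> ldom B" "1 \<notin> ldom B" using *[OF flip_SL2[OF B]] *[OF B L] ldom_flip[OF B, of 1] by auto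
  moreover have "ldom B \<subseteq> {0..1}" by (auto simp: ldom_def)
  ultimately have "ldom B \<subseteq> {0<..<1}" by (force simp: less_le)
  then show ?thesis using ldom_open[OF B] by auto
qed

lemma cusp_ends:
  assumes comp: "compact_space (X_top G)" and g: "g \<in> adm" and ax: "refl_axis g B"
    and L: "dilations B = {1}" and F: "turn_points B \<subseteq> {1}"
  shows "ldom B = {0..1}"
proof -
  have B: "B \<in> SL2" using ax axisD by blast
  have "dilations (flip B) = {1}"
  proof -
    have "l = 1" if "l \<in> dilations (flip B)" for l
      using that dilations_flip[OF B, of l] L by simp
    then show ?thesis using dilations_one by blast
  qed
  moreover have "turn_points (flip B) \<subseteq> {1}" using turn_points_flip[OF B] F by fastforce
  ultimately have "1 \<in> ldom (flip B)" using end_is_cusp[OF comp g axis_flip[OF ax]] by blast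
  then have "0 \<in> ldom B" using ldom_flip[OF B] by simp
  moreover have "1 \<in> ldom B" using end_is_cusp[OF comp g ax L F] .
  ultimately show ?thesis using ldom_open[OF B]
    by (auto simp: less_le) (auto simp: ldom_def)
qed

lemma special_pt:
  assumes g: "g \<in> adm" and ax: "refl_axis g B" and y: "y > 0"
  shows "orb (axis_pt B y) \<in> special \<longleftrightarrow> y \<in> turn_points B"
  using special_iff[OF pt_uhp pt_XR] half_turn_pt axisD(1)[OF ax] assms by blast

lemma special_end:
  assumes g: "g \<in> adm" and ax: "refl_axis g B" and u: "u \<in> ldom B" "u = 0 \<or> u = 1"
  shows "orb (line B u) \<in> special"
proof -
  have "line B u \<in> cusps G" using u ldom_0 ldom_1 axisD(1)[OF ax] by blast
  then show ?thesis using line_XR[OF g ax u(1)] by (auto simp: special_pts_def)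
qed

lemma line_preimage_open:
  assumes g: "g \<in> adm" and ax: "refl_axis g B" and U: "openin (XR_top G c) U"
  shows "line_open (\<lambda>z. orb z \<in> U) B"
proof -
  have B: "B \<in> SL2" using ax axisD by blast
  obtain V where V: "openin (X_top G) V" "U = V \<inter> XR G c"
    using U by (auto simp: XR_top_def openin_subtopology)
  have "openin (top_of_set (ldom B)) {u \<in> ldom B. line B u \<in> {z \<in> hstar G. orb z \<in> V}}"
    using V(1) unfolding openin_X by (intro line_continuous[OF B]) blast
  moreover have "{u \<in> ldom B. line B u \<in> {z \<in> hstar G. orb z \<in> V}} = {u \<in> ldom B. orb (line B u) \<in> U}"
    using line_XR[OF g ax] V(2) by (auto simp: ldom_def)
  ultimately show ?thesis by (simp add: line_open_def)
qed

text \<open>The last two clauses together say that the topology of the real locus restricted to the edge is the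
  quotient topology from the unit interval.\<close>
definition edge_path :: "(hpt \<Rightarrow> hpt) \<Rightarrow> (real \<Rightarrow> hpt set) \<Rightarrow> bool" where
  "edge_path g p \<longleftrightarrow>
     p ` {0..1} = Cimg G c g \<and>
     (\<forall>t\<in>{0<..<1}. p t \<notin> special) \<and> inj_on p {0<..<1} \<and>
     ((p 0 \<in> special \<and> p 1 \<in> special) \<or>
      (p 0 = p 1 \<and> p 0 \<notin> special \<and> p 0 \<notin> p ` {0<..<1})) \<and>
     (\<forall>U. openin (XR_top G c) U \<longrightarrow> openin (top_of_set {0..1}) {t \<in> {0..1}. p t \<in> U}) \<and>
     (\<forall>U. openin (top_of_set {0..1}) {t \<in> {0..1}. p t \<in> U} \<longrightarrow>
        (\<exists>B. refl_axis g B \<and> line_open (\<lambda>z. orb z \<in> U) B))"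

lemma edge_pathD:
  assumes "edge_path g p"
  shows edge_path_image: "p ` {0..1} = Cimg G c g"
    and edge_path_nonspecial: "t \<in> {0<..<1} \<Longrightarrow> p t \<notin> special"
    and edge_path_inj: "inj_on p {0<..<1}"
    and edge_path_ends: "(p 0 \<in> special \<and> p 1 \<in> special) \<or>
      (p 0 = p 1 \<and> p 0 \<notin> special \<and> p 0 \<notin> p ` {0<..<1})"
    and edge_path_preimage: "openin (XR_top G c) U \<Longrightarrow> openin (top_of_set {0..1}) {t \<in> {0..1}. p t \<in> U}"
    and edge_path_line_open: "openin (top_of_set {0..1}) {t \<in> {0..1}. p t \<in> U} \<Longrightarrow>
      \<exists>B. refl_axis g B \<and> line_open (\<lambda>z. orb z \<in> U) B"
  using assms by (simp_all add: edge_path_def)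

lemma path_preimage_open:
  assumes g: "g \<in> adm" and ax: "refl_axis g B" and \<psi>: "continuous_on {0..1} \<psi>" "\<psi> ` {0..1} \<subseteq> ldom B"
    and U: "openin (XR_top G c) U"
  shows "openin (top_of_set {0..1}) {t \<in> {0..1}. orb (line B (\<psi> t)) \<in> U}"
proof -
  have "openin (top_of_set {0..1}) ({0..1} \<inter> \<psi> -` {u \<in> ldom B. orb (line B u) \<in> U})"
    using line_preimage_open[OF g ax U] \<psi> unfolding line_open_def
    by (intro continuous_openin_preimage[OF \<psi>(1)]) auto
  moreover have "{0..1} \<inter> \<psi> -` {u \<in> ldom B. orb (line B u) \<in> U} = {t \<in> {0..1}. orb (line B (\<psi> t)) \<in> U}"
    using \<psi>(2) by auto
  ultimately show ?thesis by simp
qed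

text \<open>\<open>\<psi>\<close> runs through a fundamental interval and the fold
  \<open>\<rho>\<close> sends each parameter to an equivalent one there. Pulling back along
  \<open>\<psi>\<close> gives continuity of the path, pulling back along \<open>\<rho>\<close> gives
  openness along the whole geodesic. Serves every edge that has special ends.\<close>

lemma edge_path_fold:
  assumes g: "g \<in> adm" and ax: "refl_axis g B" and \<psi>: "continuous_on {0..1} \<psi>" "\<psi> ` {0..1} \<subseteq> ldom B"
    and \<rho>: "continuous_on (ldom B) \<rho>" "\<rho> ` ldom B \<subseteq> {0..1}"
    and fold: "\<And>u. u \<in> ldom B \<Longrightarrow> orb (line B (\<psi> (\<rho> u))) = orb (line B u)"
    and ns: "\<And>t. 0 < t \<Longrightarrow> t < 1 \<Longrightarrow> orb (line B (\<psi> t)) \<notin> special"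
    and inj: "inj_on (\<lambda>t. orb (line B (\<psi> t))) {0<..<1}"
    and ends: "orb (line B (\<psi> 0)) \<in> special" "orb (line B (\<psi> 1)) \<in> special"
  shows "edge_path g (\<lambda>t. orb (line B (\<psi> t)))"
proof -
  have im: "(\<lambda>t. orb (line B (\<psi> t))) ` {0..1} = Cimg G c g"
  proof
    show "(\<lambda>t. orb (line B (\<psi> t))) ` {0..1} \<subseteq> Cimg G c g"
      using \<psi>(2) unfolding Cimg_def Cset_line[OF ax] by blast
    show "Cimg G c g \<subseteq> (\<lambda>t. orb (line B (\<psi> t))) ` {0..1}"
    proof
      fix Q assume "Q \<in> Cimg G c g"
      then obtain u where u: "u \<in> ldom B" "Q = orb (line B u)" unfolding Cimg_def Cset_line[OF ax] by blast
      then show "Q \<in> (\<lambda>t. orb (line B (\<psi> t))) ` {0..1}"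
        using fold[OF u(1)] \<rho>(2) by (intro image_eqI[of _ _ "\<rho> u"]) auto
    qed
  qed
  have op: "line_open (\<lambda>z. orb z \<in> U) B" if U: "openin (top_of_set {0..1}) {t \<in> {0..1}. orb (line B (\<psi> t)) \<in> U}" for U
  proof -
    have "openin (top_of_set (ldom B)) (ldom B \<inter> \<rho> -` {t \<in> {0..1}. orb (line B (\<psi> t)) \<in> U})"
      using U \<rho> by (intro continuous_openin_preimage[OF \<rho>(1)]) auto
    moreover have "ldom B \<inter> \<rho> -` {t \<in> {0..1}. orb (line B (\<psi> t)) \<in> U} = {u \<in> ldom B. orb (line B u) \<in> U}"
      using fold \<rho>(2) by auto
    ultimately show ?thesis by (simp add: line_open_def)
  qed
  show ?thesis
    unfolding edge_path_def
  proof (intro conjI allI impI ballI disjI1 exI[of _ B])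
    show "orb (line B (\<psi> t)) \<notin> special" if "t \<in> {0<..<1}" for t using ns that by simp
  qed (use im inj ends ax path_preimage_open[OF g ax \<psi>] op in blast)+
qed

text \<open>No two interior points are equivalent, so the whole geodesic with its two cusps is the
  fundamental interval.\<close>

lemma edge_path_cusp_cusp:
  assumes comp: "compact_space (X_top G)" and g: "g \<in> adm" and ax: "refl_axis g B"
    and L: "dilations B = {1}" and F: "turn_points B = {}"
  shows "\<exists>p. edge_path g p"
proof -
  have B: "B \<in> SL2" using ax axisD by blast
  have d: "ldom B = {0..1}" using cusp_ends[OF comp g ax L] F by simp
  have ns: "orb (line B t) \<notin> special" if "0 < t" "t < 1" for t
    using special_pt[OF g ax, of "t / (1 - t)"] F that by (simp add: line_pt)
  have "edge_path g (\<lambda>t. orb (line B (id t)))"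
  proof (rule edge_path_fold[OF g ax, where \<rho> = id])
    show "inj_on (\<lambda>t. orb (line B (id t))) {0<..<1}"
    proof (rule inj_onI)
      fix t t' :: real assume t: "t \<in> {0<..<1}" "t' \<in> {0<..<1}" "orb (line B (id t)) = orb (line B (id t'))"
      then have "\<not> half_turn (axis_pt B (t / (1 - t)))" using half_turn_pt[OF B] F by simp
      then have "t' / (1 - t') = t / (1 - t)"
        using pt_equiv[OF g ax, of "t / (1 - t)" "t' / (1 - t')"] t L F by (simp add: line_pt)
      then show "t = t'" using t by (simp add: field_simps)
    qed
  qed (use ns special_end[OF g ax] d in auto)
  then show ?thesis by blast
qed

text \<open>The half-turn about height 1 is \<open>u\<close> to \<open>1 - u\<close>. The
  fundamental interval is the half from 1/2 to 1, leading from the turn point to the cusp, and the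
  fold takes the larger of \<open>u\<close> and \<open>1 - u\<close>.\<close>

lemma edge_path_turn_cusp:
  assumes comp: "compact_space (X_top G)" and g: "g \<in> adm" and ax: "refl_axis g B"
    and L: "dilations B = {1}" and F: "1 \<in> turn_points B"
  shows "\<exists>p. edge_path g p"
proof -
  have B: "B \<in> SL2" using ax axisD by blast
  have F1: "turn_points B = {1}" using turn_points_divide[OF _ F] L F by fastforce
  have d: "ldom B = {0..1}" using cusp_ends[OF comp g ax L] F1 by simp
  define \<psi> where "\<psi> t = (1 + t) / 2" for t :: real
  define \<rho> where "\<rho> u = 2 * max u (1 - u) - 1" for u :: real
  have y: "\<psi> t / (1 - \<psi> t) > 1" "0 < \<psi> t" "\<psi> t < 1" if "0 < t" "t < 1" for t
    using that by (auto simp: \<psi>_def field_simps)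
  have sym: "orb (line B (1 - u)) = orb (line B u)" if u: "u \<in> {0..1}" for u
  proof -
    consider "u = 0" | "u = 1" | "u \<noteq> 0" "u \<noteq> 1" by blast
    then show ?thesis
    proof cases
      case 3
      then have "orb (axis_pt B (1\<^sup>2 / (u / (1 - u)))) = orb (axis_pt B (u / (1 - u)))"
        by (intro turn_points_orbit F) auto
      then show ?thesis using 3 by (simp add: line_pt)
    qed (use turn_points_ends[OF F] in \<open>simp_all add: line_pt\<close>, simp_all add: line_def)
  qed
  have "edge_path g (\<lambda>t. orb (line B (\<psi> t)))"
  proof (rule edge_path_fold[OF g ax, where \<rho> = \<rho>])
    show "continuous_on {0..1} \<psi>" unfolding \<psi>_def by (intro continuous_intros) auto
    show "\<psi> ` {0..1} \<subseteq> ldom B" by (auto simp: \<psi>_def d)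
    show "continuous_on (ldom B) \<rho>" unfolding \<rho>_def by (intro continuous_intros)
    show "\<rho> ` ldom B \<subseteq> {0..1}" by (auto simp: \<rho>_def d max_def)
    show "orb (line B (\<psi> (\<rho> u))) = orb (line B u)" if "u \<in> ldom B" for u
      using sym[of u] that d by (simp add: \<psi>_def \<rho>_def max_def)
    show "orb (line B (\<psi> t)) \<notin> special" if "0 < t" "t < 1" for t
      using special_pt[OF g ax, of "\<psi> t / (1 - \<psi> t)"] F1 y[OF that] by (simp add: line_pt)
    show "inj_on (\<lambda>t. orb (line B (\<psi> t))) {0<..<1}"
    proof (rule inj_onI)
      fix t t' :: real assume t: "t \<in> {0<..<1}" "t' \<in> {0<..<1}" "orb (line B (\<psi> t)) = orb (line B (\<psi> t'))"
      let ?y = "\<psi> t / (1 - \<psi> t)" and ?y' = "\<psi> t' / (1 - \<psi> t')"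
      have yy: "?y > 1" "?y' > 1" "\<psi> t < 1" "\<psi> t' < 1" using y t by auto
      have "\<not> half_turn (axis_pt B ?y)" using half_turn_pt[OF B, of ?y] yy F1 by simp
      then have "?y' = ?y \<or> ?y' = 1 / ?y"
        using pt_equiv[OF g ax, of ?y ?y'] yy t(3) L F1 by (simp add: line_pt)
      moreover have "1 / z < 1" if "z > 1" for z :: real using that by simp
      from this[OF yy(1)] have "1 / ?y < 1" .
      ultimately have "?y' = ?y" using yy by linarith
      then have "\<psi> t = \<psi> t'" using yy by (simp add: field_simps)
      then show "t = t'" by (simp add: \<psi>_def)
    qed
    show "orb (line B (\<psi> 0)) \<in> special"
      using special_pt[OF g ax, of 1] F by (simp add: line_pt \<psi>_def)
    show "orb (line B (\<psi> 1)) \<in> special"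
      using special_end[OF g ax, of 1] d by (simp add: \<psi>_def)
  qed
  then show ?thesis by blast
qed

text \<open>\<open>pt_equiv\<close> in the logarithmic coordinate; the period is
  \<open>2 * L\<close> because a dilation \<open>l\<close> acts by \<open>l\<^sup>2\<close>.\<close>

lemma pt_exp_equiv:
  assumes g: "g \<in> adm" and ax: "refl_axis g B" and cyc: "dilations B = range (\<lambda>k::int. exp (of_int k * L))"
    and F: "turn_points B \<subseteq> dilations B" and nF: "exp x \<notin> turn_points B" and eq: "orb (axis_pt B (exp x)) = orb (axis_pt B (exp x'))"
  obtains k :: int where "x' = of_int k * (2 * L) + x" | k :: int where "x' = of_int k * (2 * L) - x" "turn_points B \<noteq> {}"
proof -
  have sq: "(exp (of_int k * L))\<^sup>2 = exp (of_int k * (2 * L))" for k :: int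
    by (simp add: exp_double[symmetric] mult.left_commute)
  have "\<not> half_turn (axis_pt B (exp x))" using half_turn_pt[OF axisD(1)[OF ax], of "exp x"] nF by simp
  then have "(\<exists>l\<in>dilations B. exp x' = l\<^sup>2 * exp x) \<or> (\<exists>f\<in>turn_points B. exp x' = f\<^sup>2 / exp x)"
    using pt_equiv[OF g ax, of "exp x" "exp x'"] eq by simp
  then consider k :: int where "exp x' = exp (of_int k * (2 * L)) * exp x"
    | k :: int where "exp x' = exp (of_int k * (2 * L)) / exp x" "turn_points B \<noteq> {}"
    using F unfolding cyc by (force simp: sq)
  then show ?thesis
  proof cases
    case (1 k)
    then show ?thesis using that(1)[of k] by (simp only: exp_add[symmetric] exp_inj_iff)
  next
    case (2 k)
    then show ?thesis using that(2)[of k] unfolding exp_diff[symmetric] exp_inj_iff by blast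
  qed
qed

text \<open>The infinite dihedral case: in the logarithmic coordinate the half-turns are the point
  reflections at the multiples of \<open>L\<close>, so the interval from 0 to \<open>L\<close> is
  fundamental and joins two turn points.\<close>

lemma edge_path_turn_turn:
  assumes g: "g \<in> adm" and ax: "refl_axis g B"
    and nt: "dilations B \<noteq> {1}" and F: "1 \<in> turn_points B"
  shows "\<exists>p. edge_path g p"
proof -
  have B: "B \<in> SL2" using ax axisD by blast
  have d: "ldom B = {0<..<1}" using no_cusp_ends[OF B nt] .
  obtain L where L: "L > 0" and cyc: "dilations B = range (\<lambda>k::int. exp (of_int k * L))"
    using dilations_cyclic[OF B nt] by blast
  have Lk: "\<exists>k::int. ln l = of_int k * L" if "l \<in> dilations B" for l
    using that unfolding cyc by auto
  have Lamk: "exp (of_int k * L) \<in> dilations B" for k :: int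
    unfolding cyc by blast
  \<comment> \<open>A dilation times the half-turn about 1 is a half-turn, and two half-turns differ
    by a dilation; with 1 a turn point both sets coincide.\<close>
  have FL: "f \<in> turn_points B \<longleftrightarrow> f \<in> dilations B" for f using turn_points_divide[OF _ F] dilations_turn_points[OF _ F] by fastforce
  define \<psi> where "\<psi> t = expu (L * t)" for t
  \<comment> \<open>\<open>arccos \<circ> cos\<close> is a triangle wave: it folds the line onto a fundamental interval.\<close>
  define \<rho> where "\<rho> u = arccos (cos (pi * ln (u / (1 - u)) / L)) / pi" for u
  have l\<psi>: "line B (\<psi> t) = axis_pt B (exp (L * t))" for t by (simp add: \<psi>_def line_expu)
  have notF: "exp (L * t) \<notin> turn_points B" if "0 < t" "t < 1" for t
  proof
    assume "exp (L * t) \<in> turn_points B"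
    then obtain k :: int where "ln (exp (L * t)) = of_int k * L" using Lk FL by blast
    then have "t = of_int k" using L by simp
    then have "0 < k" "k < 1" using that by simp_all
    then show False by simp
  qed
  have "edge_path g (\<lambda>t. orb (line B (\<psi> t)))"
  proof (rule edge_path_fold[OF g ax, where \<rho> = \<rho>])
    show "continuous_on {0..1} \<psi>" unfolding \<psi>_def by (intro continuous_on_expu continuous_intros)
    show "\<psi> ` {0..1} \<subseteq> ldom B" using expu_bounds by (auto simp: \<psi>_def d)
    show "continuous_on (ldom B) \<rho>" unfolding \<rho>_def d using L by (intro continuous_intros) auto
    show "\<rho> ` ldom B \<subseteq> {0..1}" by (auto simp: \<rho>_def arccos_lbound arccos_ubound)
    show "orb (line B (\<psi> (\<rho> u))) = orb (line B u)" if u: "u \<in> ldom B" for u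
    proof -
      have u01: "0 < u" "u < 1" using u d by auto
      define x where "x = ln (u / (1 - u))"
      have lu: "line B u = axis_pt B (exp x)" using u01 by (simp add: x_def line_pt)
      have "cos (pi * x / L) = cos (arccos (cos (pi * x / L)))" by simp
      also have "arccos (cos (pi * x / L)) = pi * \<rho> u" by (simp add: \<rho>_def x_def)
      finally obtain n where n: "n \<in> \<int>" "pi * x / L = pi * \<rho> u + 2 * n * pi \<or> pi * x / L = - (pi * \<rho> u) + 2 * n * pi"
        unfolding cos_eq by blast
      then obtain k :: int where k: "n = of_int k" by (auto elim: Ints_cases)
      have "x / L = \<rho> u + 2 * n \<or> x / L = - \<rho> u + 2 * n"
        using n(2)
      proof (elim disjE)
        assume "pi * x / L = pi * \<rho> u + 2 * n * pi"
        then have "pi * (x / L) = pi * (\<rho> u + 2 * n)" by (simp add: algebra_simps)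
        then have "x / L = \<rho> u + 2 * n" unfolding mult_cancel_left using pi_neq_zero by blast
        then show ?thesis ..
      next
        assume "pi * x / L = - (pi * \<rho> u) + 2 * n * pi"
        then have "pi * (x / L) = pi * (- \<rho> u + 2 * n)" by (simp add: algebra_simps)
        then have "x / L = - \<rho> u + 2 * n" unfolding mult_cancel_left using pi_neq_zero by blast
        then show ?thesis ..
      qed
      then have x: "x = 2 * (of_int k * L) + L * \<rho> u \<or> x = 2 * (of_int k * L) - L * \<rho> u"
        using L k by (simp add: field_simps)
      then have "exp x = (exp (of_int k * L))\<^sup>2 * exp (L * \<rho> u) \<or> exp x = (exp (of_int k * L))\<^sup>2 / exp (L * \<rho> u)"
        unfolding exp_double[symmetric] exp_add[symmetric] exp_diff[symmetric] by auto
      then show ?thesis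
        unfolding l\<psi> lu using dilations_orbit[OF Lamk[of k]] turn_points_orbit[of "exp (of_int k * L)" B "exp (L * \<rho> u)"] Lamk FL by auto
    qed
    show "orb (line B (\<psi> t)) \<notin> special" if "0 < t" "t < 1" for t
      unfolding l\<psi> using special_pt[OF g ax, of "exp (L * t)"] notF[OF that] by simp
    show "inj_on (\<lambda>t. orb (line B (\<psi> t))) {0<..<1}"
    proof (rule inj_onI)
      fix t t' :: real assume t: "t \<in> {0<..<1}" "t' \<in> {0<..<1}" "orb (line B (\<psi> t)) = orb (line B (\<psi> t'))"
      have eq: "orb (axis_pt B (exp (L * t))) = orb (axis_pt B (exp (L * t')))" using t(3) by (simp only: l\<psi>)
      have sub: "turn_points B \<subseteq> dilations B" using FL by blast
      have "exp (L * t) \<notin> turn_points B" using notF t(1) by simp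
      from g ax cyc sub this eq show "t = t'"
      proof (cases rule: pt_exp_equiv)
        case (1 k)
        then have "L * t' = L * (2 * of_int k + t)" by (simp add: algebra_simps)
        then have "t' = 2 * of_int k + t" using L by simp
        moreover have "k = 0" using calculation t by auto
        ultimately show ?thesis by simp
      next
        case (2 k)
        then have "L * t' = L * (2 * of_int k - t)" by (simp add: algebra_simps)
        then have "t' = 2 * of_int k - t" using L by simp
        then have "0 < 2 * real_of_int k" "2 * real_of_int k < 2" using t by auto
        then have "0 < k" "k < 1" by simp_all
        then show ?thesis by simp
      qed
    qed
    show "orb (line B (\<psi> 0)) \<in> special"
      unfolding l\<psi> using special_pt[OF g ax, of 1] F by simp
    show "orb (line B (\<psi> 1)) \<in> special"
      unfolding l\<psi> using special_pt[OF g ax, of "exp (L * 1)"] FL Lamk[of 1] by simp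
  qed
  then show ?thesis by blast
qed

text \<open>The stabiliser acts as translations by multiples of \<open>2 * L\<close>. A continuous
  fold onto one period cannot exist, so openness is pulled back along the periodic map
  \<open>p\<close> on the whole real line.\<close>

lemma edge_path_circle:
  assumes g: "g \<in> adm" and ax: "refl_axis g B"
    and nt: "dilations B \<noteq> {1}" and F: "turn_points B = {}"
  shows "\<exists>p. edge_path g p"
proof -
  have B: "B \<in> SL2" using ax axisD by blast
  have d: "ldom B = {0<..<1}" using no_cusp_ends[OF B nt] .
  obtain L where L: "L > 0" and cyc: "dilations B = range (\<lambda>k::int. exp (of_int k * L))"
    using dilations_cyclic[OF B nt] by blast
  have Lamk: "exp (of_int k * L) \<in> dilations B" for k :: int
    unfolding cyc by blast
  define \<psi> where "\<psi> t = expu (2 * L * t)" for t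
  define p where "p t = orb (line B (\<psi> t))" for t
  have l\<psi>: "line B (\<psi> t) = axis_pt B (exp (2 * L * t))" for t by (simp add: \<psi>_def line_expu)
  have per: "p (of_int k + t) = p t" for k :: int and t
  proof -
    have "exp (2 * L * (of_int k + t)) = (exp (of_int k * L))\<^sup>2 * exp (2 * L * t)"
      unfolding exp_double[symmetric] exp_add[symmetric] by (simp add: algebra_simps)
    then show ?thesis unfolding p_def l\<psi> using dilations_orbit[OF Lamk[of k]] by simp
  qed
  have eq: "\<exists>k::int. t' = of_int k + t" if ptt: "p t = p t'" for t t'
  proof -
    have eq: "orb (axis_pt B (exp (2 * L * t))) = orb (axis_pt B (exp (2 * L * t')))"
      using ptt by (simp only: p_def l\<psi>)
    have "turn_points B \<subseteq> dilations B" "exp (2 * L * t) \<notin> turn_points B" using F by auto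
    from g ax cyc this eq show ?thesis
    proof (cases rule: pt_exp_equiv)
      case (1 k)
      then have "2 * L * t' = 2 * L * (of_int k + t)" by (simp add: algebra_simps)
      then show ?thesis using L by auto
    qed (use F in simp)
  qed
  have ns: "p t \<notin> special" for t
    unfolding p_def l\<psi> using special_pt[OF g ax, of "exp (2 * L * t)"] F by simp
  have lp: "orb (line B u) = p (ln (u / (1 - u)) / (2 * L))" if "u \<in> ldom B" for u
    using that d L pt_exp_line[of u B] by (simp add: p_def l\<psi>)
  have unit: "\<exists>t\<in>{0..1}. \<exists>k::int. x = of_int k + t" for x :: real
    by (intro bexI[of _ "frac x"] exI[of _ "\<lfloor>x\<rfloor>"]) (auto simp: frac_def less_imp_le[OF frac_lt_1, unfolded frac_def])
  have c\<psi>: "continuous_on {0..1} \<psi>" "\<psi> ` {0..1} \<subseteq> ldom B"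
    using expu_bounds by (auto simp: \<psi>_def d intro!: continuous_on_expu continuous_intros)
  have "edge_path g p"
    unfolding edge_path_def
  proof (intro conjI allI impI)
    show "p ` {0..1} = Cimg G c g"
    proof
      show "p ` {0..1} \<subseteq> Cimg G c g"
        using c\<psi>(2) unfolding Cimg_def Cset_line[OF ax] p_def by blast
      show "Cimg G c g \<subseteq> p ` {0..1}"
      proof
        fix Q assume "Q \<in> Cimg G c g"
        then obtain u where u: "u \<in> ldom B" "Q = orb (line B u)" unfolding Cimg_def Cset_line[OF ax] by blast
        obtain t k where "t \<in> {0..1}" "ln (u / (1 - u)) / (2 * L) = of_int k + t" using unit by blast
        then show "Q \<in> p ` {0..1}" using u lp per by auto
      qed
    qed
    show "\<forall>t\<in>{0<..<1}. p t \<notin> special" using ns by blast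
    show "inj_on p {0<..<1}"
    proof (rule inj_onI)
      fix t t' assume t: "t \<in> {0<..<1}" "t' \<in> {0<..<1}" "p t = p t'"
      obtain k :: int where k: "t' = of_int k + t" using eq[OF t(3)] by blast
      moreover have "k = 0" using k t by auto
      ultimately show "t = t'" by simp
    qed
    have "p 0 = p 1" using per[of 1 0] by simp
    moreover have "p 0 \<notin> p ` {0<..<1}"
    proof
      assume "p 0 \<in> p ` {0<..<1}"
      then obtain t where t: "t \<in> {0<..<1}" "p 0 = p t" by blast
      then obtain k :: int where "t = of_int k" using eq[OF t(2)] by auto
      then show False using t(1) by auto
    qed
    ultimately show "p 0 \<in> special \<and> p 1 \<in> special \<or> p 0 = p 1 \<and> p 0 \<notin> special \<and> p 0 \<notin> p ` {0<..<1}"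
      using ns by blast
  next
    fix U assume "openin (XR_top G c) U"
    then show "openin (top_of_set {0..1}) {t \<in> {0..1}. p t \<in> U}"
      using path_preimage_open[OF g ax c\<psi>] by (simp add: p_def)
  next
    fix U assume U: "openin (top_of_set {0..1}) {t \<in> {0..1}. p t \<in> U}"
    have "closedin (top_of_set {0..1}) ({0..1} - {t \<in> {0..1}. p t \<in> U})"
      using U by (simp add: closedin_diff)
    then have "compact ({0..1} - {t \<in> {0..1}. p t \<in> U})"
      using closedin_compact compact_Icc by blast
    \<comment> \<open>The complement of the full preimage consists of the integer translates of a compact set.\<close>
    from compact_closed_sums[OF this closed_Ints]
    have cl: "closed (\<Union>x\<in>{0..1} - {t \<in> {0..1}. p t \<in> U}. \<Union>y\<in>\<int>. {x + y})" .
    have "(\<Union>x\<in>{0..1} - {t \<in> {0..1}. p t \<in> U}. \<Union>y\<in>\<int>. {x + y}) = - {t. p t \<in> U}"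
    proof (intro set_eqI iffI)
      fix x assume "x \<in> (\<Union>x\<in>{0..1} - {t \<in> {0..1}. p t \<in> U}. \<Union>y\<in>\<int>. {x + y})"
      then obtain t y where ty: "t \<in> {0..1}" "p t \<notin> U" "y \<in> \<int>" "x = t + y" by blast
      then obtain k where "y = of_int k" by (auto elim: Ints_cases)
      then have "x = of_int k + t" using ty by simp
      then show "x \<in> - {t. p t \<in> U}" using per ty(2) by simp
    next
      fix x assume x: "x \<in> - {t. p t \<in> U}"
      obtain t k where "t \<in> {0..1}" "x = of_int k + t" using unit by blast
      moreover then have "p t \<notin> U" using x per by simp
      ultimately show "x \<in> (\<Union>x\<in>{0..1} - {t \<in> {0..1}. p t \<in> U}. \<Union>y\<in>\<int>. {x + y})"
        by (intro UN_I[of t] UN_I[of "of_int k"]) auto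
    qed
    then have op: "open {t. p t \<in> U}" using cl by (simp add: closed_open)
    have "continuous_on (ldom B) (\<lambda>u. ln (u / (1 - u)) / (2 * L))"
      unfolding d using L by (intro continuous_intros) auto
    then have "openin (top_of_set (ldom B)) (ldom B \<inter> (\<lambda>u. ln (u / (1 - u)) / (2 * L)) -` {t. p t \<in> U})"
      using op by (rule continuous_openin_preimage_gen)
    moreover have "ldom B \<inter> (\<lambda>u. ln (u / (1 - u)) / (2 * L)) -` {t. p t \<in> U} = {u \<in> ldom B. orb (line B u) \<in> U}"
      using lp by auto
    ultimately have "line_open (\<lambda>z. orb z \<in> U) B" by (simp add: line_open_def)
    then show "\<exists>B. refl_axis g B \<and> line_open (\<lambda>z. orb z \<in> U) B" using ax by blast
  qed
  then show ?thesis by blast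
qed

lemma ex_edge_path:
  assumes comp: "compact_space (X_top G)" and g: "g \<in> adm"
  shows "\<exists>p. edge_path g p"
proof -
  obtain B where ax: "refl_axis g B" using ex_axis g by blast
  show ?thesis
  proof (cases "turn_points B = {}")
    case True
    then show ?thesis
      using edge_path_circle[OF g ax] edge_path_cusp_cusp[OF comp g ax] by blast
  next
    case False
    then obtain f where f: "f \<in> turn_points B" by blast
    have fp: "f > 0" using turn_points_pos f .
    \<comment> \<open>Rescaling puts the turn point \<open>f\<close> at height 1, the normalisation
      used by the two cases with a turn point.\<close>
    let ?D = "(sqrt f, 0, 0, 1 / sqrt f)"
    let ?B = "mmul B ?D"
    have B: "B \<in> SL2" using ax axisD by blast
    have D: "?D \<in> SL2" using fp by simp
    have ax': "refl_axis g ?B" using axis_scale[OF ax, of "sqrt f"] fp by simp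
    have B': "?B \<in> SL2" using ax' axisD by blast
    have "mob ?B (Pt (Complex 0 1)) = mob B (mob ?D (Pt (Complex 0 1)))"
      using mob_mmul[OF SL2_det[OF B] SL2_det[OF D]] by simp
    also have "mob ?D (Pt (Complex 0 1)) = Pt (Complex 0 f)"
      using mob_diag_pt[of "1 / sqrt f" "sqrt f" 1] fp by simp
    finally have "axis_pt ?B 1 = axis_pt B f" by (simp add: axis_pt_def)
    then have "1 \<in> turn_points ?B" using half_turn_pt[OF B fp] half_turn_pt[OF B', of 1] f by simp
    then show ?thesis
      using edge_path_turn_turn[OF g ax'] edge_path_turn_cusp[OF comp g ax'] by blast
  qed
qed

end

section \<open>The homeomorphism\<close>

lemma openin_pre: "openin (pre_top V E) U \<longleftrightarrow> pre_open V E U"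
  by (simp add: pre_top_def topology_inverse' istopology_pre)

lemma topspace_pre: "topspace (pre_top V E) = Inl ` V \<union> Inr ` (E \<times> {0..1})"
proof -
  have "{t. Inr (e, t) \<in> Inl ` V \<union> Inr ` (E \<times> {0..1::real})} = {0..1}" if "e \<in> E" for e using that by auto
  then have "openin (pre_top V E) (Inl ` V \<union> Inr ` (E \<times> {0..1}))"
    by (simp add: openin_pre pre_open_def)
  moreover have "U \<subseteq> Inl ` V \<union> Inr ` (E \<times> {0..1})" if "openin (pre_top V E) U" for U
    using that by (simp add: openin_pre pre_open_def)
  ultimately show ?thesis by (metis openin_subset openin_topspace subset_antisym)
qed

lemma topspace_graph: "topspace (graph_top V E ends) = glue ends ` (Inl ` V \<union> Inr ` (E \<times> {0..1}))"
  by (simp add: graph_top_def topspace_quot topspace_pre)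

lemma glue_in_graph: "e \<in> E \<Longrightarrow> t \<in> {0..1} \<Longrightarrow> glue ends (Inr (e, t)) \<in> topspace (graph_top V E ends)"
  by (simp add: topspace_graph)

text \<open>The vertices are open points of \<open>pre_top\<close>, so the conditions come from the
  edge intervals alone. \<open>XR_open_iff\<close> is the counterpart for the real locus.\<close>

lemma openin_graph:
  "openin (graph_top V E ends) W \<longleftrightarrow> W \<subseteq> topspace (graph_top V E ends) \<and>
    (\<forall>e\<in>E. openin (top_of_set {0..1}) {t \<in> {0..1}. glue ends (Inr (e, t)) \<in> W})"
proof -
  have "{t. Inr (e, t) \<in> {x \<in> topspace (pre_top V E). glue ends x \<in> W}} = {t \<in> {0..1}. glue ends (Inr (e, t)) \<in> W}"
    if "e \<in> E" for e using that by (auto simp: topspace_pre)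
  then show ?thesis
    unfolding graph_top_def openin_quot openin_pre pre_open_def topspace_quot
    by (auto simp: topspace_pre)
qed

lemma ends_in:
  assumes "ends e \<noteq> {}" shows "end0 ends e \<in> ends e" "end1 ends e \<in> ends e"
proof -
  show 0: "end0 ends e \<in> ends e"
    unfolding end0_def using assms by (simp add: some_in_eq)
  show "end1 ends e \<in> ends e"
  proof (cases "\<exists>w\<in>ends e. w \<noteq> end0 ends e")
    case True
    then show ?thesis unfolding end1_def using someI_ex[of "\<lambda>w. w \<in> ends e \<and> w \<noteq> end0 ends e"] by auto
  next
    case False
    then have "end1 ends e = end0 ends e" unfolding end1_def by (simp only: if_False)
    then show ?thesis using 0 by simp
  qed
qed

text \<open>In the third case \<open>GE e 0\<close> is the point where the two ends of a circle are
  glued together.\<close>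

lemma graph_cases:
  assumes "x \<in> topspace (graph_top V E ends)" and "\<And>e. e \<in> E \<Longrightarrow> ends e \<subseteq> V"
  obtains v where "x = GV v" "v \<in> V"
  | e t where "x = GE e t" "e \<in> E" "0 < t" "t < 1"
  | e where "x = GE e 0" "e \<in> E" "ends e = {}"
proof -
  from assms(1) consider v where "v \<in> V" "x = glue ends (Inl v)" | e t where "e \<in> E" "t \<in> {0..1}" "x = glue ends (Inr (e, t))"
    unfolding topspace_graph by auto
  then show ?thesis
  proof cases
    case 1
    then show ?thesis using that(1) by (simp add: glue_def)
  next
    case (2 e t)
    show ?thesis
    proof (cases "t = 0 \<or> t = 1")
      case True
      show ?thesis
      proof (cases "ends e = {}")
        case True
        then have "x = GE e 0" using 2 \<open>t = 0 \<or> t = 1\<close> by (auto simp: glue_def)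
        then show ?thesis using that(3) 2(1) True by blast
      next
        case False
        then have "x = GV (end0 ends e) \<or> x = GV (end1 ends e)" using 2 \<open>t = 0 \<or> t = 1\<close> by (auto simp: glue_def)
        then show ?thesis using that(1) ends_in[of ends, OF False] assms(2)[OF 2(1)] by blast
      qed
    next
      case False
      then show ?thesis using 2 that(2)[of e t] by (simp add: glue_def)
    qed
  qed
qed

context real_fuchsian_group begin

section \<open>Twisted classes, edges and the images of geodesics\<close>

lemma twisted_iff: "twisted_conj G c g g' \<longleftrightarrow> (\<exists>d\<in>G. c \<circ> g = d \<circ> (c \<circ> g') \<circ> inv d)"
proof -
  have "g = twist c d \<circ> g' \<circ> inv d \<longleftrightarrow> c \<circ> g = d \<circ> (c \<circ> g') \<circ> inv d" for d
  proof
    assume "g = twist c d \<circ> g' \<circ> inv d"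
    then show "c \<circ> g = d \<circ> (c \<circ> g') \<circ> inv d" by (simp add: fun_eq_iff twist_def)
  next
    assume "c \<circ> g = d \<circ> (c \<circ> g') \<circ> inv d"
    then have "c (g x) = d (c (g' (inv d x)))" for x by (metis comp_apply)
    then have "g x = c (d (c (g' (inv d x))))" for x by (metis c_c_ap)
    then show "g = twist c d \<circ> g' \<circ> inv d" by (simp add: fun_eq_iff twist_def)
  qed
  then show ?thesis by (simp add: twisted_conj_def)
qed

lemma twisted_refl: "twisted_conj G c g g"
  unfolding twisted_iff using G_id by (intro bexI[of _ id]) auto

lemma twisted_sym: "twisted_conj G c g g' \<Longrightarrow> twisted_conj G c g' g"
  unfolding twisted_iff
proof (elim bexE)
  fix d assume d: "d \<in> G" "c \<circ> g = d \<circ> (c \<circ> g') \<circ> inv d"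
  then have *: "c (g x) = d (c (g' (inv d x)))" for x by (metis comp_apply)
  have "inv (inv d) = d" using G_bij[OF d(1)] by (rule inv_inv_eq)
  then have "c \<circ> g' = inv d \<circ> (c \<circ> g) \<circ> inv (inv d)" using d(1) by (simp add: fun_eq_iff *)
  then show "\<exists>d\<in>G. c \<circ> g' = d \<circ> (c \<circ> g) \<circ> inv d" using G_inv[OF d(1)] by blast
qed

lemma twisted_trans: "twisted_conj G c g g' \<Longrightarrow> twisted_conj G c g' g'' \<Longrightarrow> twisted_conj G c g g''"
  unfolding twisted_iff
proof (elim bexE)
  fix d e assume d: "d \<in> G" "c \<circ> g = d \<circ> (c \<circ> g') \<circ> inv d" and e: "e \<in> G" "c \<circ> g' = e \<circ> (c \<circ> g'') \<circ> inv e"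
  have "c \<circ> g = (d \<circ> e) \<circ> (c \<circ> g'') \<circ> inv (d \<circ> e)"
    unfolding d(2) e(2) o_inv_distrib[OF G_bij[OF d(1)] G_bij[OF e(1)]] by (simp add: o_assoc)
  then show "\<exists>d\<in>G. c \<circ> g = d \<circ> (c \<circ> g'') \<circ> inv d" using G_comp[OF d(1) e(1)] by blast
qed

lemma tw_class_eq: "twisted_conj G c g g' \<Longrightarrow> tw_class G c g = tw_class G c g'"
  unfolding tw_class_def using twisted_sym twisted_trans by blast

lemma tw_class_eqD: "g' \<in> adm \<Longrightarrow> tw_class G c g = tw_class G c g' \<Longrightarrow> twisted_conj G c g g'"
  unfolding tw_class_def using twisted_refl by blast

lemma Cimg_twisted: "twisted_conj G c g g' \<Longrightarrow> Cimg G c g = Cimg G c g'"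
proof -
  have *: "Cimg G c g' \<subseteq> Cimg G c g" if tw: "twisted_conj G c g g'" for g g'
  proof
    fix Q assume "Q \<in> Cimg G c g'"
    then obtain z where z: "z \<in> hstar G" "c (g' z) = z" "Q = orb z" by (auto simp: Cimg_def Cset_iff)
    obtain d where d: "d \<in> G" "c \<circ> g = d \<circ> (c \<circ> g') \<circ> inv d" using tw twisted_iff by blast
    have "c (g (d z)) = d z" using fun_cong[OF d(2), of "d z"] d(1) z by simp
    then have "d z \<in> Cset G c g" using hstar_G[OF d(1)] z by (simp add: Cset_iff)
    then show "Q \<in> Cimg G c g" using orbit_eq[OF d(1)] z unfolding Cimg_def by (metis imageI)
  qed
  show "twisted_conj G c g g' \<Longrightarrow> Cimg G c g = Cimg G c g'" using *[of g g'] *[of g' g] twisted_sym by blast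
qed

lemma edge_ends_class:
  assumes "g \<in> adm" shows "edge_ends G c (tw_class G c g) = special \<inter> Cimg G c g"
proof -
  have "g \<in> tw_class G c g" using assms twisted_refl by (simp add: tw_class_def)
  then show ?thesis unfolding edge_ends_def using Cimg_twisted by (auto simp: tw_class_def)
qed

lemma Cimg_XR: "g \<in> adm \<Longrightarrow> Cimg G c g \<subseteq> XR G c"
  using Cset_XR[OF admissible_G] by (auto simp: Cimg_def)

lemma special_XR: "special \<subseteq> XR G c"
  by (auto simp: special_pts_def)

lemma nonspecial_uhp:
  assumes "z \<in> hstar G" "orb z \<in> XR G c" "orb z \<notin> special"
  shows "z \<in> uhp" "\<not> half_turn z"
proof -
  show "z \<in> uhp" using assms by (auto simp: hstar_def special_pts_def)
  then show "\<not> half_turn z" using special_iff assms by blast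
qed

text \<open>A nonspecial point lifts to a half-plane point without half-turn, where
  \<open>same_edge\<close> makes the two reflections conjugate. Different edges can therefore meet
  in special points only.\<close>

lemma nonspecial_edge_unique:
  assumes g: "g \<in> adm" "g' \<in> adm"
    and Q: "Q \<in> Cimg G c g" "Q \<in> Cimg G c g'" "Q \<notin> special"
  shows "tw_class G c g = tw_class G c g'"
proof -
  obtain z w where z: "z \<in> hstar G" "c (g z) = z" "Q = orb z" and w: "w \<in> hstar G" "c (g' w) = w" "Q = orb w"
    using Q by (auto simp: Cimg_def Cset_iff)
  have "Q \<in> XR G c" using Q(1) Cimg_XR[OF g(1)] by blast
  then have "z \<in> uhp" "\<not> half_turn z" using nonspecial_uhp z Q(3) by blast+
  then obtain d where "d \<in> G" "c \<circ> g' = d \<circ> (c \<circ> g) \<circ> inv d"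
    using same_edge[OF g] z w by metis
  then have "twisted_conj G c g' g" using twisted_iff by blast
  then show ?thesis using tw_class_eq by metis
qed

lemma nonspecial_covered:
  assumes "Q \<in> XR G c" "Q \<notin> special"
  shows "\<exists>g\<in>adm. Q \<in> Cimg G c g"
proof -
  obtain z where z: "z \<in> hstar G" "Q = orb z" using assms(1) by (auto simp: XR_def topspace_X)
  then have "z \<in> uhp" using nonspecial_uhp assms by blast
  then obtain g where "g \<in> adm" "c (g z) = z" using XR_lift assms z by blast
  then have "z \<in> Cset G c g" using z by (simp add: Cset_iff)
  then show ?thesis using z \<open>g \<in> adm\<close> unfolding Cimg_def by blast
qed

lemma edge_path_reverse: "edge_path g p \<Longrightarrow> edge_path g (\<lambda>t. p (1 - t))"
proof -
  assume p: "edge_path g p"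
  have r1: "(\<lambda>t. p (1 - t)) ` {0..1} = p ` {0..1}" and r2: "(\<lambda>t. p (1 - t)) ` {0<..<1} = p ` {0<..<1}"
  proof -
    have "t \<in> (\<lambda>t. 1 - t) ` {0<..<1}" if "t \<in> {0<..<1}" for t :: real
      using that by (intro image_eqI[of _ _ "1 - t"]) auto
    then have "(\<lambda>t. 1 - t) ` {0<..<1::real} = {0<..<1}" by auto
    then show "(\<lambda>t. p (1 - t)) ` {0..1} = p ` {0..1}" "(\<lambda>t. p (1 - t)) ` {0<..<1} = p ` {0<..<1}"
      unfolding image_image[symmetric, of p "\<lambda>t. 1 - t"] by simp_all
  qed
  have flip: "openin (top_of_set {0..1}) {t \<in> {0..1}. P (1 - t)}"
    if "openin (top_of_set {0..1}) {t \<in> {0..1}. P t}" for P :: "real \<Rightarrow> bool"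
  proof -
    have "openin (top_of_set {0..1}) ({0..1} \<inter> (\<lambda>t. 1 - t) -` {t \<in> {0..1}. P t})"
      using that by (intro continuous_openin_preimage[of _ _ "{0..1}"] continuous_intros) auto
    moreover have "{0..1} \<inter> (\<lambda>t. 1 - t) -` {t \<in> {0..1}. P t} = {t \<in> {0..1}. P (1 - t)}" by auto
    ultimately show ?thesis by simp
  qed
  show "edge_path g (\<lambda>t. p (1 - t))"
    unfolding edge_path_def r1 r2
  proof (intro conjI allI impI ballI)
    show "p ` {0..1} = Cimg G c g" using edge_path_image[OF p] .
    show "p (1 - t) \<notin> special" if "t \<in> {0<..<1}" for t
      using edge_path_nonspecial[OF p] that by simp
    show "inj_on (\<lambda>t. p (1 - t)) {0<..<1}"
    proof (rule inj_onI)
      fix t t' :: real assume t: "t \<in> {0<..<1}" "t' \<in> {0<..<1}" "p (1 - t) = p (1 - t')"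
      have "1 - t = 1 - t'" using inj_onD[OF edge_path_inj[OF p] t(3)] t(1,2) by simp
      then show "t = t'" by simp
    qed
    show "p (1 - 0) \<in> special \<and> p (1 - 1) \<in> special \<or>
      p (1 - 0) = p (1 - 1) \<and> p (1 - 0) \<notin> special \<and> p (1 - 0) \<notin> p ` {0<..<1}"
      using edge_path_ends[OF p] by auto
    show "openin (top_of_set {0..1}) {t \<in> {0..1}. p (1 - t) \<in> U}" if "openin (XR_top G c) U" for U
      using flip[OF edge_path_preimage[OF p that]] .
    show "\<exists>B. refl_axis g B \<and> line_open (\<lambda>z. orb z \<in> U) B"
      if "openin (top_of_set {0..1}) {t \<in> {0..1}. p (1 - t) \<in> U}" for U
      using edge_path_line_open[OF p, of U] flip[OF that] by simp
  qed
qed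

text \<open>\<open>end0\<close> and \<open>end1\<close> are choices made without regard to the path,
  so the path may have to be reversed to match them.\<close>

lemma edge_path_oriented:
  assumes p: "edge_path g p" and g: "g \<in> adm" and e: "e = tw_class G c g"
  shows "\<exists>p. edge_path g p \<and> (edge_ends G c e \<noteq> {} \<longrightarrow> p 0 = end0 (edge_ends G c) e \<and> p 1 = end1 (edge_ends G c) e)
     \<and> (edge_ends G c e = {} \<longrightarrow> p 0 = p 1)"
proof -
  let ?S = "special" and ?E = "edge_ends G c"
  have im: "p ` {0..1} = Cimg G c g" and ns: "\<And>t. t \<in> {0<..<1} \<Longrightarrow> p t \<notin> ?S"
    and en: "(p 0 \<in> ?S \<and> p 1 \<in> ?S) \<or> (p 0 = p 1 \<and> p 0 \<notin> ?S)"
    using edge_path_image[OF p] edge_path_nonspecial[OF p] edge_path_ends[OF p] by auto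
  have "p ` {0..1} = {p 0, p 1} \<union> p ` {0<..<1}"
  proof -
    have "{0..1::real} = {0, 1} \<union> {0<..<1}" by auto
    then show ?thesis by (metis image_Un image_insert image_empty)
  qed
  then have E: "?E e = {p 0, p 1} \<inter> ?S" unfolding e edge_ends_class[OF g] im[symmetric] using ns by auto
  show ?thesis
  proof (cases "p 0 \<in> ?S \<and> p 1 \<in> ?S")
    case True
    then have E2: "?E e = {p 0, p 1}" using E by blast
    then have e0: "end0 ?E e \<in> {p 0, p 1}" using ends_in(1)[of ?E e] by simp
    \<comment> \<open>Covers the loop as well, where \<open>end1\<close> falls back on
      \<open>end0\<close>.\<close>
    have e1: "end1 ?E e = w" if "end0 ?E e = v" "{v, w} = {p 0, p 1}" for v w
    proof (cases "w = v")
      case True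
      then have "\<not> (\<exists>w\<in>?E e. w \<noteq> end0 ?E e)" using that E2 by auto
      then show ?thesis using that True by (simp only: end1_def if_False)
    next
      case False
      have ex: "\<exists>w\<in>?E e. w \<noteq> end0 ?E e" using that E2 False by auto
      have "(SOME w. w \<in> ?E e \<and> w \<noteq> end0 ?E e) = w"
        using that E2 False by (intro some_equality) auto
      then show ?thesis using ex by (simp only: end1_def if_True)
    qed
    show ?thesis
    proof (cases "end0 ?E e = p 0")
      case True
      then show ?thesis using p e1[of "p 0" "p 1"] E2 by (intro exI[of _ p]) auto
    next
      case False
      then have "end0 ?E e = p 1" using e0 by blast
      then show ?thesis using edge_path_reverse[OF p] e1[of "p 1" "p 0"] E2
        by (intro exI[of _ "\<lambda>t. p (1 - t)"]) (auto simp: insert_commute)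
    qed
  next
    case False
    then have "?E e = {}" "p 0 = p 1" using E en by auto
    then show ?thesis using p by blast
  qed
qed

text \<open>One direction is continuity of the paths. For the other, \<open>closed_criterion\<close>
  is applied to the complement, after openness has been transported from the parametrised
  representative to every \<open>g\<close> of the class.\<close>

lemma XR_open_iff:
  assumes P: "\<And>e. e \<in> edges G c \<Longrightarrow> \<exists>g\<in>adm. e = tw_class G c g \<and> edge_path g (P e)"
    and U: "U \<subseteq> XR G c"
  shows "openin (XR_top G c) U \<longleftrightarrow> (\<forall>e\<in>edges G c. openin (top_of_set {0..1}) {t \<in> {0..1}. P e t \<in> U})"
proof (intro iffI ballI)
  fix e assume "openin (XR_top G c) U" "e \<in> edges G c"
  then show "openin (top_of_set {0..1}) {t \<in> {0..1}. P e t \<in> U}"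
    using P[of e] edge_path_preimage by blast
next
  assume op: "\<forall>e\<in>edges G c. openin (top_of_set {0..1}) {t \<in> {0..1}. P e t \<in> U}"
  have "closedin (X_top G) (XR G c - U)"
  proof (rule closed_criterion)
    fix g assume g: "g \<in> adm"
    then have e: "tw_class G c g \<in> edges G c" by (simp add: edges_def)
    then obtain h where h: "h \<in> adm" "tw_class G c g = tw_class G c h" "edge_path h (P (tw_class G c g))"
      using P by blast
    then obtain B where B: "refl_axis h B" "line_open (\<lambda>z. orb z \<in> U) B"
      using edge_path_line_open[OF h(3) bspec[OF op e]] by blast
    obtain d where "d \<in> G" "c \<circ> g = d \<circ> (c \<circ> h) \<circ> inv d"
      using tw_class_eqD[OF h(1,2)] twisted_iff by blast
    then obtain B' where B': "refl_axis g B'" "line_open (\<lambda>z. orb z \<in> U) B'"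
      using line_open_transport[OF B(1) _ _ B(2)] by blast
    have "{u \<in> ldom B'. orb (line B' u) \<in> U} = {u \<in> ldom B'. orb (line B' u) \<notin> XR G c - U}"
      using line_XR[OF g B'(1)] by blast
    then have "line_open (\<lambda>z. orb z \<notin> XR G c - U) B'"
      using B'(2) by (simp only: line_open_def)
    then show "\<exists>B. refl_axis g B \<and> line_open (\<lambda>z. orb z \<notin> XR G c - U) B"
      using B'(1) by blast
  qed blast
  then have "openin (X_top G) (topspace (X_top G) - (XR G c - U))" by (rule openin_diff[OF openin_topspace])
  moreover have "U = (topspace (X_top G) - (XR G c - U)) \<inter> XR G c" using U by (auto simp: XR_def)
  ultimately show "openin (XR_top G c) U" unfolding XR_top_def openin_subtopology by blast
qed

lemma ex_edge_parametrisations: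
  assumes comp: "compact_space (X_top G)"
  obtains P where "\<And>g. g \<in> adm \<Longrightarrow> \<exists>h\<in>adm. tw_class G c g = tw_class G c h \<and> edge_path h (P (tw_class G c g))"
    "\<And>e. e \<in> edges G c \<Longrightarrow> edge_ends G c e \<noteq> {} \<Longrightarrow> P e 0 = end0 (edge_ends G c) e \<and> P e 1 = end1 (edge_ends G c) e"
    "\<And>e. e \<in> edges G c \<Longrightarrow> edge_ends G c e = {} \<Longrightarrow> P e 0 = P e 1"
proof -
  have "\<exists>p. (\<exists>h\<in>adm. e = tw_class G c h \<and> edge_path h p) \<and>
      (edge_ends G c e \<noteq> {} \<longrightarrow> p 0 = end0 (edge_ends G c) e \<and> p 1 = end1 (edge_ends G c) e) \<and>
      (edge_ends G c e = {} \<longrightarrow> p 0 = p 1)" if "e \<in> edges G c" for e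
  proof -
    obtain h where h: "h \<in> adm" "e = tw_class G c h" using \<open>e \<in> edges G c\<close> by (auto simp: edges_def)
    obtain p where "edge_path h p" using ex_edge_path[OF comp h(1)] by blast
    from edge_path_oriented[OF this h] show ?thesis using h by blast
  qed
  then obtain P where P: "\<And>e. e \<in> edges G c \<Longrightarrow> (\<exists>h\<in>adm. e = tw_class G c h \<and> edge_path h (P e)) \<and>
      (edge_ends G c e \<noteq> {} \<longrightarrow> P e 0 = end0 (edge_ends G c) e \<and> P e 1 = end1 (edge_ends G c) e) \<and>
      (edge_ends G c e = {} \<longrightarrow> P e 0 = P e 1)"
    by metis
  show ?thesis
  proof (rule that[of P])
    show "\<exists>h\<in>adm. tw_class G c g = tw_class G c h \<and> edge_path h (P (tw_class G c g))"
      if "g \<in> adm" for g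
      using P[of "tw_class G c g"] that by (simp add: edges_def)
  qed (use P in blast)+
qed

text \<open>A homeomorphic map is by definition an injective quotient map. The open sets of both
  spaces are described by the same preimages in the edge intervals, so what remains is that the
  paths meet exactly as the graph is glued.\<close>

lemma graph_homeomorphism:
  assumes comp: "compact_space (X_top G)"
  shows "\<exists>f. homeomorphic_map
                (graph_top (special) (edges G c) (edge_ends G c)) (XR_top G c) f
           \<and> (\<forall>v\<in>special. f (GV v) = v)
           \<and> (\<forall>g\<in>adm.
                f ` edge_interior (special) (edges G c) (edge_ends G c) (tw_class G c g)
                  = Cimg G c g - special)"
proof -
  let ?S = "special" and ?E = "edges G c" and ?D = "edge_ends G c"
  let ?X = "graph_top ?S ?E ?D"
  obtain P where P: "\<And>g. g \<in> adm \<Longrightarrow> \<exists>h\<in>adm. tw_class G c g = tw_class G c h \<and> edge_path h (P (tw_class G c g))"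
    and Pends: "\<And>e. e \<in> ?E \<Longrightarrow> ?D e \<noteq> {} \<Longrightarrow> P e 0 = end0 ?D e \<and> P e 1 = end1 ?D e"
    and Pcirc: "\<And>e. e \<in> ?E \<Longrightarrow> ?D e = {} \<Longrightarrow> P e 0 = P e 1"
    using ex_edge_parametrisations[OF comp] by blast
  have Pe: "\<exists>g\<in>adm. e = tw_class G c g \<and> edge_path g (P e)" if "e \<in> ?E" for e
    using P that unfolding edges_def by (metis imageE)
  have Pim: "P (tw_class G c g) ` {0..1} = Cimg G c g" if g: "g \<in> adm" for g
  proof -
    obtain h where h: "h \<in> adm" "tw_class G c g = tw_class G c h" "edge_path h (P (tw_class G c g))"
      using P[OF g] by blast
    then have "P (tw_class G c g) ` {0..1} = Cimg G c h" by (intro edge_path_image)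
    also have "Cimg G c h = Cimg G c g" using Cimg_twisted[OF tw_class_eqD[OF h(1,2)]] by simp
    finally show ?thesis .
  qed
  have DS: "?D e \<subseteq> ?S" for e by (auto simp: edge_ends_def)
  have Pns: "P e t \<notin> ?S" if e: "e \<in> ?E" and t: "0 < t" "t < 1" for e t
  proof -
    obtain g where "edge_path g (P e)" using Pe[OF e] by blast
    then show ?thesis using t by (intro edge_path_nonspecial) auto
  qed
  have Pinj: "t = t'" if e: "e \<in> ?E" and t: "0 < t" "t < 1" "0 < t'" "t' < 1" and eq: "P e t = P e t'" for e t t'
  proof -
    obtain g where "edge_path g (P e)" using Pe[OF e] by blast
    from inj_onD[OF edge_path_inj[OF this] eq] show ?thesis using t by simp
  qed
  have P0: "P e 0 \<notin> ?S" "P e 0 \<notin> P e ` {0<..<1}" if e: "e \<in> ?E" "?D e = {}" for e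
  proof -
    obtain g where g: "g \<in> adm" "e = tw_class G c g" "edge_path g (P e)" using Pe e by blast
    have "P e 0 \<in> Cimg G c g" unfolding edge_path_image[OF g(3), symmetric] by simp
    then show n: "P e 0 \<notin> ?S" using e(2) edge_ends_class[OF g(1)] unfolding g(2)[symmetric] by blast
    then show "P e 0 \<notin> P e ` {0<..<1}" using edge_path_ends[OF g(3)] by blast
  qed
  define f where "f x = (case x of GV v \<Rightarrow> v | GE e t \<Rightarrow> P e t)" for x
  have f [simp]: "f (GV v) = v" "f (GE e t) = P e t" for v e t by (simp_all add: f_def)
  \<comment> \<open>The orientation of the paths makes this hold at the glued ends too.\<close>
  have fglue: "f (glue ?D (Inr (e, t))) = P e t" if "e \<in> ?E" for e t
    using Pends[OF that] Pcirc[OF that] by (cases "?D e = {}") (auto simp: glue_def)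
  have PXR: "P e t \<in> XR G c" if "e \<in> ?E" "t \<in> {0..1}" for e t
    using that Pim Cimg_XR unfolding edges_def by blast
  have cases: thesis
    if "x \<in> topspace ?X" "\<And>v. x = GV v \<Longrightarrow> v \<in> ?S \<Longrightarrow> thesis"
      "\<And>e t. x = GE e t \<Longrightarrow> e \<in> ?E \<Longrightarrow> 0 < t \<and> t < 1 \<or> t = 0 \<and> ?D e = {} \<Longrightarrow> thesis" for x thesis
    using graph_cases[OF that(1), of thesis] DS that(2,3) by blast
  have in_graph: "GE e t \<in> topspace ?X" if "e \<in> ?E" "0 < t \<and> t < 1 \<or> t = 0 \<and> ?D e = {}" for e t
    using glue_in_graph[OF that(1), of t ?D ?S] that(2) by (auto simp: glue_def)
  have GEns: "P e t \<notin> ?S" if "e \<in> ?E" "0 < t \<and> t < 1 \<or> t = 0 \<and> ?D e = {}" for e t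
    using Pns P0 that by blast
  have reach: "\<exists>t. (0 < t \<and> t < 1 \<or> t = 0 \<and> ?D (tw_class G c g) = {}) \<and> Q = P (tw_class G c g) t"
    if g: "g \<in> adm" and Q: "Q \<in> Cimg G c g - ?S" for g Q
  proof -
    let ?e = "tw_class G c g"
    have e: "?e \<in> ?E" using g by (simp add: edges_def)
    obtain t where t: "t \<in> {0..1}" "Q = P ?e t" using Q Pim[OF g] by blast
    show ?thesis
    proof (cases "t = 0 \<or> t = 1")
      case True
      have "?D ?e = {}"
      proof (rule ccontr)
        assume ne: "?D ?e \<noteq> {}"
        then have "P ?e 0 \<in> ?S" "P ?e 1 \<in> ?S"
          using Pends[OF e ne] ends_in[of ?D, OF ne] DS[of ?e] by auto
        then show False using True t Q by auto
      qed
      then show ?thesis using True t Pcirc[OF e] by (intro exI[of _ 0]) auto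
    next
      case False
      then show ?thesis using t by (intro exI[of _ t]) auto
    qed
  qed
  have surj: "f ` topspace ?X = topspace (XR_top G c)"
  proof -
    have "topspace (XR_top G c) = XR G c" by (auto simp: XR_top_def XR_def)
    moreover have "f ` topspace ?X \<subseteq> XR G c"
    proof
      fix Q assume "Q \<in> f ` topspace ?X"
      then obtain x where x: "x \<in> topspace ?X" "Q = f x" by blast
      from x(1) show "Q \<in> XR G c"
        by (rule cases) (use x(2) special_XR PXR in auto)
    qed
    moreover have "XR G c \<subseteq> f ` topspace ?X"
    proof
      fix Q assume Q: "Q \<in> XR G c"
      show "Q \<in> f ` topspace ?X"
      proof (cases "Q \<in> ?S")
        case True
        then have "GV Q \<in> topspace ?X" unfolding topspace_graph by (force simp: glue_def)
        then show ?thesis by (metis f(1) imageI)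
      next
        case False
        then obtain g where g: "g \<in> adm" "Q \<in> Cimg G c g - ?S" using nonspecial_covered Q by blast
        have e: "tw_class G c g \<in> ?E" using g by (simp add: edges_def)
        show ?thesis using reach[OF g] in_graph[OF e] by (metis f(2) imageI)
      qed
    qed
    ultimately show ?thesis by blast
  qed
  have inj: "inj_on f (topspace ?X)"
  proof (rule inj_onI)
    fix x y assume x: "x \<in> topspace ?X" and y: "y \<in> topspace ?X" and eq: "f x = f y"
    show "x = y"
    proof (rule cases[OF x]; rule cases[OF y])
      fix e t e' t' assume e: "x = GE e t" "e \<in> ?E" "0 < t \<and> t < 1 \<or> t = 0 \<and> ?D e = {}"
        and e': "y = GE e' t'" "e' \<in> ?E" "0 < t' \<and> t' < 1 \<or> t' = 0 \<and> ?D e' = {}"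
      have PP: "P e t = P e' t'" using eq e(1) e'(1) by simp
      obtain g g' where g: "g \<in> adm" "e = tw_class G c g" and g': "g' \<in> adm" "e' = tw_class G c g'"
        using e e' by (auto simp: edges_def)
      have "P e t \<in> P e ` {0..1}" "P e' t' \<in> P e' ` {0..1}"
        using e(3) e'(3) by (intro imageI; auto)+
      then have "P e t \<in> Cimg G c g" "P e t \<in> Cimg G c g'"
        using Pim[OF g(1), folded g(2)] Pim[OF g'(1), folded g'(2)] PP by blast+
      from nonspecial_edge_unique[OF g(1) g'(1) this GEns[OF e(2,3)]]
      have ee: "e = e'" unfolding g(2) g'(2) .
      \<comment> \<open>Two interior parameters agree by \<open>Pinj\<close>; the base point of a
        circle against an interior parameter contradicts \<open>P0\<close>.\<close>
      have "t = t'" using e(3) e'(3)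
      proof (elim disjE conjE)
        assume t: "0 < t" "t < 1" and t': "t' = 0" "?D e' = {}"
        then have "P e' 0 \<in> P e' ` {0<..<1}" using PP unfolding ee by (auto intro!: image_eqI[of _ _ t])
        then show ?thesis using P0(2)[OF e'(2) t'(2)] by blast
      next
        assume t': "0 < t'" "t' < 1" and t: "t = 0" "?D e = {}"
        then have "P e 0 \<in> P e ` {0<..<1}" using PP unfolding ee by (auto intro!: image_eqI[of _ _ t'])
        then show ?thesis using P0(2)[OF e(2) t(2)] by blast
      qed (use Pinj[OF e(2)] PP ee in auto)
      then show ?thesis using e e' ee by simp
    qed (use eq GEns in auto)
  qed
  have op: "openin ?X {x \<in> topspace ?X. f x \<in> U} \<longleftrightarrow> openin (XR_top G c) U" if U: "U \<subseteq> topspace (XR_top G c)" for U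
  proof -
    have UX: "U \<subseteq> XR G c" using U by (auto simp: XR_top_def)
    have "{t \<in> {0..1}. glue ?D (Inr (e, t)) \<in> {x \<in> topspace ?X. f x \<in> U}} = {t \<in> {0..1}. P e t \<in> U}" if "e \<in> ?E" for e
      using that glue_in_graph[OF that, of _ ?D ?S] fglue by auto
    moreover have "openin (XR_top G c) U \<longleftrightarrow> (\<forall>e\<in>?E. openin (top_of_set {0..1}) {t \<in> {0..1}. P e t \<in> U})"
      by (rule XR_open_iff[OF _ UX]) (rule Pe)
    ultimately show ?thesis unfolding openin_graph by auto
  qed
  have "homeomorphic_map ?X (XR_top G c) f"
    unfolding homeomorphic_map_def quotient_map_def using surj inj op by blast
  moreover have "f ` edge_interior ?S ?E ?D (tw_class G c g) = Cimg G c g - ?S" if g: "g \<in> adm" for g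
  proof
    let ?e = "tw_class G c g"
    have e: "?e \<in> ?E" using g by (simp add: edges_def)
    show "f ` edge_interior ?S ?E ?D ?e \<subseteq> Cimg G c g - ?S"
    proof
      fix Q assume "Q \<in> f ` edge_interior ?S ?E ?D ?e"
      then obtain t where t: "GE ?e t \<in> topspace ?X" "Q = P ?e t" by (auto simp: edge_interior_def)
      from t(1) have "0 < t \<and> t < 1 \<or> t = 0 \<and> ?D ?e = {}" by (rule cases) auto
      moreover from this have "P ?e t \<in> P ?e ` {0..1}" by (intro imageI) auto
      ultimately show "Q \<in> Cimg G c g - ?S" using GEns[OF e] t(2) Pim[OF g] by simp
    qed
    show "Cimg G c g - ?S \<subseteq> f ` edge_interior ?S ?E ?D ?e"
    proof
      fix Q assume "Q \<in> Cimg G c g - ?S"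
      then obtain t where t: "0 < t \<and> t < 1 \<or> t = 0 \<and> ?D ?e = {}" "Q = P ?e t" using reach[OF g] by blast
      then have "GE ?e t \<in> edge_interior ?S ?E ?D ?e" using in_graph[OF e t(1)] by (simp add: edge_interior_def)
      then show "Q \<in> f ` edge_interior ?S ?E ?D ?e" using t(2) by (metis f(2) imageI)
    qed
  qed
  ultimately show ?thesis using f(1) by blast
qed

end

text \<open>The interior of an image of a geodesic is expressed by removing the special points. That
  \<open>f\<close> is a homeomorphism on each edge interior follows by restriction, so only the
  image is recorded.\<close>

theorem theorem3p1:
  fixes G :: "(hpt \<Rightarrow> hpt) set" and c :: "hpt \<Rightarrow> hpt"
  assumes "real_fuchsian G c"
    and "compact_space (X_top G)"
  shows "\<exists>f. homeomorphic_map
                (graph_top (special_pts G c) (edges G c) (edge_ends G c)) (XR_top G c) f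
           \<and> (\<forall>v\<in>special_pts G c. f (GV v) = v)
           \<and> (\<forall>g\<in>admissible G c.
                f ` edge_interior (special_pts G c) (edges G c) (edge_ends G c) (tw_class G c g)
                  = Cimg G c g - special_pts G c)"
proof -
  interpret real_fuchsian_group G c using assms(1) by unfold_locales
  show ?thesis using graph_homeomorphism[OF assms(2)] .
qed

end
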